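(* Let $(M,\omega)$ be a four-dimensional symplectic manifold with two distinct commuting antisymplectic involutions $\rho_1,\rho_2$, and let $(H_s)_{s\in(-\epsilon,\epsilon)}$, $\epsilon>0$, be a smooth family of smooth functions $H_s\colon M\to\mathbb{R}$, each invariant under both $\rho_1$ and $\rho_2$. Let $(v_s)_{s\in(-\epsilon,\epsilon)}$ be a smooth family in which $v_s$ is a simple periodic orbit of $X_{H_s}$, with period $\tau_s$ depending smoothly on $s$, and suppose that $v_s$ is doubly symmetric (with respect to $\rho_1,\rho_2$) for all $s<0$. Then the family does not undergo a period doubling bifurcation at $s=0$; that is, it is not possible that $v_s$ is elliptic for all $s<0$ and negative hyperbolic for all $s>0$.
   Context: Conventions. A diffeomorphism $\rho$ of $M$ is an antisymplectic involution if $\rho^2=\mathrm{id}$ and $\rho^*\omega=-\omega$. For a smooth function $H$ on $M$, the Hamiltonian vector field $X_H$ is defined by $dH=\omega(\cdot,X_H)$, and $\phi^t_H$ denotes its flow. Put $S^1=\mathbb{R}/\mathbb{Z}$. A simple periodic orbit of $X_H$ is an injective map $v\colon S^1\to M$ for which there is $\tau>0$ (its period) with $\partial_t v(t)=\tau X_H(v(t))$ for all $t\in S^1$. Doubly symmetric orbits. A simple periodic orbit $v$ is symmetric with respect to $\rho_1$ if $\rho_1(v(-t))=v(t)$ for all $t\in S^1$. It is doubly symmetric (with respect to $\rho_1,\rho_2$) if it is symmetric with respect to $\rho_1$ and in addition $\rho_2(v(0))=v(\tfrac12)$. Reduced monodromy. Let $\Sigma=H^{-1}(H(v(0)))$, which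 is a hypersurface near $v$. The linear map $d\phi^\tau_H(v(0))$ preserves $T_{v(0)}\Sigma$ and fixes $X_H(v(0))$. The induced map $M_v$ on the two-dimensional symplectic vector space $T_{v(0)}\Sigma/\langle X_H(v(0))\rangle$ is the reduced monodromy; $\det M_v=1$. The orbit $v$ is positive hyperbolic if $\mathrm{tr}(M_v)>2$, negative hyperbolic if $\mathrm{tr}(M_v)<-2$, and elliptic if $-2\le\mathrm{tr}(M_v)\le 2$. Period doubling bifurcation refers to the transition, in a family of periodic orbits, from an elliptic periodic orbit to a negative hyperbolic one. *)

theory Defs
  imports "HOL-Analysis.Analysis" "HOL-Library.Function_Algebras"
begin

section \<open>Smooth functions between normed spaces\<close>

text \<open>
  The following notions are meant for open \<open>S\<close> in a finite-dimensional space; there, having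
  directional derivatives of class \<open>C\<^sup>k\<close> in all directions is the same as having a Frechet
  derivative of class \<open>C\<^sup>k\<close>.
\<close>

primrec Ck_on :: "nat \<Rightarrow> 'e::real_normed_vector set \<Rightarrow> ('e \<Rightarrow> 'f::real_normed_vector) \<Rightarrow> bool" where
  "Ck_on 0 S f \<longleftrightarrow> continuous_on S f"
| "Ck_on (Suc k) S f \<longleftrightarrow>
     (\<forall>x\<in>S. f differentiable (at x)) \<and> (\<forall>w. Ck_on k S (\<lambda>x. frechet_derivative f (at x) w))"

definition smooth_on :: "'e::real_normed_vector set \<Rightarrow> ('e \<Rightarrow> 'f::real_normed_vector) \<Rightarrow> bool" where
  "smooth_on S f \<longleftrightarrow> (\<forall>k. Ck_on k S f)"

section \<open>Smooth manifolds\<close>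

text \<open>
  The manifold is the whole type \<open>'a\<close>. The Hausdorff property and second countability are carried
  by its type classes; the smooth structure is given by an atlas, not necessarily maximal. The
  model space \<open>'e\<close> fixes the dimension.
\<close>

type_synonym ('a, 'e) chart = "'a set \<times> ('a \<Rightarrow> 'e)"

definition chart_image :: "('a, 'e) chart \<Rightarrow> 'e set" where
  "chart_image c = snd c ` fst c"

definition chart_inv :: "('a, 'e) chart \<Rightarrow> 'e \<Rightarrow> 'a" where
  "chart_inv c = inv_into (fst c) (snd c)"

definition smooth_atlas ::
    "('a::{t2_space, second_countable_topology}, 'e::euclidean_space) chart set \<Rightarrow> bool" where
  "smooth_atlas A \<longleftrightarrow>
     (\<Union>c\<in>A. fst c) = UNIV \<and>
     (\<forall>c\<in>A. open (fst c) \<and> open (chart_image c) \<and>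
        homeomorphism (fst c) (chart_image c) (snd c) (chart_inv c)) \<and>
     (\<forall>c\<in>A. \<forall>d\<in>A. smooth_on (snd c ` (fst c \<inter> fst d)) (snd d \<circ> chart_inv c))"

definition charts_at :: "('a, 'e) chart set \<Rightarrow> 'a \<Rightarrow> ('a, 'e) chart set" where
  "charts_at A p = {c \<in> A. p \<in> fst c}"

definition chart_at :: "('a, 'e) chart set \<Rightarrow> 'a \<Rightarrow> ('a, 'e) chart" where
  "chart_at A p = (SOME c. c \<in> charts_at A p)"

definition smooth_map ::
    "('a::topological_space, 'e::euclidean_space) chart set \<Rightarrow> ('a \<Rightarrow> 'a) \<Rightarrow> bool" where
  "smooth_map A f \<longleftrightarrow> continuous_on UNIV f \<and>
     (\<forall>c\<in>A. \<forall>d\<in>A. smooth_on (snd c ` (fst c \<inter> f -` fst d)) (snd d \<circ> f \<circ> chart_inv c))"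

section \<open>Tangent vectors\<close>

instantiation "fun" :: (type, real_vector) real_vector
begin
definition scaleR_fun :: "real \<Rightarrow> ('a \<Rightarrow> 'b) \<Rightarrow> 'a \<Rightarrow> 'b" where
  "scaleR_fun r f = (\<lambda>x. r *\<^sub>R f x)"
instance
  by standard (simp_all add: scaleR_fun_def fun_eq_iff algebra_simps)
end

text \<open>
  A tangent vector at \<open>p\<close> assigns to every chart around \<open>p\<close> its coordinate vector in that chart,
  subject to the transformation rule under change of charts. The value at other charts is set
  to \<open>0\<close>, so that tangent vectors with equal coordinates are equal.
\<close>

type_synonym ('a, 'e) tvec = "('a, 'e) chart \<Rightarrow> 'e"

definition tangent_space ::
    "('a, 'e::euclidean_space) chart set \<Rightarrow> 'a \<Rightarrow> ('a, 'e) tvec set" where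
  "tangent_space A p =
     {\<xi>. (\<forall>c. c \<notin> charts_at A p \<longrightarrow> \<xi> c = 0) \<and>
         (\<forall>c\<in>charts_at A p. \<forall>d\<in>charts_at A p.
            \<xi> d = frechet_derivative (snd d \<circ> chart_inv c) (at (snd c p)) (\<xi> c))}"

text \<open>The tangent vector at \<open>p\<close> with coordinates \<open>w\<close> in the chart \<open>c\<close>:\<close>

definition coord_vec ::
    "('a, 'e::euclidean_space) chart set \<Rightarrow> ('a, 'e) chart \<Rightarrow> 'a \<Rightarrow> 'e \<Rightarrow> ('a, 'e) tvec" where
  "coord_vec A c p w = (\<lambda>d. if d \<in> charts_at A p
     then frechet_derivative (snd d \<circ> chart_inv c) (at (snd c p)) w else 0)"

definition dmap :: "('a, 'e::euclidean_space) chart set \<Rightarrow> ('a \<Rightarrow> 'a) \<Rightarrow> 'a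
    \<Rightarrow> ('a, 'e) tvec \<Rightarrow> ('a, 'e) tvec" where
  "dmap A f p \<xi> = (let c = chart_at A p in
     (\<lambda>d. if d \<in> charts_at A (f p)
          then frechet_derivative (snd d \<circ> f \<circ> chart_inv c) (at (snd c p)) (\<xi> c) else 0))"

definition dfun :: "('a, 'e::euclidean_space) chart set \<Rightarrow> ('a \<Rightarrow> real) \<Rightarrow> 'a
    \<Rightarrow> ('a, 'e) tvec \<Rightarrow> real" where
  "dfun A H p \<xi> = (let c = chart_at A p in
     frechet_derivative (H \<circ> chart_inv c) (at (snd c p)) (\<xi> c))"

definition has_velocity :: "('a::topological_space, 'e::euclidean_space) chart set
    \<Rightarrow> (real \<Rightarrow> 'a) \<Rightarrow> ('a, 'e) tvec \<Rightarrow> real \<Rightarrow> bool" where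
  "has_velocity A \<gamma> \<xi> t \<longleftrightarrow> \<xi> \<in> tangent_space A (\<gamma> t) \<and> isCont \<gamma> t \<and>
     (\<forall>c\<in>charts_at A (\<gamma> t). ((snd c \<circ> \<gamma>) has_vector_derivative \<xi> c) (at t))"

text \<open>
  Velocities of curves contained in \<open>S\<close>. For a hypersurface \<open>S\<close> (near \<open>p\<close>) this is its tangent
  space at \<open>p\<close>.
\<close>

definition tangent_space_of :: "('a::topological_space, 'e::euclidean_space) chart set
    \<Rightarrow> 'a set \<Rightarrow> 'a \<Rightarrow> ('a, 'e) tvec set" where
  "tangent_space_of A S p = {\<xi>. \<exists>\<gamma>. \<gamma> 0 = p \<and> (\<forall>t. \<gamma> t \<in> S) \<and> has_velocity A \<gamma> \<xi> 0}"

section \<open>Symplectic forms, antisymplectic involutions\<close>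

text \<open>
  A differential 2-form is a function \<open>\<omega>\<close> such that \<open>\<omega> p\<close> is an alternating bilinear form on the
  tangent space at \<open>p\<close>; its values off the tangent space are irrelevant.
\<close>

definition form_in_chart :: "('a, 'e::euclidean_space) chart set
    \<Rightarrow> ('a \<Rightarrow> ('a, 'e) tvec \<Rightarrow> ('a, 'e) tvec \<Rightarrow> real) \<Rightarrow> ('a, 'e) chart
    \<Rightarrow> 'e \<Rightarrow> 'e \<Rightarrow> 'e \<Rightarrow> real" where
  "form_in_chart A \<omega> c x u w =
     \<omega> (chart_inv c x) (coord_vec A c (chart_inv c x) u) (coord_vec A c (chart_inv c x) w)"

definition two_form :: "('a, 'e::euclidean_space) chart set
    \<Rightarrow> ('a \<Rightarrow> ('a, 'e) tvec \<Rightarrow> ('a, 'e) tvec \<Rightarrow> real) \<Rightarrow> bool" where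
  "two_form A \<omega> \<longleftrightarrow>
     (\<forall>p. \<forall>\<xi>\<in>tangent_space A p. \<forall>\<eta>\<in>tangent_space A p. \<forall>\<zeta>\<in>tangent_space A p. \<forall>r.
        \<omega> p (r *\<^sub>R \<xi> + \<eta>) \<zeta> = r * \<omega> p \<xi> \<zeta> + \<omega> p \<eta> \<zeta> \<and> \<omega> p \<xi> \<eta> = - \<omega> p \<eta> \<xi>) \<and>
     (\<forall>c\<in>A. \<forall>u w. smooth_on (chart_image c) (\<lambda>x. form_in_chart A \<omega> c x u w))"

text \<open>
  \<open>d\<omega> = 0\<close>, evaluated on triples of coordinate vector fields, which commute.
\<close>

definition closed_form :: "('a, 'e::euclidean_space) chart set
    \<Rightarrow> ('a \<Rightarrow> ('a, 'e) tvec \<Rightarrow> ('a, 'e) tvec \<Rightarrow> real) \<Rightarrow> bool" where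
  "closed_form A \<omega> \<longleftrightarrow> (\<forall>c\<in>A. \<forall>x\<in>chart_image c. \<forall>u v w.
       frechet_derivative (\<lambda>y. form_in_chart A \<omega> c y v w) (at x) u
     + frechet_derivative (\<lambda>y. form_in_chart A \<omega> c y w u) (at x) v
     + frechet_derivative (\<lambda>y. form_in_chart A \<omega> c y u v) (at x) w = 0)"

definition nondegenerate_form :: "('a, 'e::euclidean_space) chart set
    \<Rightarrow> ('a \<Rightarrow> ('a, 'e) tvec \<Rightarrow> ('a, 'e) tvec \<Rightarrow> real) \<Rightarrow> bool" where
  "nondegenerate_form A \<omega> \<longleftrightarrow>
     (\<forall>p. \<forall>\<xi>\<in>tangent_space A p. (\<forall>\<eta>\<in>tangent_space A p. \<omega> p \<xi> \<eta> = 0) \<longrightarrow> \<xi> = 0)"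

definition symplectic_manifold ::
    "('a::{t2_space, second_countable_topology}, 'e::euclidean_space) chart set
     \<Rightarrow> ('a \<Rightarrow> ('a, 'e) tvec \<Rightarrow> ('a, 'e) tvec \<Rightarrow> real) \<Rightarrow> bool" where
  "symplectic_manifold A \<omega> \<longleftrightarrow>
     smooth_atlas A \<and> two_form A \<omega> \<and> closed_form A \<omega> \<and> nondegenerate_form A \<omega>"

text \<open>A smooth map with \<open>\<rho> \<circ> \<rho> = id\<close> is a diffeomorphism.\<close>

definition antisymplectic_involution :: "('a::topological_space, 'e::euclidean_space) chart set
    \<Rightarrow> ('a \<Rightarrow> ('a, 'e) tvec \<Rightarrow> ('a, 'e) tvec \<Rightarrow> real) \<Rightarrow> ('a \<Rightarrow> 'a) \<Rightarrow> bool" where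
  "antisymplectic_involution A \<omega> \<rho> \<longleftrightarrow>
     smooth_map A \<rho> \<and> \<rho> \<circ> \<rho> = id \<and>
     (\<forall>p. \<forall>\<xi>\<in>tangent_space A p. \<forall>\<eta>\<in>tangent_space A p.
        \<omega> (\<rho> p) (dmap A \<rho> p \<xi>) (dmap A \<rho> p \<eta>) = - \<omega> p \<xi> \<eta>)"

section \<open>Hamiltonian dynamics\<close>

definition ham_vf :: "('a, 'e::euclidean_space) chart set
    \<Rightarrow> ('a \<Rightarrow> ('a, 'e) tvec \<Rightarrow> ('a, 'e) tvec \<Rightarrow> real) \<Rightarrow> ('a \<Rightarrow> real) \<Rightarrow> 'a \<Rightarrow> ('a, 'e) tvec" where
  "ham_vf A \<omega> H p = (THE X. X \<in> tangent_space A p \<and>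
     (\<forall>\<xi>\<in>tangent_space A p. dfun A H p \<xi> = \<omega> p \<xi> X))"

text \<open>
  The flow need not be complete: \<open>flow A X t p\<close> is meaningful whenever an integral curve starting
  at \<open>p\<close> exists up to time \<open>t\<close>, and unspecified otherwise.
\<close>

definition flow :: "('a::topological_space, 'e::euclidean_space) chart set
    \<Rightarrow> ('a \<Rightarrow> ('a, 'e) tvec) \<Rightarrow> real \<Rightarrow> 'a \<Rightarrow> 'a" where
  "flow A X t p = (THE q. \<exists>\<gamma> I. open I \<and> connected I \<and> 0 \<in> I \<and> t \<in> I \<and>
     (\<forall>r\<in>I. has_velocity A \<gamma> (X (\<gamma> r)) r) \<and> \<gamma> 0 = p \<and> \<gamma> t = q)"

text \<open>Maps on \<open>S\<^sup>1 = \<real>/\<int>\<close> are represented by 1-periodic maps on \<open>\<real>\<close>.\<close>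

definition simple_periodic_orbit :: "('a::topological_space, 'e::euclidean_space) chart set
    \<Rightarrow> ('a \<Rightarrow> ('a, 'e) tvec) \<Rightarrow> (real \<Rightarrow> 'a) \<Rightarrow> real \<Rightarrow> bool" where
  "simple_periodic_orbit A X v \<tau> \<longleftrightarrow>
     (\<forall>t. v (t + 1) = v t) \<and> (\<forall>t t'. v t = v t' \<longrightarrow> t - t' \<in> \<int>) \<and>
     \<tau> > 0 \<and> (\<forall>t. has_velocity A v (\<tau> *\<^sub>R X (v t)) t)"

definition symmetric_orbit :: "('a \<Rightarrow> 'a) \<Rightarrow> (real \<Rightarrow> 'a) \<Rightarrow> bool" where
  "symmetric_orbit \<rho> v \<longleftrightarrow> (\<forall>t. \<rho> (v (- t)) = v t)"

definition doubly_symmetric_orbit ::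
    "('a \<Rightarrow> 'a) \<Rightarrow> ('a \<Rightarrow> 'a) \<Rightarrow> (real \<Rightarrow> 'a) \<Rightarrow> bool" where
  "doubly_symmetric_orbit \<rho>\<^sub>1 \<rho>\<^sub>2 v \<longleftrightarrow> symmetric_orbit \<rho>\<^sub>1 v \<and> \<rho>\<^sub>2 (v 0) = v (1/2)"

section \<open>Reduced monodromy\<close>

definition coset :: "'v::real_vector set \<Rightarrow> 'v \<Rightarrow> 'v set" where
  "coset L x = {x + y | y. y \<in> L}"

definition quotient_space :: "'v::real_vector set \<Rightarrow> 'v set \<Rightarrow> 'v set set" where
  "quotient_space V L = coset L ` V"

definition induced_map :: "'v::real_vector set \<Rightarrow> ('v \<Rightarrow> 'v) \<Rightarrow> 'v set \<Rightarrow> 'v set" where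
  "induced_map L f C = (\<Union>x\<in>C. coset L (f x))"

text \<open>The classes of \<open>e i\<close> form a basis of the quotient \<open>V/L\<close>:\<close>

definition quotient_basis ::
    "'v::real_vector set \<Rightarrow> 'v set \<Rightarrow> ('n::finite \<Rightarrow> 'v) \<Rightarrow> bool" where
  "quotient_basis V L e \<longleftrightarrow> (\<forall>i. e i \<in> V) \<and>
     (\<forall>C\<in>quotient_space V L. \<exists>!a::real^'n. C = coset L (\<Sum>i\<in>UNIV. a $ i *\<^sub>R e i))"

text \<open>Trace of a linear endomorphism of a two-dimensional quotient \<open>V/L\<close>, read off from its
  matrix \<open>B\<close> with respect to any basis:\<close>

definition quotient_trace :: "'v::real_vector set \<Rightarrow> 'v set \<Rightarrow> ('v set \<Rightarrow> 'v set) \<Rightarrow> real" where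
  "quotient_trace V L F = (THE x. \<exists>(e :: 2 \<Rightarrow> 'v) (B :: real^2^2). quotient_basis V L e \<and>
     (\<forall>j. F (coset L (e j)) = coset L (\<Sum>i\<in>UNIV. B $ i $ j *\<^sub>R e i)) \<and> x = trace B)"

definition energy_surface :: "('a \<Rightarrow> real) \<Rightarrow> (real \<Rightarrow> 'a) \<Rightarrow> 'a set" where
  "energy_surface H v = H -` {H (v 0)}"

definition reduced_monodromy :: "('a::topological_space, 'e::euclidean_space) chart set
    \<Rightarrow> ('a \<Rightarrow> ('a, 'e) tvec \<Rightarrow> ('a, 'e) tvec \<Rightarrow> real) \<Rightarrow> ('a \<Rightarrow> real) \<Rightarrow> (real \<Rightarrow> 'a) \<Rightarrow> real
    \<Rightarrow> ('a, 'e) tvec set \<Rightarrow> ('a, 'e) tvec set" where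
  "reduced_monodromy A \<omega> H v \<tau> =
     induced_map (span {ham_vf A \<omega> H (v 0)}) (dmap A (flow A (ham_vf A \<omega> H) \<tau>) (v 0))"

definition monodromy_trace :: "('a::topological_space, 'e::euclidean_space) chart set
    \<Rightarrow> ('a \<Rightarrow> ('a, 'e) tvec \<Rightarrow> ('a, 'e) tvec \<Rightarrow> real) \<Rightarrow> ('a \<Rightarrow> real) \<Rightarrow> (real \<Rightarrow> 'a) \<Rightarrow> real
    \<Rightarrow> real" where
  "monodromy_trace A \<omega> H v \<tau> =
     quotient_trace (tangent_space_of A (energy_surface H v) (v 0)) (span {ham_vf A \<omega> H (v 0)})
       (reduced_monodromy A \<omega> H v \<tau>)"

definition elliptic_orbit :: "('a::topological_space, 'e::euclidean_space) chart set
    \<Rightarrow> ('a \<Rightarrow> ('a, 'e) tvec \<Rightarrow> ('a, 'e) tvec \<Rightarrow> real) \<Rightarrow> ('a \<Rightarrow> real) \<Rightarrow> (real \<Rightarrow> 'a) \<Rightarrow> real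
    \<Rightarrow> bool" where
  "elliptic_orbit A \<omega> H v \<tau> \<longleftrightarrow>
     - 2 \<le> monodromy_trace A \<omega> H v \<tau> \<and> monodromy_trace A \<omega> H v \<tau> \<le> 2"

definition negative_hyperbolic_orbit :: "('a::topological_space, 'e::euclidean_space) chart set
    \<Rightarrow> ('a \<Rightarrow> ('a, 'e) tvec \<Rightarrow> ('a, 'e) tvec \<Rightarrow> real) \<Rightarrow> ('a \<Rightarrow> real) \<Rightarrow> (real \<Rightarrow> 'a) \<Rightarrow> real
    \<Rightarrow> bool" where
  "negative_hyperbolic_orbit A \<omega> H v \<tau> \<longleftrightarrow> monodromy_trace A \<omega> H v \<tau> < - 2"

section \<open>Smooth families\<close>

text \<open>Joint smoothness of \<open>(s, p) \<mapsto> H s p\<close> and of \<open>(s, t) \<mapsto> v s t\<close> for \<open>s \<in> J\<close>, \<open>J\<close> an open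
  interval:\<close>

definition smooth_function_family :: "('a, 'e::euclidean_space) chart set \<Rightarrow> real set
    \<Rightarrow> (real \<Rightarrow> 'a \<Rightarrow> real) \<Rightarrow> bool" where
  "smooth_function_family A J H \<longleftrightarrow>
     (\<forall>c\<in>A. smooth_on (J \<times> chart_image c) (\<lambda>(s, x). H s (chart_inv c x)))"

definition smooth_curve_family :: "('a::topological_space, 'e::euclidean_space) chart set
    \<Rightarrow> real set \<Rightarrow> (real \<Rightarrow> real \<Rightarrow> 'a) \<Rightarrow> bool" where
  "smooth_curve_family A J v \<longleftrightarrow>
     continuous_on (J \<times> UNIV) (\<lambda>(s, t). v s t) \<and>
     (\<forall>c\<in>A. smooth_on {(s, t). s \<in> J \<and> v s t \<in> fst c} (\<lambda>(s, t). snd c (v s t)))"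

end

(*
  Let s be a parameter for which the orbit v_s is doubly symmetric, and p = v_s(0). Then
  sigma = rho_1 rho_2 satisfies sigma(v_s(t)) = v_s(t + 1/2), so that N, the composition of sigma with
  the flow over half a period, fixes p, and the flow over a full period is N^2. Moreover R = rho_1
  satisfies R^2 = id and N R N = R near p. On the two-dimensional reduced space this forces
  det N = 1 or det N = -1, hence tr(N^2) = (tr N)^2 - 2 det N is at least -2, and if it equals -2, then
  det N = 1, tr N = 0, and N^2 = -id has no eigenvalue 1.

  If v_s is doubly symmetric for s < 0 and negative hyperbolic for s > 0, then v_0 is doubly symmetric
  and its reduced monodromy has trace at most -2, so 1 is not an eigenvalue. Hence v_0 is isolated
  on its energy level, uniformly in s: for small s > 0 the images of v_s under the symmetries, being
  closed orbits of the same energy and period close to v_0, are reparametrizations of v_s.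
  So v_s is doubly symmetric up to a shift of the time and its trace is at least -2, a contradiction.
*)

theory Submission
  imports Defs
begin

section \<open>Traces on the reduced space\<close>

text \<open>N R N = R holds because \<sigma> preserves \<omega> and the energy, hence commutes with
  the flow, while \<open>\<rho>\<^sub>1\<close> reverses it. So N is conjugate to its inverse, which
  yields its determinant up to sign. All traces are those of 4 x 4 matrices in a chart: the line of
  X and the quotient by the energy level add 1 each, so the reduced bound -2 reads 0. The symmetry
  is given only on the left and hyperbolicity only on the right. The trace at the middle parameter
  is a limit from the right, hence at most -2, while the symmetry inherited from the left excludes
  smaller values and describes the case of equality. This squeeze supplies the nondegeneracy.
  Isolation is shown without solving for fixed points: the difference of two nearby fixed points
  satisfies a linear equation up to a small error, and an injective linear map is bounded below. For
  one neighbourhood to serve all s, the flow has to be strictly differentiable in space, uniformly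
  in s; the ODE theory is built for that notion. The varying period is absorbed into the field
  \<tau> X, so that time 1 serves the whole family.\<close>

lemma mat4_trace: "trace (A::real^4^4) = A$1$1 + A$2$2 + A$3$3 + A$4$4"
  by (simp add: trace_def sum_4)

text \<open>Applying \<open>\<alpha>\<close> to a vanishing combination removes \<open>w\<close>,
  then \<open>ind\<close> removes \<open>b\<close> and \<open>b'\<close>, and
  \<open>X \<noteq> 0\<close> the rest. Independence of \<open>b\<close>, \<open>b'\<close> is
  required modulo the line of \<open>X\<close>, as is natural for representatives of classes in the
  quotient.\<close>

lemma frame_invertible:
  fixes X b b' w :: "real^4" and \<alpha> :: "real^4 \<Rightarrow> real"
  assumes "linear \<alpha>" "X \<noteq> 0" "\<alpha> X = 0" "\<alpha> w = 1" "\<alpha> b = 0" "\<alpha> b' = 0"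
    and ind: "\<forall>k l m. k *\<^sub>R X + l *\<^sub>R b + m *\<^sub>R b' = 0 \<longrightarrow> l = 0 \<and> m = 0"
  defines "P \<equiv> (\<chi> i j. if j = 1 then X$i else if j = 2 then b$i else if j = 3 then b'$i else w$i) :: real^4^4"
  shows "invertible P" "\<And>x. P *v x = x$1 *\<^sub>R X + x$2 *\<^sub>R b + x$3 *\<^sub>R b' + x$4 *\<^sub>R w"
    "\<And>x. \<alpha> (P *v x) = x$4"
proof -
  show Px: "P *v x = x$1 *\<^sub>R X + x$2 *\<^sub>R b + x$3 *\<^sub>R b' + x$4 *\<^sub>R w" for x
    by (simp add: P_def vec_eq_iff matrix_vector_mult_def sum_4)
  show aPx: "\<alpha> (P *v x) = x$4" for x
    using assms(1,3-6) by (simp add: Px linear_add linear_scale)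
  have "x = 0" if "P *v x = 0" for x
  proof -
    have "x$4 = 0" using aPx[of x] that assms(1) by (simp add: linear_0)
    moreover from this have "x$2 = 0 \<and> x$3 = 0" using ind[rule_format, of "x$1" "x$2" "x$3"] that by (simp add: Px)
    moreover from calculation have "x$1 = 0" using that assms(2) by (simp add: Px)
    ultimately show ?thesis by (simp add: vec_eq_iff forall_4)
  qed
  then show "invertible P"
    by (metis invertible_left_inverse matrix_left_invertible_ker)
qed

text \<open>With \<open>a\<close> the vector representing \<open>\<alpha>\<close>, the middle
  columns are an orthonormal basis of the complement of \<open>a\<close> and \<open>X\<close>, and
  the last is a multiple of \<open>a\<close>. Maps that scale \<open>X\<close> and preserve
  \<open>\<alpha>\<close> become block triangular in such a frame.\<close>

lemma adapted_frame:
  fixes X :: "real^4" and \<alpha> :: "real^4 \<Rightarrow> real"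
  assumes lin: "linear \<alpha>" and X: "X \<noteq> 0" "\<alpha> X = 0" and a: "\<alpha> w0 \<noteq> 0"
  obtains P :: "real^4^4" where "invertible P" "P *v axis 1 1 = X" "\<And>x. \<alpha> (P *v x) = x$4"
proof -
  define a where "a = adjoint \<alpha> 1"
  have al: "\<alpha> x = a \<bullet> x" for x
    using adjoint_works[OF lin, of x 1] by (simp add: a_def inner_commute)
  have a0: "a \<noteq> 0" using a by (auto simp: al)
  have aX: "a \<bullet> X = 0" using X by (simp add: al)
  define A where "A = span {a, X}"
  have "independent {a, X}"
    using a0 X aX by (intro pairwise_orthogonal_independent)
      (auto simp: pairwise_def orthogonal_def inner_commute)
  moreover have "a \<noteq> X" using aX a0 by auto
  ultimately have dA: "dim A = 2" by (simp add: A_def dim_eq_card_independent)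
  define U where "U = {y\<in>UNIV. \<forall>x\<in>A. orthogonal x y}"
  have "dim U + dim A = dim (UNIV::(real^4) set)"
    unfolding U_def by (rule dim_subspace_orthogonal_to_vectors) (auto simp: A_def)
  then have dU: "dim U = 2" using dA by simp
  have sU: "subspace U"
    unfolding U_def by (auto simp: subspace_def orthogonal_def inner_add_right)
  obtain B where B: "B \<subseteq> U" "pairwise orthogonal B" "\<And>x. x \<in> B \<Longrightarrow> norm x = 1" "card B = 2"
    using orthonormal_basis_subspace[OF sU] dU by metis
  obtain b b' where bb: "B = {b, b'}" "b \<noteq> b'" using B(4) by (auto simp: card_2_iff)
  have o: "b \<bullet> b' = 0" "b \<bullet> b = 1" "b' \<bullet> b' = 1" "b' \<bullet> b = 0"
    using B(2,3) bb by (auto simp: pairwise_def orthogonal_def dot_square_norm)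
  have "a \<in> A" "X \<in> A" by (auto simp: A_def span_base)
  then have oa: "a \<bullet> b = 0" "a \<bullet> b' = 0" "X \<bullet> b = 0" "X \<bullet> b' = 0"
    using B(1) bb by (auto simp: U_def orthogonal_def)
  have ind: "\<forall>k l m. k *\<^sub>R X + l *\<^sub>R b + m *\<^sub>R b' = 0 \<longrightarrow> l = 0 \<and> m = 0"
  proof (intro allI impI)
    fix k l m assume that: "k *\<^sub>R X + l *\<^sub>R b + m *\<^sub>R b' = 0"
    have "(k *\<^sub>R X + l *\<^sub>R b + m *\<^sub>R b') \<bullet> b = 0" "(k *\<^sub>R X + l *\<^sub>R b + m *\<^sub>R b') \<bullet> b' = 0"
      using that by auto
    then show "l = 0 \<and> m = 0" using o oa by (simp add: inner_add_left)
  qed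
  have w: "\<alpha> (a /\<^sub>R (a \<bullet> a)) = 1" "\<alpha> b = 0" "\<alpha> b' = 0" using a0 oa by (auto simp: al)
  note fr = frame_invertible[OF lin X w ind]
  show thesis by (rule that[OF fr(1) _ fr(3)]) (auto simp: fr(2) axis_def)
qed

lemma matrix_inv_right:
  fixes P :: "real^'n^'n"
  assumes "invertible P"
  shows "P ** matrix_inv P = mat 1"
  using someI_ex[OF assms[unfolded invertible_def]] by (simp add: matrix_inv_def)

lemma matrix_inv_left:
  fixes P :: "real^'n^'n"
  assumes "invertible P"
  shows "matrix_inv P ** P = mat 1"
  using someI_ex[OF assms[unfolded invertible_def]] by (simp add: matrix_inv_def)

lemma trace_conj:
  fixes D P :: "real^'n^'n"
  assumes "invertible P"
  shows "trace (matrix_inv P ** D ** P) = trace D"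
proof -
  have "trace (matrix_inv P ** D ** P) = trace (P ** (matrix_inv P ** D))" by (rule trace_mul_sym)
  then show ?thesis by (simp add: matrix_mul_assoc matrix_inv_right[OF assms])
qed

text \<open>
  \<open>D\<close> is the identity on the line spanned by \<open>X\<close> and on the quotient by the kernel of \<open>\<alpha>\<close>, each of
  which contributes \<open>1\<close> to its trace.
\<close>

lemma quotient_matrix_trace:
  fixes X :: "real^4" and \<alpha> :: "real^4 \<Rightarrow> real" and e :: "2 \<Rightarrow> real^4" and B :: "real^2^2"
  assumes lin: "linear \<alpha>" and X: "X \<noteq> 0" "\<alpha> X = 0" and w0: "\<alpha> w0 \<noteq> 0"
    and D: "D *v X = X" "\<And>u. \<alpha> (D *v u) = \<alpha> u"
    and e: "\<And>i. \<alpha> (e i) = 0"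
    and ind: "\<forall>k l m. k *\<^sub>R X + l *\<^sub>R e 1 + m *\<^sub>R e 2 = 0 \<longrightarrow> l = 0 \<and> m = 0"
    and B: "\<And>j. \<exists>k. D *v e j = k *\<^sub>R X + B$1$j *\<^sub>R e 1 + B$2$j *\<^sub>R e 2"
  shows "trace B = trace D - 2"
proof -
  define w where "w = w0 /\<^sub>R \<alpha> w0"
  have w: "\<alpha> w = 1" using w0 lin by (simp add: w_def linear_scale)
  define P :: "real^4^4" where "P = (\<chi> i j. if j = 1 then X$i else if j = 2 then e 1$i else if j = 3 then e 2$i else w$i)"
  note fr = frame_invertible[OF lin X w e[of 1] e[of 2] ind, folded P_def]
  define Q where "Q = matrix_inv P ** D ** P"
  have PQ: "P *v (Q *v x) = D *v (P *v x)" for x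
    by (simp only: Q_def matrix_vector_mul_assoc matrix_mul_assoc matrix_inv_right[OF fr(1)] matrix_mul_lid)
  have inj: "P *v x = P *v y \<Longrightarrow> x = y" for x y
    using inj_matrix_vector_mult[OF fr(1)] by (auto dest: injD)
  have col: "(Q *v axis j 1)$i = Q$i$j" for i j by (simp add: matrix_vector_mul_component inner_axis)
  have ax: "P *v axis 1 1 = X" "P *v axis 2 1 = e 1" "P *v axis 3 1 = e 2" "P *v axis 4 1 = w"
    by (auto simp: fr(2) axis_def)
  have "Q *v axis 1 1 = axis 1 1" by (rule inj) (simp add: PQ ax D)
  then have q1: "Q$1$1 = 1" by (metis col axis_nth)
  have q4: "Q$4$4 = 1" using fr(3)[of "Q *v axis 4 1"] by (simp add: PQ ax D w col)
  \<comment> \<open>The multiples of \<open>X\<close>, invisible in the quotient, land in the first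
    row of \<open>Q\<close>, off the diagonal.\<close>
  obtain k1 k2 where k: "D *v e 1 = k1 *\<^sub>R X + B$1$1 *\<^sub>R e 1 + B$2$1 *\<^sub>R e 2"
     "D *v e 2 = k2 *\<^sub>R X + B$1$2 *\<^sub>R e 1 + B$2$2 *\<^sub>R e 2" using B by metis
  have "Q *v axis 2 1 = (\<chi> i. if i = 1 then k1 else if i = 2 then B$1$1 else if i = 3 then B$2$1 else 0)"
    by (rule inj, unfold PQ ax k, simp add: fr(2))
  then have q2: "Q$2$2 = B$1$1" by (subst col[symmetric]) simp
  have "Q *v axis 3 1 = (\<chi> i. if i = 1 then k2 else if i = 2 then B$1$2 else if i = 3 then B$2$2 else 0)"
    by (rule inj, unfold PQ ax k, simp add: fr(2))
  then have q3: "Q$3$3 = B$2$2" by (subst col[symmetric]) simp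
  have "trace D = trace Q" using trace_conj[OF fr(1)] by (simp add: Q_def)
  then show ?thesis by (simp add: mat4_trace q1 q2 q3 q4 trace_def sum_2)
qed

text \<open>In an adapted frame the matrices are block triangular with diagonal 1, n, 1 for
  \<open>N\<close> and -1, r, 1 for \<open>R\<close>, where n and r are 2 x 2. The middle blocks
  inherit r r = 1 and n r n = r, so det n is 1 or -1, and the trace of \<open>N ** N\<close> is 2 +
  (tr n)^2 - 2 det n. It is nonpositive only if det n = 1 and tr n = 0; then n n = -1, which fixes
  no nonzero vector.\<close>

lemma reversible_square_trace:
  fixes X :: "real^4" and \<alpha> :: "real^4 \<Rightarrow> real" and N R :: "real^4^4"
  assumes lin: "linear \<alpha>" and X: "X \<noteq> 0" "\<alpha> X = 0" and w0: "\<alpha> w0 \<noteq> 0"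
    and N: "N *v X = X" "\<And>u. \<alpha> (N *v u) = \<alpha> u"
    and R: "R *v X = - X" "\<And>u. \<alpha> (R *v u) = \<alpha> u"
    and RR: "R ** R = mat 1" and NRN: "N ** R ** N = R"
  shows "0 \<le> trace (N ** N)"
    "\<lbrakk>trace (N ** N) \<le> 0; \<alpha> u = 0; (N ** N) *v u = u\<rbrakk> \<Longrightarrow> \<exists>k. u = k *\<^sub>R X"
proof -
  obtain P :: "real^4^4" where P: "invertible P" "P *v axis 1 1 = X" "\<And>x. \<alpha> (P *v x) = x$4"
    using adapted_frame[OF lin X w0] by metis
  define cj where "cj M = matrix_inv P ** M ** P" for M :: "real^4^4"
  have cjv: "P *v (cj M *v x) = M *v (P *v x)" for M x
    by (simp only: cj_def matrix_vector_mul_assoc matrix_mul_assoc matrix_inv_right[OF P(1)] matrix_mul_lid)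
  have cj_mul: "cj M ** cj M' = cj (M ** M')" for M M'
  proof -
    have "cj M ** cj M' = matrix_inv P ** M ** (P ** matrix_inv P) ** M' ** P"
      by (simp only: cj_def matrix_mul_assoc)
    then show ?thesis by (simp add: cj_def matrix_inv_right[OF P(1)] matrix_mul_assoc)
  qed
  have inj: "P *v x = P *v y \<Longrightarrow> x = y" for x y
    using inj_matrix_vector_mult[OF P(1)] by (auto dest: injD)
  have col: "(M *v axis j 1)$i = M$i$j" for i j and M :: "real^4^4"
    by (simp add: matrix_vector_mul_component inner_axis)
  \<comment> \<open>The first column says that \<open>X\<close> is scaled by \<open>k\<close>, the
    last row that \<open>\<alpha>\<close> is preserved; \<open>k\<close> is 1 for \<open>N\<close>
    and -1 for \<open>R\<close>.\<close>
  have shape: "M$1$1 = k \<and> M$2$1 = 0 \<and> M$3$1 = 0 \<and> M$4$1 = 0 \<and> M$4$2 = 0 \<and> M$4$3 = 0 \<and> M$4$4 = 1"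
    if "M' *v X = k *\<^sub>R X" "\<And>u. \<alpha> (M' *v u) = \<alpha> u" "M = cj M'" for k M M'
  proof -
    have "M *v axis 1 1 = k *\<^sub>R axis 1 1"
      by (rule inj) (simp add: cjv that P(2) matrix_vector_mult_scaleR)
    then have "M$i$1 = (k *\<^sub>R axis 1 1)$i" for i by (metis col)
    moreover have "M$4$j = axis j 1 $ 4" for j
      using P(3)[of "M *v axis j 1"] P(3)[of "axis j 1"] by (simp add: that cjv col)
    ultimately show ?thesis by (auto simp: axis_def)
  qed
  define n where "n = cj N"
  define r where "r = cj R"
  have n: "n$1$1 = 1" "n$2$1 = 0" "n$3$1 = 0" "n$4$1 = 0" "n$4$2 = 0" "n$4$3 = 0" "n$4$4 = 1"
    using shape[OF _ N(2) n_def, of 1] N(1) by auto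
  have r: "r$1$1 = -1" "r$2$1 = 0" "r$3$1 = 0" "r$4$1 = 0" "r$4$2 = 0" "r$4$3 = 0" "r$4$4 = 1"
    using shape[OF _ R(2) r_def, of "-1"] R(1) by auto
  have rr: "r ** r = mat 1"
    unfolding r_def cj_mul RR by (simp add: cj_def matrix_inv_left P(1))
  have nrn: "n ** r ** n = r"
    unfolding r_def n_def cj_mul NRN ..
  define a b c d where "a = n$2$2" and "b = n$2$3" and "c = n$3$2" and "d = n$3$3"
  define a' b' c' d' where "a' = r$2$2" and "b' = r$2$3" and "c' = r$3$2" and "d' = r$3$3"
  have e: "(r ** r)$i$j = (mat 1 :: real^4^4)$i$j" "(n ** r ** n)$i$j = r$i$j" for i j
    using rr nrn by auto
  \<comment> \<open>Because of the zeros in the first column and the last row, the middle block of a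
    product is the product of the middle blocks.\<close>
  have q1: "a'*a' + b'*c' = 1" "c'*b' + d'*d' = 1" "a'*b' + b'*d' = 0" "c'*a'+d'*c' = 0"
    using e(1)[of 2 2] e(1)[of 3 3] e(1)[of 2 3] e(1)[of 3 2]
    by (simp_all add: matrix_matrix_mult_def sum_4 mat_def n r a'_def b'_def c'_def d'_def)
  have q2: "(a*a'+b*c')*a + (a*b'+b*d')*c = a'" "(a*a'+b*c')*b + (a*b'+b*d')*d = b'"
     "(c*a'+d*c')*a + (c*b'+d*d')*c = c'" "(c*a'+d*c')*b + (c*b'+d*d')*d = d'"
    using e(2)[of 2 2] e(2)[of 3 3] e(2)[of 2 3] e(2)[of 3 2]
    by (simp_all add: matrix_matrix_mult_def sum_4 n r a'_def b'_def c'_def d'_def a_def b_def c_def d_def)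
  define dt where "dt = a*d - b*c"
  \<comment> \<open>Determinants of the two block identities: that of r has square 1, and
    \<open>dt^2\<close> times it equals it.\<close>
  have "(a'*d' - b'*c')^2 = 1" using q1 by algebra
  moreover have "dt^2 * (a'*d'-b'*c') =
      ((a*a'+b*c')*a + (a*b'+b*d')*c) * ((c*a'+d*c')*b + (c*b'+d*d')*d)
      - ((a*a'+b*c')*b + (a*b'+b*d')*d) * ((c*a'+d*c')*a + (c*b'+d*d')*c)"
    unfolding dt_def power2_eq_square by (simp add: algebra_simps)
  then have "dt^2 * (a'*d'-b'*c') = a'*d'-b'*c'" unfolding q2 .
  ultimately have "dt^2 = 1"
    by (metis mult.commute mult_cancel_left1 power_zero_numeral zero_neq_one)
  then have dt: "dt = 1 \<or> dt = -1" by (simp add: power2_eq_1_iff)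
  have "trace (N ** N) = trace (cj (N ** N))" by (simp add: cj_def trace_conj[OF P(1)])
  also have "\<dots> = trace (n ** n)" by (simp add: n_def cj_mul)
  also have "\<dots> = 2 + (a*a + b*c + c*b + d*d)"
    by (simp add: mat4_trace matrix_matrix_mult_def sum_4 n a_def b_def c_def d_def)
  also have "\<dots> = 2 + (a+d)^2 - 2*dt" by (simp add: dt_def power2_eq_square algebra_simps)
  finally have tr: "trace (N ** N) = 2 + (a+d)^2 - 2*dt" .
  show "0 \<le> trace (N ** N)" using tr dt zero_le_power2[of "a+d"] by auto
  assume le: "trace (N ** N) \<le> 0" and u: "\<alpha> u = 0" "(N ** N) *v u = u"
  have dt1: "dt = 1" and ad: "d = - a" using tr dt le zero_le_power2[of "a+d"] by auto
  define x where "x = matrix_inv P *v u"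
  have Px: "P *v x = u" by (simp add: x_def matrix_vector_mul_assoc matrix_inv_right[OF P(1)])
  have x4: "x$4 = 0" using P(3)[of x] u Px by simp
  have "(n ** n) *v x = x" by (rule inj) (simp add: n_def cj_mul cjv Px u)
  then have "((n ** n) *v x)$i = x$i" for i by simp
  from this[of 2] this[of 3] have
    "(a*a + b*c) * x$2 + (a*b+b*d)*x$3 = x$2" "(c*a+d*c) * x$2 + (c*b+d*d)*x$3 = x$3"
    by (simp_all add: matrix_matrix_mult_def matrix_vector_mult_def sum_4 n a_def b_def c_def d_def x4)
  \<comment> \<open>Cayley-Hamilton for trace 0 and determinant 1.\<close>
  moreover have "a*a+b*c = -1" using dt1 unfolding dt_def ad by (simp add: algebra_simps)
  ultimately have "x$2 = 0" "x$3 = 0" unfolding ad by (auto simp: algebra_simps)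
  then have "x = x$1 *\<^sub>R axis 1 1" using x4 by (simp add: vec_eq_iff forall_4 axis_def)
  then have "u = x$1 *\<^sub>R X" using Px P(2) by (metis matrix_vector_mult_scaleR)
  then show "\<exists>k. u = k *\<^sub>R X" ..
qed

section \<open>Strict differentiability with parameters and flows in Euclidean space\<close>

text \<open>
  Strict differentiability of \<open>g s\<close> at \<open>x0\<close>, uniformly in \<open>s\<close> near \<open>s0\<close>. In contrast to
  differentiability of each \<open>g s\<close>, this passes to flows by a Gronwall estimate for differences of
  solutions, it controls pairs of nearby fixed points, and it makes the derivatives of \<open>g s\<close>
  converge as \<open>s\<close> tends to \<open>s0\<close>.
\<close>

definition param_diff ::
    "(real \<Rightarrow> 'a::real_normed_vector \<Rightarrow> 'b::real_normed_vector) \<Rightarrow> real \<Rightarrow> 'a \<Rightarrow> ('a \<Rightarrow> 'b) \<Rightarrow> bool" where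
  "param_diff g s0 x0 D \<longleftrightarrow> bounded_linear D \<and> isCont (\<lambda>s. g s x0) s0 \<and>
     (\<forall>e>0. \<exists>d>0. \<forall>s x y. dist s s0 < d \<longrightarrow> dist x x0 < d \<longrightarrow> dist y x0 < d \<longrightarrow>
        norm (g s x - g s y - D (x - y)) \<le> e * norm (x - y))"

lemma param_diffD:
  assumes "param_diff g s0 x0 D" "e > 0"
  obtains d where "d > 0" "\<And>s x y. \<lbrakk>dist s s0 < d; dist x x0 < d; dist y x0 < d\<rbrakk> \<Longrightarrow>
     norm (g s x - g s y - D (x - y)) \<le> e * norm (x - y)"
  using assms unfolding param_diff_def by metis

lemma param_diff_has_derivative:
  assumes "param_diff g s0 x0 D"
  shows "(g s0 has_derivative D) (at x0)"
proof -
  have "bounded_linear D" using assms by (simp add: param_diff_def)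
  moreover have "\<exists>d>0. \<forall>y. norm (y - x0) < d \<longrightarrow> norm (g s0 y - g s0 x0 - D (y - x0)) \<le> e * norm (y - x0)"
    if "e > 0" for e
    using param_diffD[OF assms that] by (metis dist_norm dist_self)
  ultimately show ?thesis unfolding has_derivative_at_alt by blast
qed

text \<open>The strict estimate makes \<open>g s\<close> Lipschitz near \<open>x0\<close> with one
  constant for all nearby \<open>s\<close>, so continuity in \<open>s\<close> at the point
  \<open>x0\<close> upgrades to joint continuity.\<close>

lemma param_diff_isCont:
  assumes "param_diff g s0 x0 D"
  shows "isCont (\<lambda>z. g (fst z) (snd z)) (s0, x0)"
proof -
  have bl: "bounded_linear D" and c: "isCont (\<lambda>s. g s x0) s0" using assms by (auto simp: param_diff_def)
  obtain d where d: "d > 0" "\<And>s x y. \<lbrakk>dist s s0 < d; dist x x0 < d; dist y x0 < d\<rbrakk> \<Longrightarrow>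
     norm (g s x - g s y - D (x - y)) \<le> 1 * norm (x - y)"
    using param_diffD[OF assms, of 1] by auto
  obtain C where C: "\<And>x. norm (D x) \<le> norm x * C" using bounded_linear.bounded[OF bl] by blast
  have ev: "\<forall>\<^sub>F z in at (s0, x0). dist (fst z) s0 < d \<and> dist (snd z) x0 < d"
  proof -
    have "((\<lambda>z. dist (fst z) s0) \<longlongrightarrow> dist s0 s0) (at (s0, x0))"
      "((\<lambda>z. dist (snd z) x0) \<longlongrightarrow> dist x0 x0) (at (s0, x0))"
      by (auto intro!: tendsto_eq_intros)
    then show ?thesis using d(1) by (auto intro!: eventually_conj order_tendstoD(2)[where y = 0])
  qed
  have "((\<lambda>z. g (fst z) (snd z) - g (fst z) x0) \<longlongrightarrow> 0) (at (s0, x0))"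
  proof (rule Lim_null_comparison)
    show "\<forall>\<^sub>F z in at (s0, x0). norm (g (fst z) (snd z) - g (fst z) x0) \<le> (1 + C) * norm (snd z - x0)"
      using ev
    proof eventually_elim
      case (elim z)
      have "norm (g (fst z) (snd z) - g (fst z) x0 - D (snd z - x0)) \<le> norm (snd z - x0)"
        using d(2)[of "fst z" "snd z" x0] elim d(1) by simp
      then show ?case using C[of "snd z - x0"] norm_triangle_ineq2[of "g (fst z) (snd z) - g (fst z) x0" "D (snd z - x0)"]
        by (simp add: algebra_simps)
    qed
    show "((\<lambda>z. (1 + C) * norm (snd z - x0)) \<longlongrightarrow> 0) (at (s0, x0))"
      by (auto intro!: tendsto_eq_intros)
  qed
  moreover have "((\<lambda>z. g (fst z) x0) \<longlongrightarrow> g s0 x0) (at (s0, x0))"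
    by (rule isCont_tendsto_compose[OF c]) (auto intro!: tendsto_eq_intros)
  ultimately have "((\<lambda>z. g (fst z) (snd z) - g (fst z) x0 + g (fst z) x0) \<longlongrightarrow> 0 + g s0 x0) (at (s0, x0))"
    by (rule tendsto_add)
  then show ?thesis by (simp add: isCont_def)
qed

lemma param_diff_cong:
  assumes "param_diff g s0 x0 D" "d > 0"
    and "\<And>s x. \<lbrakk>dist s s0 < d; dist x x0 < d\<rbrakk> \<Longrightarrow> g s x = h s x"
  shows "param_diff h s0 x0 D"
  unfolding param_diff_def
proof (intro conjI allI impI)
  show "bounded_linear D" using assms(1) by (simp add: param_diff_def)
  have "\<forall>\<^sub>F s in nhds s0. g s x0 = h s x0"
    unfolding eventually_nhds_metric using assms(2,3) by auto
  then show "isCont (\<lambda>s. h s x0) s0"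
    using assms(1) isCont_cong[of "\<lambda>s. g s x0" "\<lambda>s. h s x0" s0] unfolding param_diff_def by simp
  fix e :: real assume "e > 0"
  from param_diffD[OF assms(1) this] obtain d' where d': "d' > 0" "\<And>s x y. \<lbrakk>dist s s0 < d'; dist x x0 < d'; dist y x0 < d'\<rbrakk> \<Longrightarrow>
     norm (g s x - g s y - D (x - y)) \<le> e * norm (x - y)" by blast
  show "\<exists>d>0. \<forall>s x y. dist s s0 < d \<longrightarrow> dist x x0 < d \<longrightarrow> dist y x0 < d \<longrightarrow>
        norm (h s x - h s y - D (x - y)) \<le> e * norm (x - y)"
    using d' assms(2,3) by (intro exI[of _ "min d d'"]) (auto, metis)
qed

lemma param_diff_compose:
  assumes g: "param_diff g s0 x0 D" and h: "param_diff h s0 (g s0 x0) D'"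
  shows "param_diff (\<lambda>s x. h s (g s x)) s0 x0 (\<lambda>u. D' (D u))"
  unfolding param_diff_def
proof (intro conjI allI impI)
  have bl: "bounded_linear D" "bounded_linear D'" using g h by (auto simp: param_diff_def)
  show "bounded_linear (\<lambda>u. D' (D u))" using bounded_linear_compose bl by blast
  have "isCont (\<lambda>s. (s, g s x0)) s0" using g by (auto simp: param_diff_def)
  then have "isCont (\<lambda>s. (\<lambda>z. h (fst z) (snd z)) (s, g s x0)) s0"
    by (rule isCont_o2[of s0 "\<lambda>s. (s, g s x0)" "\<lambda>z. h (fst z) (snd z)", OF _ param_diff_isCont[OF h]])
  then show "isCont (\<lambda>s. h s (g s x0)) s0" by simp
  fix e :: real assume e: "e > 0"
  obtain C where C: "C > 0" "\<And>x. norm (D x) \<le> norm x * C" using bounded_linear.pos_bounded[OF bl(1)] by blast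
  obtain C' where C': "C' > 0" "\<And>x. norm (D' x) \<le> norm x * C'" using bounded_linear.pos_bounded[OF bl(2)] by blast
  \<comment> \<open>The error of \<open>g\<close> is magnified by at most \<open>C'\<close> under
    \<open>D'\<close>, and \<open>e1 \<le> 1\<close> makes \<open>g\<close> Lipschitz with constant
    \<open>1 + C\<close>, by which the error of \<open>h\<close> is magnified. Each contributes
    \<open>e / 2\<close>.\<close>
  define e1 where "e1 = min 1 (e / (2 * C'))"
  define e2 where "e2 = e / (2 * (1 + C))"
  have e12: "e1 > 0" "e2 > 0" "e1 \<le> 1" "e1 * C' \<le> e / 2" "e2 * (1 + C) = e / 2"
    using e C C' by (auto simp: e1_def e2_def min_def field_simps)
  obtain d1 where d1: "d1 > 0" "\<And>s x y. \<lbrakk>dist s s0 < d1; dist x x0 < d1; dist y x0 < d1\<rbrakk> \<Longrightarrow>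
     norm (g s x - g s y - D (x - y)) \<le> e1 * norm (x - y)" using param_diffD[OF g e12(1)] by blast
  obtain d2 where d2: "d2 > 0" "\<And>s x y. \<lbrakk>dist s s0 < d2; dist x (g s0 x0) < d2; dist y (g s0 x0) < d2\<rbrakk> \<Longrightarrow>
     norm (h s x - h s y - D' (x - y)) \<le> e2 * norm (x - y)" using param_diffD[OF h e12(2)] by blast
  obtain d3 where d3: "d3 > 0" "\<And>z. dist z (s0,x0) < d3 \<Longrightarrow> dist (g (fst z) (snd z)) (g s0 x0) < d2"
    using param_diff_isCont[OF g] d2(1) unfolding continuous_at_eps_delta by auto
  define d where "d = Min {d1, d2, d3/2}"
  have d: "d > 0" "d \<le> d1" "d \<le> d2" "d \<le> d3/2" using d1 d2 d3 by (auto simp: d_def)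
  show "\<exists>d>0. \<forall>s x y. dist s s0 < d \<longrightarrow> dist x x0 < d \<longrightarrow> dist y x0 < d \<longrightarrow>
        norm (h s (g s x) - h s (g s y) - D' (D (x - y))) \<le> e * norm (x - y)"
  proof (intro exI[of _ d] conjI allI impI)
    show "d > 0" by (rule d)
    fix s x y assume sxy: "dist s s0 < d" "dist x x0 < d" "dist y x0 < d"
    have n: "dist (s, w) (s0, x0) < d3" if "dist w x0 < d" for w
    proof -
      have "dist (s, w) (s0, x0) \<le> dist s s0 + dist w x0" unfolding dist_Pair_Pair by (rule sqrt_sum_squares_le_sum_abs[THEN order_trans]) auto
      then show ?thesis using sxy(1) that d by auto
    qed
    have gg: "dist (g s x) (g s0 x0) < d2" "dist (g s y) (g s0 x0) < d2"
      using d3(2)[OF n[OF sxy(2)]] d3(2)[OF n[OF sxy(3)]] by auto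
    let ?z = "g s x - g s y"
    have a: "norm (?z - D (x - y)) \<le> e1 * norm (x - y)" using d1(2) sxy d by auto
    have b: "norm (h s (g s x) - h s (g s y) - D' ?z) \<le> e2 * norm ?z" using d2(2)[of s "g s x" "g s y"] gg sxy d by auto
    have "norm ?z \<le> norm (?z - D (x - y)) + norm (D (x - y))" by (metis add.commute norm_triangle_sub)
    also have "\<dots> \<le> 1 * norm (x - y) + norm (x - y) * C"
      using a e12(3) C(2) by (intro add_mono) (auto intro!: order_trans[OF a] mult_left_le_one_le less_imp_le[OF e12(1)])
    finally have "norm ?z \<le> (1 + C) * norm (x - y)" by (simp add: algebra_simps)
    then have "e2 * norm ?z \<le> e2 * ((1 + C) * norm (x - y))" using e12(2) by simp
    also have "\<dots> = e / 2 * norm (x - y)" using e12(5) by (metis mult.assoc)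
    finally have b': "norm (h s (g s x) - h s (g s y) - D' ?z) \<le> e / 2 * norm (x - y)" using b by simp
    have "norm (D' (?z - D (x - y))) \<le> e1 * norm (x - y) * C'"
      using C'(2)[of "?z - D (x - y)"] a C'(1) by (meson mult_right_mono order_trans less_imp_le)
    also have "\<dots> = (e1 * C') * norm (x - y)" by simp
    also have "\<dots> \<le> e / 2 * norm (x - y)" using e12(4) by (intro mult_right_mono) auto
    finally have a': "norm (D' ?z - D' (D (x - y))) \<le> e / 2 * norm (x - y)"
      using linear_diff[OF bounded_linear.linear[OF bl(2)]] by simp
    have "norm ((h s (g s x) - h s (g s y) - D' ?z) + (D' ?z - D' (D (x - y))))
      \<le> e / 2 * norm (x - y) + e / 2 * norm (x - y)"
      by (rule order_trans[OF norm_triangle_ineq add_mono[OF b' a']])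
    then show "norm (h s (g s x) - h s (g s y) - D' (D (x - y))) \<le> e * norm (x - y)"
      by (simp add: distrib_right[symmetric])
  qed
qed

text \<open>The mean value inequality for \<open>g - A\<close>: one linear map approximates all
  increments within a convex set.\<close>

lemma mean_value_blinfun:
  fixes g :: "'a::real_normed_vector \<Rightarrow> 'b::real_normed_vector"
  assumes "convex S" "\<And>x. x \<in> S \<Longrightarrow> (g has_derivative blinfun_apply (g' x)) (at x)"
    and B: "\<And>x. x \<in> S \<Longrightarrow> norm (g' x - A) \<le> B" and xy: "x \<in> S" "y \<in> S"
  shows "norm (g x - g y - A (x - y)) \<le> B * norm (x - y)"
proof -
  have "norm ((g x - A x) - (g y - A y)) \<le> B * norm (x - y)"
  proof (rule differentiable_bound[OF assms(1) _ _ xy])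
    fix z assume z: "z \<in> S"
    show "((\<lambda>x. g x - A x) has_derivative blinfun_apply (g' z - A)) (at z within S)"
      using has_derivative_diff[OF has_derivative_at_withinI[OF assms(2)[OF z]]
          bounded_linear_imp_has_derivative[OF blinfun.bounded_linear_right[of A]]]
      by (simp add: minus_blinfun.rep_eq)
    show "onorm (blinfun_apply (g' z - A)) \<le> B" using B[OF z] by (simp add: norm_blinfun.rep_eq)
  qed
  then show ?thesis by (simp add: blinfun.diff_right algebra_simps)
qed

text \<open>A jointly continuous space derivative stays within \<open>e\<close> of its value at
  \<open>(s0, x0)\<close>, and the mean value inequality on a ball turns this into the strict
  estimate. Through this criterion transition maps, vector fields and energies enter.\<close>

lemma param_diff_C1:
  assumes W: "open W" "(s0, x0) \<in> W" and c: "continuous_on W g'" "isCont (\<lambda>s. g s x0) s0"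
    and d: "\<And>z. z \<in> W \<Longrightarrow> (g (fst z) has_derivative blinfun_apply (g' z)) (at (snd z))"
  shows "param_diff g s0 x0 (g' (s0, x0))"
  unfolding param_diff_def
proof (intro conjI allI impI)
  show "bounded_linear (blinfun_apply (g' (s0, x0)))" by (rule blinfun.bounded_linear_right)
  show "isCont (\<lambda>s. g s x0) s0" by (rule c)
  fix e :: real assume e: "e > 0"
  have "isCont g' (s0, x0)" using c(1) W by (simp add: continuous_on_eq_continuous_at)
  then obtain d1 where d1: "d1 > 0" "\<And>z. dist z (s0,x0) < d1 \<Longrightarrow> dist (g' z) (g' (s0,x0)) < e"
    unfolding continuous_at_eps_delta using e by auto
  obtain d2 where d2: "d2 > 0" "ball (s0,x0) d2 \<subseteq> W" using W openE by blast
  \<comment> \<open>Halved, since a distance in the product is at most the sum of the distances of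
    the components.\<close>
  define d where "d = min d1 d2 / 2"
  have dp: "d > 0" using d1 d2 by (simp add: d_def)
  have n: "dist (s, w) (s0, x0) < d1 \<and> (s, w) \<in> W" if "dist s s0 < d" "dist w x0 < d" for s w
  proof -
    have "dist (s, w) (s0, x0) \<le> dist s s0 + dist w x0" unfolding dist_Pair_Pair by (rule sqrt_sum_squares_le_sum_abs[THEN order_trans]) auto
    then have "dist (s, w) (s0, x0) < min d1 d2" using that d_def by auto
    then show ?thesis using d2 by (auto simp: dist_commute)
  qed
  show "\<exists>d>0. \<forall>s x y. dist s s0 < d \<longrightarrow> dist x x0 < d \<longrightarrow> dist y x0 < d \<longrightarrow>
        norm (g s x - g s y - (g' (s0, x0)) (x - y)) \<le> e * norm (x - y)"
  proof (intro exI[of _ d] conjI allI impI dp)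
    fix s x y assume sxy: "dist s s0 < d" "dist x x0 < d" "dist y x0 < d"
    show "norm (g s x - g s y - (g' (s0, x0)) (x - y)) \<le> e * norm (x - y)"
    proof (rule mean_value_blinfun[of "ball x0 d" _ "\<lambda>w. g' (s, w)"])
      fix w assume "w \<in> ball x0 d"
      then have "dist w x0 < d" by (simp add: dist_commute)
      note n = n[OF sxy(1) this]
      show "(g s has_derivative blinfun_apply (g' (s, w))) (at w)" using d[of "(s, w)"] n by simp
      show "norm (g' (s, w) - g' (s0, x0)) \<le> e" using d1(2) n by (metis dist_norm less_imp_le)
    qed (use sxy in \<open>auto simp: dist_commute\<close>)
  qed
qed

text \<open>One small increment along \<open>w\<close> at the moving base point is compared with
  both linear maps: with \<open>D' i\<close> since it is the derivative there, with \<open>D\<close>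
  by the strict estimate. This yields convergence of the monodromy matrices along the
  family.\<close>

lemma param_diff_derivative_tendsto:
  fixes D :: "'a::real_normed_vector \<Rightarrow> 'b::real_normed_vector"
  assumes g: "param_diff g s0 x0 D"
    and s: "((\<lambda>i. s i) \<longlongrightarrow> s0) F" and x: "((\<lambda>i. x i) \<longlongrightarrow> x0) F"
    and d: "\<forall>\<^sub>F i in F. (g (s i) has_derivative D' i) (at (x i))"
  shows "((\<lambda>i. D' i w) \<longlongrightarrow> D w) F"
proof (rule tendstoI)
  fix e :: real assume "e > 0"
  \<comment> \<open>Two errors of \<open>e'\<close> times the length of the increment add up;
    \<open>norm w + 1\<close> avoids division by zero.\<close>
  define e' where "e' = e / (4 * (norm w + 1))"
  have e': "e' > 0" "2 * e' * norm w < e"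
  proof -
    show "e' > 0" using \<open>e > 0\<close> by (simp add: e'_def add_nonneg_pos)
    have "2 * norm w < 4 * (norm w + 1)" using norm_ge_zero[of w] by (simp add: add_nonneg_pos add_pos_nonneg algebra_simps)
    then have "2 * norm w / (4 * (norm w + 1)) < 1" by (simp add: add_nonneg_pos)
    then have "e * (2 * norm w / (4 * (norm w + 1))) < e * 1"
      using \<open>e > 0\<close> by (intro mult_strict_left_mono)
    then show "2 * e' * norm w < e" by (simp add: e'_def mult_ac)
  qed
  obtain r where r: "r > 0" "\<And>s x y. \<lbrakk>dist s s0 < r; dist x x0 < r; dist y x0 < r\<rbrakk> \<Longrightarrow>
     norm (g s x - g s y - D (x - y)) \<le> e' * norm (x - y)" using param_diffD[OF g e'(1)] by blast
  have "\<forall>\<^sub>F i in F. dist (s i) s0 < r" "\<forall>\<^sub>F i in F. dist (x i) x0 < r / 2"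
    using tendstoD[OF s r(1)] tendstoD[OF x half_gt_zero[OF r(1)]] by auto
  with d show "\<forall>\<^sub>F i in F. dist (D' i w) (D w) < e"
  proof eventually_elim
    case (elim i)
    obtain h where h: "h > 0" "\<And>y. norm (y - x i) < h \<Longrightarrow> norm (g (s i) y - g (s i) (x i) - D' i (y - x i)) \<le> e' * norm (y - x i)"
      using elim(1) e'(1) unfolding has_derivative_at_alt by blast
    define m where "m = min h (r / 2)"
    \<comment> \<open>Scales \<open>w\<close> to an increment shorter than both \<open>h\<close> and
      \<open>r / 2\<close>.\<close>
    define k where "k = m / (2 * (norm w + 1))"
    have wp: "norm w + 1 > 0" by (simp add: add_nonneg_pos)
    have m: "m > 0" "m \<le> h" "m \<le> r / 2" using h r by (auto simp: m_def)
    have k: "k > 0" using m wp by (simp add: k_def)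
    have "norm w < 2 * (norm w + 1)" using norm_ge_zero[of w] by (simp add: add_nonneg_pos add_pos_nonneg algebra_simps)
    then have "m * norm w < m * (2 * (norm w + 1))"
      using m by (intro mult_strict_left_mono) auto
    then have "k * norm w < m" using wp by (simp add: k_def pos_divide_less_eq)
    then have kw: "k * norm w < h" "k * norm w < r / 2" using m by linarith+
    define y where "y = x i + k *\<^sub>R w"
    have y: "y - x i = k *\<^sub>R w" "norm (y - x i) < h" "dist y (x i) < r / 2" "norm (y - x i) = k * norm w"
      using kw k by (auto simp: y_def dist_norm)
    have "dist y x0 < r" using y(3) elim(3) dist_triangle[of y x0 "x i"] by linarith
    then have 1: "norm (g (s i) y - g (s i) (x i) - D (y - x i)) \<le> e' * norm (y - x i)"
      using r(2)[of "s i" y "x i"] elim r by auto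
    have lin: "D (k *\<^sub>R w) = k *\<^sub>R D w" "D' i (k *\<^sub>R w) = k *\<^sub>R D' i w"
      using g has_derivative_bounded_linear[OF elim(1)] by (auto simp: param_diff_def linear_scale bounded_linear.linear)
    have "norm (k *\<^sub>R D w - k *\<^sub>R D' i w) \<le> 2 * e' * (k * norm w)"
      using norm_triangle_le_diff[OF add_mono[OF h(2)[OF y(2)] 1]] unfolding y lin using k by (simp add: algebra_simps)
    moreover have "norm (k *\<^sub>R D w - k *\<^sub>R D' i w) = k * norm (D w - D' i w)"
      using k by (simp only: scaleR_diff_right[symmetric] norm_scaleR abs_of_pos)
    ultimately have "k * norm (D w - D' i w) \<le> k * (2 * e' * norm w)" by (simp only: mult_ac)
    then have "norm (D w - D' i w) \<le> 2 * e' * norm w" using k by simp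
    then show ?case using e'(2) by (simp add: dist_norm norm_minus_commute)
  qed
qed


section \<open>Ordinary differential equations in Euclidean space\<close>

lemma interval_bound:
  fixes g :: "real \<Rightarrow> 'b::real_normed_vector"
  assumes d: "\<And>t. t \<in> {-\<delta>..\<delta>} \<Longrightarrow> (g has_vector_derivative g' t) (at t within {-\<delta>..\<delta>})"
    and B: "\<And>t. t \<in> {-\<delta>..\<delta>} \<Longrightarrow> norm (g' t) \<le> B" and t: "t \<in> {-\<delta>..\<delta>}"
  shows "norm (g t - g 0) \<le> B * \<delta>"
proof -
  have "norm (g t - g 0) \<le> B * norm (t - 0)"
  proof (rule differentiable_bound[where S = "{-\<delta>..\<delta>}" and f' = "\<lambda>x h. h *\<^sub>R g' x"])
    show "onorm (\<lambda>h. h *\<^sub>R g' x) \<le> B" if "x \<in> {-\<delta>..\<delta>}" for x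
      using B[OF that] by (intro onorm_le) (simp add: mult.commute[of _ "norm (g' x)"] mult_right_mono)
  qed (use d t in \<open>auto simp: has_vector_derivative_def\<close>)
  also have "\<dots> \<le> B * \<delta>"
    using t order_trans[OF norm_ge_zero B[OF t]] by (intro mult_left_mono) auto
  finally show ?thesis .
qed

text \<open>
  As \<open>L * \<delta> \<le> 1 / 2\<close>, the mean value inequality bounds the maximum of the norm of \<open>z\<close> by half of
  itself plus the other terms.
\<close>

lemma small_interval_gronwall:
  fixes z :: "real \<Rightarrow> 'b::real_normed_vector"
  assumes d: "\<And>t. t \<in> {-\<delta>..\<delta>} \<Longrightarrow> (z has_vector_derivative z' t) (at t within {-\<delta>..\<delta>})"
    and B: "\<And>t. t \<in> {-\<delta>..\<delta>} \<Longrightarrow> norm (z' t) \<le> L * norm (z t) + \<kappa>"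
    and L: "0 \<le> L" "L * \<delta> \<le> 1 / 2" and t: "t \<in> {-\<delta>..\<delta>}"
  shows "norm (z t) \<le> 2 * (norm (z 0) + \<kappa> * \<delta>)"
proof -
  have c: "continuous_on {-\<delta>..\<delta>} (\<lambda>t. norm (z t))"
    using d by (intro continuous_intros continuous_on_vector_derivative) auto
  obtain t0 where t0: "t0 \<in> {-\<delta>..\<delta>}" "\<And>t. t \<in> {-\<delta>..\<delta>} \<Longrightarrow> norm (z t) \<le> norm (z t0)"
    using continuous_attains_sup[OF compact_Icc _ c] t by auto
  have "norm (z t0 - z 0) \<le> (L * norm (z t0) + \<kappa>) * \<delta>"
  proof (rule interval_bound[OF d _ t0(1)])
    fix t assume "t \<in> {-\<delta>..\<delta>}"
    then show "norm (z' t) \<le> L * norm (z t0) + \<kappa>"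
      using B[of t] mult_left_mono[OF t0(2) L(1), of t] by linarith
  qed
  also have "\<dots> = (L * \<delta>) * norm (z t0) + \<kappa> * \<delta>" by (simp add: algebra_simps)
  also have "\<dots> \<le> 1 / 2 * norm (z t0) + \<kappa> * \<delta>" by (intro add_right_mono mult_right_mono L) auto
  finally have "norm (z t0) \<le> 2 * (norm (z 0) + \<kappa> * \<delta>)"
    using norm_triangle_ineq2[of "z t0" "z 0"] by (simp add: algebra_simps)
  then show ?thesis using t0(2)[OF t] by linarith
qed

text \<open>Picard iteration contracts by the factor \<open>L * \<delta> \<le> 1 / 2\<close>. The
  right-hand side depends on time and is Lipschitz on the whole space because the lemma serves both
  a truncated vector field and the linearised equation along a solution.\<close>

lemma picard_lindelof:
  fixes F :: "real \<Rightarrow> 'e::euclidean_space \<Rightarrow> 'e"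
  assumes \<delta>: "\<delta> > 0" and c: "continuous_on ({-\<delta>..\<delta>} \<times> UNIV) (\<lambda>z. F (fst z) (snd z))"
    and lip: "\<And>t x y. t \<in> {-\<delta>..\<delta>} \<Longrightarrow> norm (F t x - F t y) \<le> L * norm (x - y)"
    and L: "0 \<le> L" "L * \<delta> \<le> 1 / 2"
  shows "\<exists>\<gamma>. \<gamma> 0 = x0 \<and> (\<forall>t\<in>{-\<delta>..\<delta>}. (\<gamma> has_vector_derivative F t (\<gamma> t)) (at t within {-\<delta>..\<delta>}))"
proof -
  define I where "I = {-\<delta>..\<delta>}"
  have 0: "0 \<in> I" using \<delta> by (simp add: I_def)
  have cF: "continuous_on I (\<lambda>t. F t (h t))" if "continuous_on I h" for h
  proof -
    have "continuous_on I (\<lambda>t. (t, h t))" using that by (intro continuous_intros)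
    then show ?thesis using continuous_on_compose2[OF c, of I "\<lambda>t. (t, h t)"] by (auto simp: I_def)
  qed
  have ex: "\<exists>g. g 0 = x0 \<and> (\<forall>t\<in>I. (g has_vector_derivative F t (h t)) (at t within I))"
    if hc: "continuous_on I h" for h
  proof -
    obtain g where g: "\<And>t. t \<in> I \<Longrightarrow> (g has_vector_derivative F t (h t)) (at t within I)"
      using cF[OF hc] antiderivative_continuous[of "-\<delta>" \<delta> "\<lambda>t. F t (h t)"] unfolding I_def by blast
    then have "((\<lambda>t. (x0 - g 0) + g t) has_vector_derivative F t (h t)) (at t within I)" if "t \<in> I" for t
      using that by (auto intro!: derivative_eq_intros)
    then show ?thesis by (intro exI[of _ "\<lambda>t. (x0 - g 0) + g t"]) simp
  qed
  \<comment> \<open>The Picard operator: an antiderivative of \<open>F t (h t)\<close>, normalised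
    at time 0.\<close>
  define S where "S h = (SOME g. g 0 = x0 \<and> (\<forall>t\<in>I. (g has_vector_derivative F t (h t)) (at t within I)))" for h
  have S: "S h 0 = x0" "t \<in> I \<Longrightarrow> (S h has_vector_derivative F t (h t)) (at t within I)"
    if "continuous_on I h" for h t using someI_ex[OF ex[OF that]] by (auto simp: S_def)
  have Sc: "continuous_on I (S h)" if "continuous_on I h" for h
    using S(2)[OF that] by (rule continuous_on_vector_derivative)
  \<comment> \<open>Any pointwise bound \<open>B\<close> on the interval takes the place of the
    supremum norm.\<close>
  have contr: "norm (S h t - S k t) \<le> 1 / 2 * B"
    if h: "continuous_on I h" "continuous_on I k" and B: "\<And>t. t \<in> I \<Longrightarrow> norm (h t - k t) \<le> B" and t: "t \<in> I" for h k B t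
  proof -
    have "norm ((S h t - S k t) - (S h 0 - S k 0)) \<le> (L * B) * \<delta>"
    proof (rule interval_bound[where g' = "\<lambda>t. F t (h t) - F t (k t)"])
      fix t assume t: "t \<in> {-\<delta>..\<delta>}"
      show "((\<lambda>t. S h t - S k t) has_vector_derivative F t (h t) - F t (k t)) (at t within {-\<delta>..\<delta>})"
        using S(2)[OF h(1)] S(2)[OF h(2)] t by (auto simp: I_def intro!: has_vector_derivative_diff)
      show "norm (F t (h t) - F t (k t)) \<le> L * B"
        using lip[OF t, of "h t" "k t"] mult_left_mono[OF B L(1), of t] t by (auto simp: I_def)
    qed (use t in \<open>simp add: I_def\<close>)
    also have "(L * B) * \<delta> = (L * \<delta>) * B" by simp
    also have "\<dots> \<le> 1 / 2 * B"
      using L(2) order_trans[OF norm_ge_zero B[OF t]] by (intro mult_right_mono)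
    finally show ?thesis using S(1) h by simp
  qed
  define \<gamma> where "\<gamma> n = (S ^^ n) (\<lambda>_. x0)" for n
  have \<gamma>c: "continuous_on I (\<gamma> n)" for n
    by (induction n) (auto simp: \<gamma>_def Sc)
  have \<gamma>S: "\<gamma> (Suc n) = S (\<gamma> n)" for n by (simp add: \<gamma>_def)
  have "compact ((\<lambda>t. \<gamma> 1 t - \<gamma> 0 t) ` I)"
    by (intro compact_continuous_image continuous_intros \<gamma>c) (simp add: I_def)
  then obtain C where C: "\<And>t. t \<in> I \<Longrightarrow> norm (\<gamma> 1 t - \<gamma> 0 t) \<le> C"
    by (meson bounded_iff compact_imp_bounded imageI)
  have step: "norm (\<gamma> (Suc n) t - \<gamma> n t) \<le> C * (1/2) ^ n" if "t \<in> I" for n t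
    using that
  proof (induction n arbitrary: t)
    case (Suc n)
    show ?case unfolding \<gamma>S[of "Suc n"]  \<gamma>S[of n]
      using contr[OF \<gamma>c[of "Suc n"] \<gamma>c[of n] Suc.IH Suc.prems] by (simp add: \<gamma>S)
  qed (use C in simp)
  \<comment> \<open>The iterates are the partial sums of a telescoping series with a geometric
    majorant.\<close>
  define lim where "lim t = (\<Sum>n. \<gamma> (Suc n) t - \<gamma> n t) + x0" for t
  have "uniform_limit I (\<lambda>n t. \<Sum>i<n. \<gamma> (Suc i) t - \<gamma> i t) (\<lambda>t. \<Sum>n. \<gamma> (Suc n) t - \<gamma> n t) sequentially"
    by (rule Weierstrass_m_test[OF step]) (auto intro!: summable_mult summable_geometric)
  moreover have "(\<Sum>i<n. \<gamma> (Suc i) t - \<gamma> i t) = \<gamma> n t - x0" for n t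
    by (induction n) (auto simp: \<gamma>_def)
  ultimately have "uniform_limit I (\<lambda>n t. \<gamma> n t - x0) (\<lambda>t. lim t - x0) sequentially"
    by (simp add: lim_def)
  then have ul: "uniform_limit I \<gamma> lim sequentially"
    unfolding uniform_limit_iff by (simp add: dist_norm)
  have lc: "continuous_on I lim"
    by (rule uniform_limit_theorem[OF _ ul]) (auto simp: \<gamma>c)
  have fix_lim: "S lim t = lim t" if t: "t \<in> I" for t
  proof (rule LIMSEQ_unique)
    show "(\<lambda>n. \<gamma> (Suc n) t) \<longlonglongrightarrow> lim t"
      using tendsto_uniform_limitI[OF ul t] by (rule LIMSEQ_Suc)
    show "(\<lambda>n. \<gamma> (Suc n) t) \<longlonglongrightarrow> S lim t"
    proof (rule tendstoI)
      fix e :: real assume e: "e > 0"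
      have "\<forall>\<^sub>F n in sequentially. \<forall>t\<in>I. dist (\<gamma> n t) (lim t) < e" using uniform_limitD[OF ul e] .
      then show "\<forall>\<^sub>F n in sequentially. dist (\<gamma> (Suc n) t) (S lim t) < e"
      proof eventually_elim
        case (elim n)
        then have "norm (\<gamma> n t - lim t) \<le> e" if "t \<in> I" for t using that by (auto simp: dist_norm intro: less_imp_le)
        from contr[OF \<gamma>c lc this t] show ?case using e by (simp add: \<gamma>S dist_norm)
      qed
    qed
  qed
  have "(lim has_vector_derivative F t (lim t)) (at t within I)" if "t \<in> I" for t
    using has_vector_derivative_transform[OF that _ S(2)[OF lc that]] fix_lim by metis
  moreover have "lim 0 = x0" using fix_lim[OF 0] S(1)[OF lc] by simp
  ultimately show ?thesis unfolding I_def by blast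
qed

text \<open>Solutions exist for the field truncated outside a ball, and for short times they do not
  leave the ball. The derivative of the time-\<open>t\<close> map solves the linearised equation
  along the reference solution; the Gronwall bound controls how far the difference of two nearby
  solutions deviates from it. One \<open>\<delta>\<close> serves all parameters and points near the
  centre.\<close>

lemma local_flow_euclid:
  fixes f :: "real \<Rightarrow> 'e::euclidean_space \<Rightarrow> 'e" and f' :: "real \<times> 'e \<Rightarrow> 'e \<Rightarrow>\<^sub>L 'e"
  assumes W: "open W" "(s0, x0) \<in> W" and cf: "continuous_on W (\<lambda>z. f (fst z) (snd z))"
    and cf': "continuous_on W f'"
    and df: "\<And>z. z \<in> W \<Longrightarrow> (f (fst z) has_derivative blinfun_apply (f' z)) (at (snd z))"
  obtains \<delta> r \<Phi> where "\<delta> > 0" "r > 0"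
    "\<And>s x. \<lbrakk>dist s s0 < r; dist x x0 < r\<rbrakk> \<Longrightarrow> \<Phi> s x 0 = x"
    "\<And>s x t. \<lbrakk>dist s s0 < r; dist x x0 < r; \<bar>t\<bar> < \<delta>\<rbrakk> \<Longrightarrow>
       (s, \<Phi> s x t) \<in> W \<and> (\<Phi> s x has_vector_derivative f s (\<Phi> s x t)) (at t)"
    "\<And>s x t. \<lbrakk>dist s s0 < r; dist x x0 < r; \<bar>t\<bar> < \<delta>\<rbrakk> \<Longrightarrow> \<exists>D. param_diff (\<lambda>s x. \<Phi> s x t) s x D"
proof -
  obtain A B where AB: "open A" "open B" "s0 \<in> A" "x0 \<in> B" "A \<times> B \<subseteq> W"
    using open_prod_elim[OF W] by (metis mem_Sigma_iff)
  obtain R1 where R1: "R1 > 0" "cball s0 R1 \<subseteq> A" using AB open_contains_cball by blast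
  obtain R2 where R2: "R2 > 0" "cball x0 R2 \<subseteq> B" using AB open_contains_cball by blast
  define R where "R = min R1 R2"
  define K where "K = cball s0 R \<times> cball x0 R"
  have R: "R > 0" and KW: "K \<subseteq> W"
    using R1 R2 AB(5) by (auto simp: R_def K_def subset_iff)
  have cK: "compact K" by (simp add: K_def compact_Times)
  have "bounded (f' ` K)" using compact_continuous_image[OF continuous_on_subset[OF cf' KW] cK] by (rule compact_imp_bounded)
  then obtain L where L: "L > 0" "\<And>z. z \<in> K \<Longrightarrow> norm (f' z) \<le> L" unfolding bounded_pos by auto
  have "bounded ((\<lambda>z. f (fst z) (snd z)) ` K)" using compact_continuous_image[OF continuous_on_subset[OF cf KW] cK] by (rule compact_imp_bounded)
  then obtain M where M: "M > 0" "\<And>z. z \<in> K \<Longrightarrow> norm (f (fst z) (snd z)) \<le> M" unfolding bounded_pos by auto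
  have lin: "norm (f s x - f s y - A (x - y)) \<le> e * norm (x - y)"
    if "convex S" "S \<subseteq> cball x0 R" "s \<in> cball s0 R" "x \<in> S" "y \<in> S" "\<And>w. w \<in> S \<Longrightarrow> norm (f' (s, w) - A) \<le> e" for S A e x y s
    by (rule mean_value_blinfun[where g' = "\<lambda>w. f' (s, w)" and S = S])
      (use that df KW in \<open>auto simp: K_def subset_iff\<close>)
  have lip: "norm (f s x - f s y) \<le> L * norm (x - y)" if "s \<in> cball s0 R" "x \<in> cball x0 R" "y \<in> cball x0 R" for s x y
    using lin[of "cball x0 R" s x y 0 L] that L(2) by (auto simp: K_def)
  \<comment> \<open>The closest point projection does not increase distances, so
    \<open>f s (p x)\<close> is Lipschitz on the whole space and agrees with \<open>f s x\<close> on
    the ball.\<close>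
  define p where "p = closest_point (cball x0 R)"
  have ne: "closed (cball x0 R)" "cball x0 R \<noteq> {}" "convex (cball x0 R)" using R by auto
  have pin: "p x \<in> cball x0 R" for x using closest_point_in_set[OF ne(1,2)] by (simp add: p_def)
  have plip: "norm (p x - p y) \<le> norm (x - y)" for x y
    using closest_point_lipschitz[OF ne(3,1,2), of x y] by (simp add: p_def dist_norm)
  have pself: "x \<in> cball x0 R \<Longrightarrow> p x = x" for x by (simp add: p_def closest_point_self)
  have pc: "continuous_on UNIV p" unfolding p_def by (rule continuous_on_closest_point[OF ne(3,1,2)])
  \<comment> \<open>\<open>1 / (2 * L)\<close> makes the Picard operator contract.
    \<open>R / (4 * M)\<close> keeps the distance travelled below \<open>R / 2\<close>, and the
    starting points will lie within \<open>R / 2\<close> of \<open>x0\<close>.\<close>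
  define \<delta> where "\<delta> = min (1 / (2 * L)) (R / (4 * M))"
  have \<delta>: "\<delta> > 0" using L M R by (simp add: \<delta>_def)
  have "L * \<delta> \<le> L * (1 / (2 * L))" using L(1) by (intro mult_left_mono) (auto simp: \<delta>_def)
  then have L\<delta>: "0 \<le> L" "L * \<delta> \<le> 1 / 2" using L by auto
  have "M * \<delta> \<le> M * (R / (4 * M))" using M(1) by (intro mult_left_mono) (auto simp: \<delta>_def)
  then have M\<delta>: "M * \<delta> < R / 2" using M R by auto
  define J where "J = {-\<delta>..\<delta>}"
  have "\<exists>\<gamma>. \<gamma> 0 = x \<and> (\<forall>t\<in>J. (\<gamma> has_vector_derivative f s (p (\<gamma> t))) (at t within J))" if s: "s \<in> cball s0 R" for s x
    unfolding J_def
  proof (rule picard_lindelof[OF \<delta> _ _ L\<delta>])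
    have "continuous_on ({-\<delta>..\<delta>} \<times> UNIV) (\<lambda>z. (\<lambda>z. f (fst z) (snd z)) (s, p (snd z)))"
      by (rule continuous_on_compose2[OF continuous_on_subset[OF cf KW]])
        (use s pin in \<open>auto simp: K_def intro!: continuous_intros continuous_on_compose2[OF pc]\<close>)
    then show "continuous_on ({-\<delta>..\<delta>} \<times> UNIV) (\<lambda>z. f s (p (snd z)))" by simp
    show "norm (f s (p x) - f s (p y)) \<le> L * norm (x - y)" for x y
      using lip[OF s pin pin, of x y] mult_left_mono[OF plip L\<delta>(1), of x y] by linarith
  qed
  then obtain \<Phi> where \<Phi>p: "\<And>s x. s \<in> cball s0 R \<Longrightarrow> \<Phi> s x 0 = x"
     "\<And>s x t. \<lbrakk>s \<in> cball s0 R; t \<in> J\<rbrakk> \<Longrightarrow> (\<Phi> s x has_vector_derivative f s (p (\<Phi> s x t))) (at t within J)" by metis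
  define r where "r = R / 2"
  have in_ball: "\<Phi> s x t \<in> cball x0 R" if s: "s \<in> cball s0 R" and x: "dist x x0 < r" and t: "t \<in> J" for s x t
  proof -
    have "norm (\<Phi> s x t - \<Phi> s x 0) \<le> M * \<delta>"
    proof (rule interval_bound[where g' = "\<lambda>t. f s (p (\<Phi> s x t))"])
      show "norm (f s (p (\<Phi> s x t))) \<le> M" for t using M(2)[of "(s, p (\<Phi> s x t))"] s pin by (auto simp: K_def)
    qed (use \<Phi>p s t in \<open>auto simp: J_def\<close>)
    then have "dist (\<Phi> s x t) x < R / 2" using \<Phi>p(1)[OF s] M\<delta> by (simp add: dist_norm)
    then show ?thesis using x dist_triangle[of "\<Phi> s x t" x0 x] by (simp add: r_def dist_commute)
  qed
  have \<Phi>: "(\<Phi> s x has_vector_derivative f s (\<Phi> s x t)) (at t within J)"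
    if "s \<in> cball s0 R" "dist x x0 < r" "t \<in> J" for s x t
    using \<Phi>p(2)[OF that(1,3), of x] pself[OF in_ball[OF that]] by simp
  have ucf: "uniformly_continuous_on K (\<lambda>z. f (fst z) (snd z))"
    by (rule compact_uniformly_continuous[OF continuous_on_subset[OF cf KW] cK])
  have ucf': "uniformly_continuous_on K f'"
    by (rule compact_uniformly_continuous[OF continuous_on_subset[OF cf' KW] cK])
  \<comment> \<open>Continuous dependence on parameter and initial point, uniform in time. The
    Gronwall bound is twice \<open>dist x x1 + \<kappa> * \<delta>\<close>, whose two terms are at
    most \<open>e / 4\<close>, the first one strictly less.\<close>
  have near: "\<exists>\<eta>>0. \<forall>s x t. dist s s1 < \<eta> \<longrightarrow> dist x x1 < \<eta> \<longrightarrow> t \<in> J \<longrightarrow> dist x x0 < r \<and> s \<in> cball s0 R \<and> dist (\<Phi> s x t) (\<Phi> s1 x1 t) < e"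
    if e: "e > 0" and s1: "dist s1 s0 < r" and x1: "dist x1 x0 < r" for e s1 x1
  proof -
    define \<kappa> where "\<kappa> = e / (4 * \<delta>)"
    have \<kappa>: "\<kappa> > 0" using e \<delta> by (simp add: \<kappa>_def)
    obtain h where h: "h > 0" "\<And>z z'. \<lbrakk>z \<in> K; z' \<in> K; dist z' z < h\<rbrakk> \<Longrightarrow> dist (f (fst z') (snd z')) (f (fst z) (snd z)) < \<kappa>"
      using ucf \<kappa> unfolding uniformly_continuous_on_def by metis
    define \<eta> where "\<eta> = Min {h, e / 4, r - dist s1 s0, r - dist x1 x0}"
    have \<eta>: "\<eta> > 0" "\<eta> \<le> h" "\<eta> \<le> e / 4" "\<eta> \<le> r - dist s1 s0" "\<eta> \<le> r - dist x1 x0" 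
      using h e s1 x1 by (simp add: \<eta>_def) (unfold \<eta>_def, (rule Min_le; simp)+)
    have s1K: "s1 \<in> cball s0 R" using s1 R by (simp add: r_def dist_commute)
    show ?thesis
    proof (intro exI[of _ \<eta>] conjI allI impI \<eta>(1))
      fix s x t assume s: "dist s s1 < \<eta>" and x: "dist x x1 < \<eta>" and t: "t \<in> J"
      show xx: "dist x x0 < r" using x \<eta> dist_triangle[of x x0 x1] by linarith
      have "dist s s0 < r" using s \<eta> dist_triangle[of s s0 s1] by linarith
      then show sK: "s \<in> cball s0 R" using R by (simp add: r_def dist_commute)
      have "norm (\<Phi> s x t - \<Phi> s1 x1 t) \<le> 2 * (norm (\<Phi> s x 0 - \<Phi> s1 x1 0) + \<kappa> * \<delta>)"
      proof (rule small_interval_gronwall[where z' = "\<lambda>t. f s (\<Phi> s x t) - f s1 (\<Phi> s1 x1 t)" and L = L])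
        fix t assume t: "t \<in> {-\<delta>..\<delta>}"
        then have tJ: "t \<in> J" by (simp add: J_def)
        show "((\<lambda>t. \<Phi> s x t - \<Phi> s1 x1 t) has_vector_derivative f s (\<Phi> s x t) - f s1 (\<Phi> s1 x1 t)) (at t within {-\<delta>..\<delta>})"
          using \<Phi>[OF sK xx tJ] \<Phi>[OF s1K x1 tJ] by (auto simp: J_def intro: has_vector_derivative_diff)
        have "dist (f (fst (s, \<Phi> s1 x1 t)) (snd (s, \<Phi> s1 x1 t))) (f (fst (s1, \<Phi> s1 x1 t)) (snd (s1, \<Phi> s1 x1 t))) < \<kappa>"
          by (rule h(2)) (use in_ball[OF s1K x1 tJ] sK s1K s \<eta> in \<open>auto simp: K_def dist_Pair_Pair\<close>)
        then have "norm (f s (\<Phi> s1 x1 t) - f s1 (\<Phi> s1 x1 t)) \<le> \<kappa>" by (simp add: dist_norm)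
        moreover have "norm (f s (\<Phi> s x t) - f s (\<Phi> s1 x1 t)) \<le> L * norm (\<Phi> s x t - \<Phi> s1 x1 t)"
          by (rule lip[OF sK in_ball[OF sK xx tJ] in_ball[OF s1K x1 tJ]])
        ultimately show "norm (f s (\<Phi> s x t) - f s1 (\<Phi> s1 x1 t)) \<le> L * norm (\<Phi> s x t - \<Phi> s1 x1 t) + \<kappa>"
          using norm_triangle_ineq[of "f s (\<Phi> s x t) - f s (\<Phi> s1 x1 t)" "f s (\<Phi> s1 x1 t) - f s1 (\<Phi> s1 x1 t)"] by simp
      qed (use L\<delta> t in \<open>auto simp: J_def\<close>)
      also have "\<dots> = 2 * dist x x1 + 2 * (\<kappa> * \<delta>)" using \<Phi>p(1) sK s1K by (simp add: dist_norm)
      also have "\<kappa> * \<delta> = e / 4" using \<delta> by (simp add: \<kappa>_def)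
      also have "2 * dist x x1 + 2 * (e / 4) < e" using x \<eta> by linarith
      finally show "dist (\<Phi> s x t) (\<Phi> s1 x1 t) < e" by (simp add: dist_norm)
    qed
  qed
  have pd: "\<exists>D. param_diff (\<lambda>s x. \<Phi> s x t) s1 x1 D" if s1: "dist s1 s0 < r" and x1: "dist x1 x0 < r" and t: "\<bar>t\<bar> < \<delta>" for s1 x1 t
  proof -
    have s1K: "s1 \<in> cball s0 R" using s1 R by (simp add: r_def dist_commute)
    have tJ: "t \<in> J" using t by (auto simp: J_def)
    define \<gamma> where "\<gamma> = \<Phi> s1 x1"
    define A where "A t = f' (s1, \<gamma> t)" for t
    have \<gamma>K: "(s1, \<gamma> t) \<in> K" if "t \<in> J" for t using in_ball[OF s1K x1 that] s1K by (simp add: K_def \<gamma>_def)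
    have AL: "norm (A t) \<le> L" if "t \<in> J" for t using L(2)[OF \<gamma>K[OF that]] by (simp add: A_def)
    have \<gamma>c: "continuous_on J \<gamma>" unfolding \<gamma>_def by (rule continuous_on_vector_derivative[OF \<Phi>[OF s1K x1]])
    have Ac: "continuous_on J A" unfolding A_def
      by (rule continuous_on_compose2[OF continuous_on_subset[OF cf' KW]]) (auto intro!: continuous_intros \<gamma>c \<gamma>K)
    have Alip: "norm (A t u) \<le> L * norm u" if "t \<in> J" for t u
      using norm_blinfun[of "A t" u] mult_right_mono[OF AL[OF that] norm_ge_zero[of u]] by linarith
    \<comment> \<open>Solutions of the linearised equation along \<open>\<gamma>\<close>.\<close>
    have "\<exists>U. U 0 = u \<and> (\<forall>t\<in>J. (U has_vector_derivative A t (U t)) (at t within J))" for u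
      unfolding J_def
    proof (rule picard_lindelof[OF \<delta> _ _ L\<delta>])
      have "continuous_on (J \<times> UNIV) (\<lambda>z. A (fst z))"
        by (rule continuous_on_compose2[OF Ac]) (auto intro!: continuous_intros)
      then show "continuous_on ({-\<delta>..\<delta>} \<times> UNIV) (\<lambda>z. A (fst z) (snd z))"
        unfolding J_def by (intro continuous_intros)
      show "norm (A t x - A t y) \<le> L * norm (x - y)" if "t \<in> {-\<delta>..\<delta>}" for t x y
        using Alip[of t "x - y"] that by (simp add: J_def blinfun.diff_right)
    qed
    then obtain U where U: "\<And>u. U u 0 = u" "\<And>u t. t \<in> J \<Longrightarrow> (U u has_vector_derivative A t (U u t)) (at t within J)"
      by metis
    \<comment> \<open>A solution starting at 0 vanishes at time \<open>t\<close>. Applied to the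
      defects of additivity and homogeneity this gives linearity of \<open>D\<close>; applied to
      \<open>U u\<close> it gives the bound 2.\<close>
    have zero: "norm (z t) \<le> 2 * norm (z 0)" if "\<And>t. t \<in> J \<Longrightarrow> (z has_vector_derivative A t (z t)) (at t within J)" for z :: "real \<Rightarrow> 'e"
    proof -
      have "norm (z t) \<le> 2 * (norm (z 0) + 0 * \<delta>)"
        by (rule small_interval_gronwall[where z' = "\<lambda>t. A t (z t)" and L = L])
          (use that Alip tJ L\<delta> in \<open>auto simp: J_def\<close>)
      then show ?thesis by simp
    qed
    define D where "D u = U u t" for u
    have "D (u + v) - (D u + D v) = 0" for u v
    proof -
      have "norm (U (u + v) t - (U u t + U v t)) \<le> 2 * norm (U (u + v) 0 - (U u 0 + U v 0))"
        by (rule zero) (auto simp: blinfun.add_right blinfun.diff_right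
          intro!: has_vector_derivative_diff has_vector_derivative_add U)
      then show ?thesis by (simp add: U D_def)
    qed
    moreover have "D (k *\<^sub>R u) - k *\<^sub>R D u = 0" for u k
    proof -
      have "norm (U (k *\<^sub>R u) t - k *\<^sub>R U u t) \<le> 2 * norm (U (k *\<^sub>R u) 0 - k *\<^sub>R U u 0)"
        by (rule zero) (auto simp: blinfun.scaleR_right blinfun.diff_right
          intro!: has_vector_derivative_diff bounded_linear.has_vector_derivative[OF bounded_linear_scaleR_right] U)
      then show ?thesis by (simp add: U D_def)
    qed
    moreover have "norm (D u) \<le> norm u * 2" for u
      using zero[of "U u"] U by (simp add: D_def)
    ultimately have bl: "bounded_linear D" by (intro bounded_linear_intro[where K = 2]) auto
    have "param_diff (\<lambda>s x. \<Phi> s x t) s1 x1 D"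
      unfolding param_diff_def
    proof (intro conjI allI impI bl)
      show "isCont (\<lambda>s. \<Phi> s x1 t) s1"
        unfolding continuous_at_eps_delta using near[OF _ s1 x1] tJ by (metis dist_self)
      fix e :: real assume e: "e > 0"
      \<comment> \<open>The final bound is \<open>4 * e' * \<delta>\<close> times the distance: one
        factor 2 comes from the Gronwall bound, the other from the bound \<open>zb\<close> on the
        difference of the two solutions.\<close>
      define e' where "e' = e / (4 * \<delta>)"
      have e': "e' > 0" using e \<delta> by (simp add: e'_def)
      obtain h where h: "h > 0" "\<And>z z'. \<lbrakk>z \<in> K; z' \<in> K; dist z' z < h\<rbrakk> \<Longrightarrow> dist (f' z') (f' z) < e'"
        using ucf' e' unfolding uniformly_continuous_on_def by metis
      \<comment> \<open>Half of \<open>h\<close> is spent on the space component, the other half is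
        left for the parameter.\<close>
      obtain \<eta> where \<eta>: "\<eta> > 0" "\<And>s x t. \<lbrakk>dist s s1 < \<eta>; dist x x1 < \<eta>; t \<in> J\<rbrakk> \<Longrightarrow> dist x x0 < r \<and> s \<in> cball s0 R \<and> dist (\<Phi> s x t) (\<Phi> s1 x1 t) < h / 2"
        using near[OF half_gt_zero[OF h(1)] s1 x1] by blast
      show "\<exists>d>0. \<forall>s x y. dist s s1 < d \<longrightarrow> dist x x1 < d \<longrightarrow> dist y x1 < d \<longrightarrow>
             norm (\<Phi> s x t - \<Phi> s y t - D (x - y)) \<le> e * norm (x - y)"
      proof (intro exI[of _ "min \<eta> (h/2)"] conjI allI impI)
        show "0 < min \<eta> (h / 2)" using \<eta> h by simp
        fix s x y assume "dist s s1 < min \<eta> (h/2)" "dist x x1 < min \<eta> (h/2)" "dist y x1 < min \<eta> (h/2)"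
        then have sh: "dist s s1 < h / 2" and s: "dist s s1 < \<eta>" and x: "dist x x1 < \<eta>" and y: "dist y x1 < \<eta>" by auto
        have sK: "s \<in> cball s0 R" and x0r: "dist x x0 < r" and y0r: "dist y x0 < r"
          using \<eta>(2)[OF s x tJ] \<eta>(2)[OF s y tJ] by auto
        define z where "z t = \<Phi> s x t - \<Phi> s y t" for t
        have zd: "(z has_vector_derivative f s (\<Phi> s x t) - f s (\<Phi> s y t)) (at t within J)" if "t \<in> J" for t
          unfolding z_def by (intro has_vector_derivative_diff \<Phi> sK x0r y0r that)
        have z0: "z 0 = x - y" using \<Phi>p(1)[OF sK] by (simp add: z_def)
        have zb: "norm (z t) \<le> 2 * norm (x - y)" if "t \<in> J" for t
        proof -
          have "norm (z t) \<le> 2 * (norm (z 0) + 0 * \<delta>)"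
          proof (rule small_interval_gronwall[where L = L])
            fix t assume "t \<in> {-\<delta>..\<delta>}" then have t: "t \<in> J" by (simp add: J_def)
            show "(z has_vector_derivative f s (\<Phi> s x t) - f s (\<Phi> s y t)) (at t within {-\<delta>..\<delta>})" using zd[OF t] by (simp add: J_def)
            show "norm (f s (\<Phi> s x t) - f s (\<Phi> s y t)) \<le> L * norm (z t) + 0"
              using lip[OF sK in_ball[OF sK x0r t] in_ball[OF sK y0r t]] by (simp add: z_def)
          qed (use L\<delta> that in \<open>auto simp: J_def\<close>)
          then show ?thesis by (simp add: z0)
        qed
        have "norm (z t - U (x - y) t) \<le> 2 * (norm (z 0 - U (x - y) 0) + (e' * (2 * norm (x - y))) * \<delta>)"
        proof (rule small_interval_gronwall[where L = L and z' = "\<lambda>t. f s (\<Phi> s x t) - f s (\<Phi> s y t) - A t (U (x - y) t)"])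
          fix t assume "t \<in> {-\<delta>..\<delta>}" then have t: "t \<in> J" by (simp add: J_def)
          show "((\<lambda>t. z t - U (x - y) t) has_vector_derivative f s (\<Phi> s x t) - f s (\<Phi> s y t) - A t (U (x - y) t)) (at t within {-\<delta>..\<delta>})"
            using has_vector_derivative_diff[OF zd[OF t] U(2)[OF t]] by (simp add: J_def)
          \<comment> \<open>Linearisation of \<open>f\<close> on a convex set that contains both
            solutions at time \<open>t\<close> and lies where \<open>f'\<close> is uniformly
            continuous.\<close>
          have *: "norm (f s (\<Phi> s x t) - f s (\<Phi> s y t) - A t (\<Phi> s x t - \<Phi> s y t)) \<le> e' * norm (\<Phi> s x t - \<Phi> s y t)"
          proof (rule lin[of "ball (\<gamma> t) (h / 2) \<inter> cball x0 R"])
            show "\<Phi> s x t \<in> ball (\<gamma> t) (h / 2) \<inter> cball x0 R" "\<Phi> s y t \<in> ball (\<gamma> t) (h / 2) \<inter> cball x0 R"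
              using in_ball[OF sK x0r t] in_ball[OF sK y0r t] \<eta>(2)[OF s x t] \<eta>(2)[OF s y t] by (auto simp: \<gamma>_def dist_commute)
            fix w assume w: "w \<in> ball (\<gamma> t) (h / 2) \<inter> cball x0 R"
            have "dist (s, w) (s1, \<gamma> t) \<le> dist s s1 + dist w (\<gamma> t)"
              unfolding dist_Pair_Pair by (rule sqrt_sum_squares_le_sum_abs[THEN order_trans]) auto
            also have "\<dots> < h" using w sh by (simp add: dist_commute)
            finally have "dist (f' (s, w)) (f' (s1, \<gamma> t)) < e'"
              using h(2)[OF \<gamma>K[OF t], of "(s, w)"] sK w by (auto simp: K_def)
            then show "norm (f' (s, w) - A t) \<le> e'" by (simp add: A_def dist_norm)
          qed (use sK in \<open>auto intro: convex_Int\<close>)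
          have "norm (f s (\<Phi> s x t) - f s (\<Phi> s y t) - A t (U (x - y) t)) \<le>
             norm (A t (z t - U (x - y) t)) + norm (f s (\<Phi> s x t) - f s (\<Phi> s y t) - A t (z t))"
            using norm_triangle_ineq[of "A t (z t - U (x - y) t)" "f s (\<Phi> s x t) - f s (\<Phi> s y t) - A t (z t)"]
            by (simp add: blinfun.diff_right algebra_simps)
          also have "\<dots> \<le> L * norm (z t - U (x - y) t) + e' * norm (z t)"
            using Alip[OF t] * by (intro add_mono) (auto simp: z_def)
          also have "\<dots> \<le> L * norm (z t - U (x - y) t) + e' * (2 * norm (x - y))"
            using zb[OF t] e' by (intro add_left_mono mult_left_mono) auto
          finally show "norm (f s (\<Phi> s x t) - f s (\<Phi> s y t) - A t (U (x - y) t)) \<le> L * norm (z t - U (x - y) t) + e' * (2 * norm (x - y))" .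
        qed (use L\<delta> tJ in \<open>auto simp: J_def\<close>)
        also have "\<dots> = (4 * e' * \<delta>) * norm (x - y)" by (simp add: z0 U(1))
        also have "4 * e' * \<delta> = e" using \<delta> by (simp add: e'_def)
        finally show "norm (\<Phi> s x t - \<Phi> s y t - D (x - y)) \<le> e * norm (x - y)" by (simp add: z_def D_def)
      qed
    qed
    then show ?thesis by blast
  qed
  show thesis
  proof (rule that[of \<delta> r \<Phi>, OF \<delta>])
    show "r > 0" using R by (simp add: r_def)
    fix s x assume s: "dist s s0 < r" and x: "dist x x0 < r"
    have sK: "s \<in> cball s0 R" using s R by (simp add: r_def dist_commute)
    show "\<Phi> s x 0 = x" by (rule \<Phi>p(1)[OF sK])
    fix t assume t: "\<bar>t\<bar> < \<delta>"
    have tJ: "t \<in> J" "t \<in> interior J" using t by (auto simp: J_def)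
    show "(s, \<Phi> s x t) \<in> W \<and> (\<Phi> s x has_vector_derivative f s (\<Phi> s x t)) (at t)"
      using in_ball[OF sK x tJ(1)] sK KW \<Phi>[OF sK x tJ(1)] at_within_interior[OF tJ(2)] by (auto simp: K_def)
    show "\<exists>D. param_diff (\<lambda>s x. \<Phi> s x t) s x D" by (rule pd[OF s x t])
  qed
qed

section \<open>Charts, tangent vectors and flows on manifolds\<close>

text \<open>Smoothness is stated through directional derivatives; in finite dimension their
  continuity gives a derivative that is continuous in the operator norm.\<close>

lemma smooth_on_C1:
  fixes f :: "'a::euclidean_space \<Rightarrow> 'b::real_normed_vector"
  assumes "smooth_on S f"
  obtains f' where "\<And>x. x \<in> S \<Longrightarrow> (f has_derivative blinfun_apply (f' x)) (at x)"
    "continuous_on S f'" "\<And>x. x \<in> S \<Longrightarrow> blinfun_apply (f' x) = frechet_derivative f (at x)"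
proof -
  have 1: "Ck_on (Suc 0) S f" using assms unfolding smooth_on_def by blast
  then have d: "f differentiable (at x)" if "x \<in> S" for x using that by simp
  have c: "continuous_on S (\<lambda>x. frechet_derivative f (at x) w)" for w using 1 by simp
  define f' where "f' x = Blinfun (frechet_derivative f (at x))" for x
  have ap: "blinfun_apply (f' x) = frechet_derivative f (at x)" if "x \<in> S" for x
    using d[OF that] unfolding f'_def frechet_derivative_works
    by (simp add: bounded_linear_Blinfun_apply has_derivative_bounded_linear)
  show thesis
  proof (rule that[OF _ _ ap])
    show "(f has_derivative blinfun_apply (f' x)) (at x)" if "x \<in> S" for x
      using d[OF that] ap[OF that] by (simp add: frechet_derivative_works)
    show "continuous_on S f'"
      by (rule continuous_on_blinfun_componentwise) (use c ap in \<open>simp cong: continuous_on_cong\<close>)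
  qed
qed

text \<open>Off its domain the chart map \<open>snd d\<close> has arbitrary values, so
  differentiability of the coordinate expression alone does not keep \<open>g\<close> inside the
  chart near \<open>p\<close>; continuity of \<open>g\<close> at \<open>p\<close> is therefore part
  of the notion.\<close>

definition chart_deriv where
  "chart_deriv A c d g p D \<longleftrightarrow> c \<in> charts_at A p \<and> d \<in> charts_at A (g p) \<and> isCont g p \<and>
     ((\<lambda>x. snd d (g (chart_inv c x))) has_derivative D) (at (snd c p))"

text \<open>Joint continuity keeps \<open>G s q\<close> in the domain of \<open>d\<close> for all
  nearby parameters and points.\<close>

definition chart_param_diff where
  "chart_param_diff A c d G s p D \<longleftrightarrow> c \<in> charts_at A p \<and> d \<in> charts_at A (G s p) \<and>
     isCont (\<lambda>z. G (fst z) (snd z)) (s, p) \<and> param_diff (\<lambda>s x. snd d (G s (chart_inv c x))) s (snd c p) D"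

text \<open>The derivative of the change of charts, by which coordinate vectors at \<open>p\<close>
  are transformed, not the change of charts itself.\<close>

definition transition where
  "transition c d p = frechet_derivative (snd d \<circ> chart_inv c) (at (snd c p))"

lemma has_derivative_cong_nhds:
  assumes "(f has_derivative D) (at x)" "\<forall>\<^sub>F y in nhds x. f y = g y"
  shows "(g has_derivative D) (at x)"
proof (rule has_derivative_transform_eventually[OF assms(1)])
  show "\<forall>\<^sub>F y in at x. f y = g y" using assms(2) by (auto simp: eventually_at_filter elim: eventually_mono)
  show "f x = g x" using assms(2) by (rule eventually_nhds_x_imp_x)
qed simp

lemma has_vector_derivative_cong_nhds:
  assumes "(f has_vector_derivative D) (at x)" "\<forall>\<^sub>F y in nhds x. f y = g y"
  shows "(g has_vector_derivative D) (at x)"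
  using has_derivative_cong_nhds assms unfolding has_vector_derivative_def by blast

lemma isCont_eventually_in_open:
  assumes "isCont f a" "open S" "f a \<in> S"
  shows "\<forall>\<^sub>F x in nhds a. f x \<in> S"
  using assms continuous_at_open unfolding eventually_nhds by (metis image_subset_iff continuous_at_open)

locale smooth_manifold =
  fixes A :: "('a::{t2_space, second_countable_topology}, 'e::euclidean_space) chart set"
  assumes atlas: "smooth_atlas A"
begin

lemma chart_atI: "c \<in> A \<Longrightarrow> p \<in> fst c \<Longrightarrow> c \<in> charts_at A p"
  by (simp add: charts_at_def)

lemma charts_atD: "c \<in> charts_at A p \<Longrightarrow> c \<in> A" "c \<in> charts_at A p \<Longrightarrow> p \<in> fst c"
  by (auto simp: charts_at_def)

lemma ex_chart: "\<exists>c. c \<in> charts_at A p"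
  using atlas unfolding smooth_atlas_def charts_at_def by blast

lemma chart_at: "chart_at A p \<in> charts_at A p"
  unfolding chart_at_def using someI_ex[OF ex_chart] .

lemma chart_open: "c \<in> A \<Longrightarrow> open (fst c)" "c \<in> A \<Longrightarrow> open (chart_image c)"
  using atlas unfolding smooth_atlas_def by blast+

lemma chart_homeo: "c \<in> A \<Longrightarrow> homeomorphism (fst c) (chart_image c) (snd c) (chart_inv c)"
  using atlas unfolding smooth_atlas_def by blast

lemma inv_chart [simp]: "c \<in> A \<Longrightarrow> p \<in> fst c \<Longrightarrow> chart_inv c (snd c p) = p"
  using chart_homeo homeomorphism_apply1 by blast

lemma chart_inv [simp]: "c \<in> A \<Longrightarrow> x \<in> chart_image c \<Longrightarrow> snd c (chart_inv c x) = x"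
  using chart_homeo homeomorphism_apply2 by blast

lemma chart_inv_in [simp]: "c \<in> A \<Longrightarrow> x \<in> chart_image c \<Longrightarrow> chart_inv c x \<in> fst c"
  using chart_homeo[of c] unfolding homeomorphism_def by blast

lemma chart_in [simp]: "p \<in> fst c \<Longrightarrow> snd c p \<in> chart_image c"
  by (simp add: chart_image_def)

lemma isCont_chart: "c \<in> A \<Longrightarrow> p \<in> fst c \<Longrightarrow> isCont (snd c) p"
  using chart_homeo[of c] chart_open[of c] unfolding homeomorphism_def
  by (simp add: continuous_on_eq_continuous_at)

lemma isCont_chart_inv: "c \<in> A \<Longrightarrow> x \<in> chart_image c \<Longrightarrow> isCont (chart_inv c) x"
  using chart_homeo[of c] chart_open[of c] unfolding homeomorphism_def
  by (simp add: continuous_on_eq_continuous_at)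

lemma eventually_chart_image: "c \<in> charts_at A p \<Longrightarrow> \<forall>\<^sub>F x in nhds (snd c p). x \<in> chart_image c"
  using chart_open[of c] charts_atD[of c p] by (intro eventually_nhds_in_open) auto

text \<open>Allows identities between germs to be proved on the manifold and used in
  coordinates.\<close>

lemma eventually_chart_inv:
  assumes "c \<in> charts_at A p" "\<forall>\<^sub>F q in nhds p. P q"
  shows "\<forall>\<^sub>F x in nhds (snd c p). P (chart_inv c x)"
proof -
  obtain S where S: "open S" "p \<in> S" "\<forall>q\<in>S. P q" using assms(2) unfolding eventually_nhds by blast
  have "isCont (chart_inv c) (snd c p)" using charts_atD[OF assms(1)] by (intro isCont_chart_inv) auto
  then have "\<forall>\<^sub>F x in nhds (snd c p). chart_inv c x \<in> S"
    by (rule isCont_eventually_in_open) (use S charts_atD[OF assms(1)] in auto)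
  then show ?thesis using S(3) by (auto elim: eventually_mono)
qed

lemma overlap_open:
  assumes "c \<in> A" "open S"
  shows "open (snd c ` (fst c \<inter> S))"
proof -
  have "snd c ` (fst c \<inter> S) = chart_image c \<inter> chart_inv c -` S"
    using assms(1) by (auto simp: chart_image_def image_iff)
  moreover have "continuous_on (chart_image c) (chart_inv c)" using chart_homeo[OF assms(1)] by (simp add: homeomorphism_def)
  ultimately show ?thesis using continuous_open_preimage chart_open(2) assms by (metis)
qed

section \<open>Derivatives of germs in charts\<close>

text \<open>The identity read in two charts is the change of coordinates. Composing with it on
  either side is the way to pass to other charts.\<close>

lemma chart_deriv_id:
  assumes "c \<in> charts_at A p" "d \<in> charts_at A p"
  shows "chart_deriv A c d (\<lambda>q. q) p (transition c d p)"
    "chart_param_diff A c d (\<lambda>s q. q) s p (transition c d p)"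
proof -
  note m = charts_atD[OF assms(1)] charts_atD[OF assms(2)]
  have "smooth_on (snd c ` (fst c \<inter> fst d)) (snd d \<circ> chart_inv c)"
    using atlas m unfolding smooth_atlas_def by blast
  then obtain f' where f': "\<And>x. x \<in> snd c ` (fst c \<inter> fst d) \<Longrightarrow> ((snd d \<circ> chart_inv c) has_derivative blinfun_apply (f' x)) (at x)"
    "continuous_on (snd c ` (fst c \<inter> fst d)) f'" "\<And>x. x \<in> snd c ` (fst c \<inter> fst d) \<Longrightarrow> blinfun_apply (f' x) = frechet_derivative (snd d \<circ> chart_inv c) (at x)"
    using smooth_on_C1 by metis
  have p: "snd c p \<in> snd c ` (fst c \<inter> fst d)" using m by auto
  have t: "transition c d p = blinfun_apply (f' (snd c p))" using f'(3)[OF p] by (simp add: transition_def)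
  show "chart_deriv A c d (\<lambda>q. q) p (transition c d p)"
    using f'(1)[OF p] assms by (simp add: chart_deriv_def t o_def)
  have "param_diff (\<lambda>s. snd d \<circ> chart_inv c) s (snd c p) (blinfun_apply ((\<lambda>z. f' (snd z)) (s, snd c p)))"
  proof (rule param_diff_C1)
    show "open (UNIV \<times> snd c ` (fst c \<inter> fst d) :: (real \<times> 'e) set)"
      using overlap_open[OF m(1) chart_open(1)[OF m(3)]] by (intro open_Times) auto
    show "continuous_on (UNIV \<times> snd c ` (fst c \<inter> fst d) :: (real \<times> 'e) set) (\<lambda>z. f' (snd z))"
      by (rule continuous_on_compose2[OF f'(2)]) (auto intro!: continuous_intros)
  next
    fix z :: "real \<times> 'e" assume "z \<in> UNIV \<times> snd c ` (fst c \<inter> fst d)"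
    then have "snd z \<in> snd c ` (fst c \<inter> fst d)" by auto
    from f'(1)[OF this] show "((snd d \<circ> chart_inv c) has_derivative blinfun_apply (f' (snd z))) (at (snd z))" .
  qed (use p in auto)
  then show "chart_param_diff A c d (\<lambda>s q. q) s p (transition c d p)"
    using assms isCont_snd[OF continuous_ident, of "(s, p)"] by (simp add: chart_param_diff_def t o_def)
qed

lemma chart_deriv_cong:
  assumes "chart_deriv A c d g p D" "\<forall>\<^sub>F q in nhds p. g q = h q"
  shows "chart_deriv A c d h p D"
proof -
  have gh: "g p = h p" using assms(2) eventually_nhds_x_imp_x by blast
  have c: "c \<in> charts_at A p" using assms(1) by (simp add: chart_deriv_def)
  have "\<forall>\<^sub>F x in nhds (snd c p). snd d (g (chart_inv c x)) = snd d (h (chart_inv c x))"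
    using eventually_chart_inv[OF c assms(2)] by eventually_elim simp
  then have "((\<lambda>x. snd d (h (chart_inv c x))) has_derivative D) (at (snd c p))"
    by (rule has_derivative_cong_nhds[rotated]) (use assms(1) in \<open>simp add: chart_deriv_def\<close>)
  moreover have "isCont h p" using assms isCont_cong[of g h p] by (simp add: chart_deriv_def)
  ultimately show ?thesis using assms(1) gh by (simp add: chart_deriv_def)
qed

lemma chart_deriv_compose:
  assumes g: "chart_deriv A c d g p D" and h: "chart_deriv A d e h (g p) D'"
  shows "chart_deriv A c e (\<lambda>q. h (g q)) p (\<lambda>u. D' (D u))"
proof -
  have c: "c \<in> charts_at A p" "d \<in> charts_at A (g p)" "e \<in> charts_at A (h (g p))"
    using g h by (auto simp: chart_deriv_def)
  have ic: "isCont g p" "isCont h (g p)" using g h by (auto simp: chart_deriv_def)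
  have "\<forall>\<^sub>F q in nhds p. g q \<in> fst d"
    using ic c chart_open charts_atD[OF c(2)] by (intro isCont_eventually_in_open) auto
  then have "\<forall>\<^sub>F x in nhds (snd c p). g (chart_inv c x) \<in> fst d" using c eventually_chart_inv by blast
  then have ev: "\<forall>\<^sub>F x in nhds (snd c p). snd e (h (chart_inv d (snd d (g (chart_inv c x))))) = snd e (h (g (chart_inv c x)))"
    by eventually_elim (use charts_atD[OF c(2)] in simp)
  have "((\<lambda>x. snd e (h (chart_inv d (snd d (g (chart_inv c x)))))) has_derivative (\<lambda>u. D' (D u))) (at (snd c p))"
    using g h charts_atD[OF c(1)] unfolding chart_deriv_def
    by (intro has_derivative_compose[of "\<lambda>x. snd d (g (chart_inv c x))" D _ UNIV "\<lambda>y. snd e (h (chart_inv d y))"]) auto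
  then have "((\<lambda>x. snd e (h (g (chart_inv c x)))) has_derivative (\<lambda>u. D' (D u))) (at (snd c p))"
    by (rule has_derivative_cong_nhds[OF _ ev])
  then show ?thesis using c ic by (simp add: chart_deriv_def isCont_o2)
qed

lemma chart_deriv_unique:
  "\<lbrakk>chart_deriv A c d g p D; chart_deriv A c d g p D'\<rbrakk> \<Longrightarrow> D = D'"
  unfolding chart_deriv_def by (metis has_derivative_unique)

lemma chart_deriv_linear: "chart_deriv A c d g p D \<Longrightarrow> linear D"
  unfolding chart_deriv_def by (metis has_derivative_linear)

lemma chart_deriv_change:
  assumes g: "chart_deriv A c d g p D" and c': "c' \<in> charts_at A p" "d' \<in> charts_at A (g p)"
  shows "chart_deriv A c' d' g p (\<lambda>u. transition d d' (g p) (D (transition c' c p u)))"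
proof -
  have c: "c \<in> charts_at A p" "d \<in> charts_at A (g p)" using g by (auto simp: chart_deriv_def)
  show ?thesis
    using chart_deriv_compose[OF chart_deriv_compose[OF chart_deriv_id(1)[OF c'(1) c(1)] g] chart_deriv_id(1)[OF c(2) c'(2)]]
    by simp
qed

lemma transition_linear: "c \<in> charts_at A p \<Longrightarrow> d \<in> charts_at A p \<Longrightarrow> linear (transition c d p)"
  using chart_deriv_id(1) chart_deriv_linear by blast

text \<open>Chain rule for the identity map through an intermediate chart.\<close>

lemma transition_cocycle:
  assumes "c \<in> charts_at A p" "d \<in> charts_at A p" "e \<in> charts_at A p"
  shows "transition d e p (transition c d p u) = transition c e p u"
  using chart_deriv_unique[OF chart_deriv_compose[OF chart_deriv_id(1)[OF assms(1,2)] chart_deriv_id(1)[OF assms(2,3)]]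
    chart_deriv_id(1)[OF assms(1,3)]] by (rule fun_cong)

lemma transition_same:
  assumes c: "c \<in> charts_at A p"
  shows "transition c c p u = u"
proof -
  have "((\<lambda>x. snd c (chart_inv c x)) has_derivative (\<lambda>u. u)) (at (snd c p))"
    by (rule has_derivative_cong_nhds[OF has_derivative_ident])
      (use eventually_chart_image[OF c] charts_atD[OF c] in \<open>auto elim: eventually_mono\<close>)
  moreover have "((\<lambda>x. snd c (chart_inv c x)) has_derivative transition c c p) (at (snd c p))"
    using chart_deriv_id(1)[OF c c] by (simp add: chart_deriv_def)
  ultimately show ?thesis using has_derivative_unique by metis
qed

lemma smooth_map_chart_deriv:
  assumes "smooth_map A f" "c \<in> charts_at A p" "d \<in> charts_at A (f p)"
  shows "\<exists>D. chart_deriv A c d f p D"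
proof -
  note m = charts_atD[OF assms(2)] charts_atD[OF assms(3)]
  have s: "smooth_on (snd c ` (fst c \<inter> f -` fst d)) (snd d \<circ> f \<circ> chart_inv c)" and cf: "continuous_on UNIV f"
    using assms(1) m unfolding smooth_map_def by auto
  obtain f' where "\<And>x. x \<in> snd c ` (fst c \<inter> f -` fst d) \<Longrightarrow> ((snd d \<circ> f \<circ> chart_inv c) has_derivative blinfun_apply (f' x)) (at x)"
    using smooth_on_C1[OF s] by metis
  then have "((snd d \<circ> f \<circ> chart_inv c) has_derivative blinfun_apply (f' (snd c p))) (at (snd c p))" using m by auto
  moreover have "isCont f p" using cf by (simp add: continuous_on_eq_continuous_at)
  ultimately show ?thesis using assms by (auto simp: chart_deriv_def o_def)
qed

subsection \<open>Tangent vectors\<close>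

lemma tangent_transition:
  "\<lbrakk>\<xi> \<in> tangent_space A p; c \<in> charts_at A p; d \<in> charts_at A p\<rbrakk> \<Longrightarrow> \<xi> d = transition c d p (\<xi> c)"
  unfolding tangent_space_def transition_def by blast

lemma tangent_spaceI:
  assumes "\<And>c. c \<notin> charts_at A p \<Longrightarrow> \<xi> c = 0"
    "\<And>c d. \<lbrakk>c \<in> charts_at A p; d \<in> charts_at A p\<rbrakk> \<Longrightarrow> \<xi> d = transition c d p (\<xi> c)"
  shows "\<xi> \<in> tangent_space A p"
  using assms unfolding tangent_space_def transition_def by blast

lemma tangent_outside: "\<xi> \<in> tangent_space A p \<Longrightarrow> c \<notin> charts_at A p \<Longrightarrow> \<xi> c = 0"
  unfolding tangent_space_def by blast

lemma tangent_eqI: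
  assumes "\<xi> \<in> tangent_space A p" "\<eta> \<in> tangent_space A p" "c \<in> charts_at A p" "\<xi> c = \<eta> c"
  shows "\<xi> = \<eta>"
proof
  fix d show "\<xi> d = \<eta> d"
  proof (cases "d \<in> charts_at A p")
    case True
    then show ?thesis
      using tangent_transition[OF assms(1,3) True] tangent_transition[OF assms(2,3) True] assms(4) by simp
  next
    case False
    then show ?thesis using tangent_outside[OF assms(1)] tangent_outside[OF assms(2)] by simp
  qed
qed

lemma coord_vec_tangent:
  assumes "c \<in> charts_at A p"
  shows "coord_vec A c p w \<in> tangent_space A p" "coord_vec A c p w c = w"
proof -
  have e: "coord_vec A c p w d = (if d \<in> charts_at A p then transition c d p w else 0)" for d
    by (simp add: coord_vec_def transition_def)
  show "coord_vec A c p w c = w" using assms transition_same[OF assms] by (simp add: e)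
  show "coord_vec A c p w \<in> tangent_space A p"
    by (rule tangent_spaceI) (use transition_cocycle[OF assms] in \<open>simp_all add: e\<close>)
qed

lemma coord_vec_coord:
  "\<lbrakk>\<xi> \<in> tangent_space A p; c \<in> charts_at A p\<rbrakk> \<Longrightarrow> coord_vec A c p (\<xi> c) = \<xi>"
  using tangent_eqI coord_vec_tangent by metis

lemma subspace_tangent_space: "subspace (tangent_space A p)"
  unfolding subspace_def
proof (intro conjI ballI allI)
  show "0 \<in> tangent_space A p"
    by (rule tangent_spaceI) (use transition_linear in \<open>auto simp: linear_0\<close>)
  fix \<xi> assume \<xi>: "\<xi> \<in> tangent_space A p"
  show "k *\<^sub>R \<xi> \<in> tangent_space A p" for k
  proof (rule tangent_spaceI)
    fix c d assume cd: "c \<in> charts_at A p" "d \<in> charts_at A p"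
    show "(k *\<^sub>R \<xi>) d = transition c d p ((k *\<^sub>R \<xi>) c)"
      using tangent_transition[OF \<xi> cd] linear_scale[OF transition_linear[OF cd]] by (simp only: scaleR_fun_def)
  qed (use tangent_outside[OF \<xi>] in \<open>simp add: scaleR_fun_def\<close>)
  fix \<eta> assume \<eta>: "\<eta> \<in> tangent_space A p"
  show "\<xi> + \<eta> \<in> tangent_space A p"
  proof (rule tangent_spaceI)
    fix c d assume cd: "c \<in> charts_at A p" "d \<in> charts_at A p"
    show "(\<xi> + \<eta>) d = transition c d p ((\<xi> + \<eta>) c)"
      using tangent_transition[OF \<xi> cd] tangent_transition[OF \<eta> cd] linear_add[OF transition_linear[OF cd]]
      by (simp only: plus_fun_apply)
  qed (use tangent_outside[OF \<xi>] tangent_outside[OF \<eta>] in simp)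
qed

text \<open>\<open>dmap\<close> is computed in an arbitrarily chosen chart; the transformation rule
  of \<open>\<xi>\<close> compensates the change to \<open>c\<close>, so the choice has no
  effect.\<close>

lemma dmap_chart_deriv:
  assumes g: "chart_deriv A c d g p D" and \<xi>: "\<xi> \<in> tangent_space A p"
  shows "dmap A g p \<xi> = coord_vec A d (g p) (D (\<xi> c))"
proof
  fix e
  have c: "c \<in> charts_at A p" "d \<in> charts_at A (g p)" using g by (auto simp: chart_deriv_def)
  show "dmap A g p \<xi> e = coord_vec A d (g p) (D (\<xi> c)) e"
  proof (cases "e \<in> charts_at A (g p)")
    case True
    have "((\<lambda>x. snd e (g (chart_inv (chart_at A p) x))) has_derivative
        (\<lambda>u. transition d e (g p) (D (transition (chart_at A p) c p u)))) (at (snd (chart_at A p) p))"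
      using chart_deriv_change[OF g chart_at True] by (simp add: chart_deriv_def)
    then have "frechet_derivative (snd e \<circ> g \<circ> chart_inv (chart_at A p)) (at (snd (chart_at A p) p)) =
        (\<lambda>u. transition d e (g p) (D (transition (chart_at A p) c p u)))"
      by (simp add: o_def frechet_derivative_at[symmetric])
    then show ?thesis
      using True tangent_transition[OF \<xi> chart_at c(1)]
      by (simp add: dmap_def Let_def coord_vec_def transition_def)
  qed (simp add: dmap_def coord_vec_def Let_def)
qed

lemma dmap_tangent:
  assumes "chart_deriv A c d g p D" "\<xi> \<in> tangent_space A p"
  shows "dmap A g p \<xi> \<in> tangent_space A (g p)" "dmap A g p \<xi> d = D (\<xi> c)"
  using coord_vec_tangent[of d "g p"] assms unfolding dmap_chart_deriv[OF assms] by (auto simp: chart_deriv_def)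

text \<open>One chart suffices: the transformation rule of \<open>\<xi>\<close> is the chain rule,
  and continuity keeps the curve in the domain of \<open>c\<close> for nearby times.\<close>

lemma has_velocityI:
  assumes \<xi>: "\<xi> \<in> tangent_space A (\<gamma> t)" and ic: "isCont \<gamma> t" and c: "c \<in> charts_at A (\<gamma> t)"
    and d: "((\<lambda>t. snd c (\<gamma> t)) has_vector_derivative \<xi> c) (at t)"
  shows "has_velocity A \<gamma> \<xi> t"
  unfolding has_velocity_def
proof (intro conjI \<xi> ic ballI)
  fix e assume e: "e \<in> charts_at A (\<gamma> t)"
  have "((\<lambda>x. snd e (chart_inv c x)) has_derivative transition c e (\<gamma> t)) (at (snd c (\<gamma> t)))"
    using chart_deriv_id(1)[OF c e] by (simp add: chart_deriv_def)
  then have "((\<lambda>t. snd e (chart_inv c (snd c (\<gamma> t)))) has_derivative (\<lambda>h. transition c e (\<gamma> t) (h *\<^sub>R \<xi> c))) (at t)"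
    using d unfolding has_vector_derivative_def
    by (intro has_derivative_compose[of "\<lambda>t. snd c (\<gamma> t)" _ _ UNIV "\<lambda>x. snd e (chart_inv c x)"]) auto
  then have "((\<lambda>t. snd e (chart_inv c (snd c (\<gamma> t)))) has_vector_derivative \<xi> e) (at t)"
    using linear_scale[OF transition_linear[OF c e]] tangent_transition[OF \<xi> c e]
    by (simp add: has_vector_derivative_def)
  moreover have "\<forall>\<^sub>F t in nhds t. \<gamma> t \<in> fst c"
    using ic chart_open charts_atD[OF c] by (intro isCont_eventually_in_open) auto
  then have "\<forall>\<^sub>F t in nhds t. snd e (chart_inv c (snd c (\<gamma> t))) = (snd e \<circ> \<gamma>) t"
    by eventually_elim (use charts_atD[OF c] in simp)
  ultimately show "((snd e \<circ> \<gamma>) has_vector_derivative \<xi> e) (at t)"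
    by (rule has_vector_derivative_cong_nhds)
qed

lemma has_velocityD:
  assumes "has_velocity A \<gamma> \<xi> t"
  shows "\<xi> \<in> tangent_space A (\<gamma> t)" "isCont \<gamma> t"
    "c \<in> charts_at A (\<gamma> t) \<Longrightarrow> ((\<lambda>t. snd c (\<gamma> t)) has_vector_derivative \<xi> c) (at t)"
  using assms by (auto simp: has_velocity_def o_def)

lemma has_velocity_cong:
  assumes "has_velocity A \<gamma> \<xi> t" "\<forall>\<^sub>F r in nhds t. \<gamma> r = \<gamma>' r"
  shows "has_velocity A \<gamma>' \<xi> t"
proof -
  have e: "\<gamma> t = \<gamma>' t" using assms(2) eventually_nhds_x_imp_x by blast
  obtain c where c: "c \<in> charts_at A (\<gamma> t)" using ex_chart by blast
  have ev: "\<forall>\<^sub>F r in nhds t. snd c (\<gamma> r) = snd c (\<gamma>' r)" using assms(2) by eventually_elim simp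
  show ?thesis
  proof (rule has_velocityI)
    show "isCont \<gamma>' t" using has_velocityD(2)[OF assms(1)] isCont_cong[OF assms(2)] by simp
    show "((\<lambda>t. snd c (\<gamma>' t)) has_vector_derivative \<xi> c) (at t)"
      by (rule has_vector_derivative_cong_nhds[OF has_velocityD(3)[OF assms(1) c] ev])
  qed (use e c has_velocityD(1)[OF assms(1)] in auto)
qed

lemma has_velocity_image:
  assumes v: "has_velocity A \<gamma> \<xi> t" and g: "chart_deriv A c d g (\<gamma> t) D"
  shows "has_velocity A (\<lambda>t. g (\<gamma> t)) (dmap A g (\<gamma> t) \<xi>) t"
proof (rule has_velocityI[where c = d])
  note v = has_velocityD[OF v]
  have c: "c \<in> charts_at A (\<gamma> t)" and d: "d \<in> charts_at A (g (\<gamma> t))" and ic: "isCont g (\<gamma> t)"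
   using g by (auto simp: chart_deriv_def)
  show "dmap A g (\<gamma> t) \<xi> \<in> tangent_space A (g (\<gamma> t))" by (rule dmap_tangent(1)[OF g v(1)])
  show "isCont (\<lambda>t. g (\<gamma> t)) t" by (rule isCont_o2[OF v(2) ic])
  show "d \<in> charts_at A (g (\<gamma> t))" by (rule d)
  have "((\<lambda>t. snd d (g (chart_inv c (snd c (\<gamma> t))))) has_derivative (\<lambda>h. D (h *\<^sub>R \<xi> c))) (at t)"
    using v(3)[OF c] g unfolding has_vector_derivative_def chart_deriv_def
    by (intro has_derivative_compose[of "\<lambda>t. snd c (\<gamma> t)" _ _ UNIV "\<lambda>x. snd d (g (chart_inv c x))"]) auto
  then have "((\<lambda>t. snd d (g (chart_inv c (snd c (\<gamma> t))))) has_vector_derivative dmap A g (\<gamma> t) \<xi> d) (at t)"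
    using linear_scale[OF chart_deriv_linear[OF g]] dmap_tangent(2)[OF g v(1)]
    by (simp add: has_vector_derivative_def)
  moreover have "\<forall>\<^sub>F t in nhds t. \<gamma> t \<in> fst c"
    using v chart_open charts_atD[OF c] by (intro isCont_eventually_in_open) auto
  then have "\<forall>\<^sub>F t in nhds t. snd d (g (chart_inv c (snd c (\<gamma> t)))) = snd d (g (\<gamma> t))"
    by eventually_elim (use charts_atD[OF c] in simp)
  ultimately show "((\<lambda>t. snd d (g (\<gamma> t))) has_vector_derivative dmap A g (\<gamma> t) \<xi> d) (at t)"
    by (rule has_vector_derivative_cong_nhds)
qed

lemma has_velocity_affine:
  assumes v: "has_velocity A \<gamma> \<xi> (a * r + b)"
  shows "has_velocity A (\<lambda>r. \<gamma> (a * r + b)) (a *\<^sub>R \<xi>) r"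
proof -
  note v = has_velocityD[OF v]
  obtain c where c: "c \<in> charts_at A (\<gamma> (a * r + b))" using ex_chart by blast
  show ?thesis
  proof (rule has_velocityI[where c = c])
    show "c \<in> charts_at A (\<gamma> (a * r + b))" by (rule c)
    show "a *\<^sub>R \<xi> \<in> tangent_space A (\<gamma> (a * r + b))" using v(1) subspace_tangent_space subspace_scale by blast
    show "isCont (\<lambda>r. \<gamma> (a * r + b)) r" by (rule isCont_o2[of r "\<lambda>r. a * r + b" \<gamma>, OF _ v(2)]) (auto intro!: continuous_intros)
    have "((\<lambda>r. snd c (\<gamma> (a * r + b))) has_derivative (\<lambda>h. (a * h) *\<^sub>R \<xi> c)) (at r)"
      using v(3)[OF c] unfolding has_vector_derivative_def
      by (intro has_derivative_compose[of "\<lambda>r. a * r + b" _ _ UNIV "\<lambda>t. snd c (\<gamma> t)"]) (auto intro!: derivative_eq_intros)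
    then show "((\<lambda>r. snd c (\<gamma> (a * r + b))) has_vector_derivative (a *\<^sub>R \<xi>) c) (at r)"
      by (simp add: has_vector_derivative_def scaleR_fun_def mult.commute)
  qed
qed


subsection \<open>Families of germs depending on a parameter\<close>

lemma chart_param_diff_chart_deriv:
  "chart_param_diff A c d G s p D \<Longrightarrow> chart_deriv A c d (G s) p D"
proof -
  assume G: "chart_param_diff A c d G s p D"
  have "isCont (\<lambda>q. (s, q)) p" by (auto intro!: continuous_intros)
  moreover have "isCont (\<lambda>z. G (fst z) (snd z)) (s, p)" using G by (simp add: chart_param_diff_def)
  ultimately have "isCont (\<lambda>q. (\<lambda>z. G (fst z) (snd z)) (s, q)) p"
    by (rule isCont_o2[of p "\<lambda>q. (s, q)" "\<lambda>z. G (fst z) (snd z)"])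
  then show ?thesis
    using G param_diff_has_derivative[of "\<lambda>s x. snd d (G s (chart_inv c x))"]
    by (simp add: chart_param_diff_def chart_deriv_def)
qed

text \<open>The estimates of \<open>param_diff\<close> use a single radius for parameter and
  coordinates, which has to be extracted from a neighbourhood in the product with the
  manifold.\<close>

lemma eventually_chart_inv_param:
  assumes c: "c \<in> charts_at A p" and ev: "\<forall>\<^sub>F z in nhds (s0, p). P z"
  obtains e where "e > 0" "\<And>s x. \<lbrakk>dist s s0 < e; dist x (snd c p) < e\<rbrakk> \<Longrightarrow> x \<in> chart_image c \<and> P (s, chart_inv c x)"
proof -
  obtain S where S: "open S" "(s0, p) \<in> S" "\<forall>z\<in>S. P z" using ev unfolding eventually_nhds by blast
  obtain U V where UV: "open U" "open V" "s0 \<in> U" "p \<in> V" "U \<times> V \<subseteq> S"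
    using open_prod_elim[OF S(1,2)] by (metis mem_Sigma_iff)
  obtain e1 where e1: "e1 > 0" "\<And>s. dist s s0 < e1 \<Longrightarrow> s \<in> U"
    using UV by (metis open_dist)
  have "\<forall>\<^sub>F q in nhds p. q \<in> V" using UV by (simp add: eventually_nhds_in_open)
  then have "\<forall>\<^sub>F x in nhds (snd c p). chart_inv c x \<in> V \<and> x \<in> chart_image c"
    by (intro eventually_conj eventually_chart_inv[OF c] eventually_chart_image[OF c])
  then obtain e2 where e2: "e2 > 0" "\<And>x. dist x (snd c p) < e2 \<Longrightarrow> chart_inv c x \<in> V \<and> x \<in> chart_image c"
    unfolding eventually_nhds_metric by blast
  show thesis
    by (rule that[of "min e1 e2"]) (use e1 e2 UV(5) S(3) in auto)
qed

lemma chart_param_diff_cong: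
  assumes G: "chart_param_diff A c d G s p D" and ev: "\<forall>\<^sub>F z in nhds (s, p). G (fst z) (snd z) = G' (fst z) (snd z)"
  shows "chart_param_diff A c d G' s p D"
proof -
  have c: "c \<in> charts_at A p" using G by (simp add: chart_param_diff_def)
  have e: "G s p = G' s p" using eventually_nhds_x_imp_x[OF ev] by simp
  obtain r where r: "r > 0" "\<And>s' x. \<lbrakk>dist s' s < r; dist x (snd c p) < r\<rbrakk> \<Longrightarrow> G s' (chart_inv c x) = G' s' (chart_inv c x)"
    by (rule eventually_chart_inv_param[OF c ev]) auto
  have P: "param_diff (\<lambda>s x. snd d (G s (chart_inv c x))) s (snd c p) D"
    using G by (simp add: chart_param_diff_def)
  have "param_diff (\<lambda>s x. snd d (G' s (chart_inv c x))) s (snd c p) D"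
    by (rule param_diff_cong[OF P r(1)]) (simp add: r(2))
  then show ?thesis using G e isCont_cong[OF ev] by (simp add: chart_param_diff_def)
qed

lemma chart_param_diff_compose:
  assumes g: "chart_param_diff A c d G s p D" and h: "chart_param_diff A d e K s (G s p) D'"
  shows "chart_param_diff A c e (\<lambda>s q. K s (G s q)) s p (\<lambda>u. D' (D u))"
proof -
  have c: "c \<in> charts_at A p" "d \<in> charts_at A (G s p)" "e \<in> charts_at A (K s (G s p))"
    using g h by (auto simp: chart_param_diff_def)
  have ic: "isCont (\<lambda>z. G (fst z) (snd z)) (s, p)" "isCont (\<lambda>z. K (fst z) (snd z)) (s, G s p)"
    using g h by (auto simp: chart_param_diff_def)
  have "isCont (\<lambda>z. (fst z, G (fst z) (snd z))) (s, p)" using ic(1) by (auto intro!: continuous_intros)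
  then have k: "isCont (\<lambda>z. K (fst z) (G (fst z) (snd z))) (s, p)"
    using isCont_o2[of "(s, p)" "\<lambda>z. (fst z, G (fst z) (snd z))" "\<lambda>z. K (fst z) (snd z)"] ic(2) by simp
  have "\<forall>\<^sub>F z in nhds (s, p). G (fst z) (snd z) \<in> fst d"
    using ic c chart_open charts_atD[OF c(2)] by (intro isCont_eventually_in_open) auto
  then obtain r where r: "r > 0" "\<And>s' x. \<lbrakk>dist s' s < r; dist x (snd c p) < r\<rbrakk> \<Longrightarrow> G s' (chart_inv c x) \<in> fst d"
    by (rule eventually_chart_inv_param[OF c(1)]) auto
  have "param_diff (\<lambda>s x. snd e (K s (chart_inv d (snd d (G s (chart_inv c x)))))) s (snd c p) (\<lambda>u. D' (D u))"
    using g h charts_atD[OF c(1)]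
    by (intro param_diff_compose[of "\<lambda>s x. snd d (G s (chart_inv c x))" s "snd c p" D "\<lambda>s y. snd e (K s (chart_inv d y))"])
       (auto simp: chart_param_diff_def)
  then have "param_diff (\<lambda>s x. snd e (K s (G s (chart_inv c x)))) s (snd c p) (\<lambda>u. D' (D u))"
    by (rule param_diff_cong[OF _ r(1)]) (use r charts_atD[OF c(2)] in simp)
  then show ?thesis using c k by (simp add: chart_param_diff_def)
qed

lemma chart_param_diff_change:
  assumes g: "chart_param_diff A c d G s p D" and c': "c' \<in> charts_at A p" "d' \<in> charts_at A (G s p)"
  shows "\<exists>D. chart_param_diff A c' d' G s p D"
proof -
  have c: "c \<in> charts_at A p" "d \<in> charts_at A (G s p)" using g by (auto simp: chart_param_diff_def)
  show ?thesis
    by (rule exI) (rule chart_param_diff_compose[OF chart_param_diff_compose[OF chart_deriv_id(2)[OF c'(1) c(1), of s] g] chart_deriv_id(2)[OF c(2) c'(2), of s]])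
qed

end

subsection \<open>Flows of families of vector fields\<close>

text \<open>Openness makes the velocity two-sided at every time of \<open>I\<close>; a connected
  \<open>I\<close> is an interval, as in the description of \<open>flow\<close>.\<close>

definition int_curve where
  "int_curve A X \<gamma> I \<longleftrightarrow> open I \<and> connected I \<and> (\<forall>r\<in>I. has_velocity A \<gamma> (X (\<gamma> r)) r)"

lemma int_curve_subset: "int_curve A X \<gamma> I \<Longrightarrow> open J \<Longrightarrow> connected J \<Longrightarrow> J \<subseteq> I \<Longrightarrow> int_curve A X \<gamma> J"
  by (auto simp: int_curve_def)

text \<open>Only derivatives in space are recorded, jointly continuous in parameter and point: this
  is the input of \<open>local_flow_euclid\<close>.\<close>

locale smooth_field_family = smooth_manifold A
  for A :: "('a::{t2_space, second_countable_topology}, 'e::euclidean_space) chart set" +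
  fixes J :: "real set" and Y :: "real \<Rightarrow> 'a \<Rightarrow> ('a, 'e) tvec"
  assumes J: "open J"
    and tangent: "\<And>s p. s \<in> J \<Longrightarrow> Y s p \<in> tangent_space A p"
    and field_C1: "\<And>c. c \<in> A \<Longrightarrow> \<exists>f'. continuous_on (J \<times> chart_image c) (\<lambda>z. Y (fst z) (chart_inv c (snd z)) c) \<and>
        continuous_on (J \<times> chart_image c) f' \<and>
        (\<forall>z\<in>J \<times> chart_image c. ((\<lambda>x. Y (fst z) (chart_inv c x) c) has_derivative blinfun_apply (f' z)) (at (snd z)))"
begin

section \<open>Uniqueness and gluing of integral curves\<close>

lemma int_curve_shift:
  assumes "int_curve A (Y s) \<gamma> I"
  shows "int_curve A (Y s) (\<lambda>r. \<gamma> (r + b)) ((\<lambda>r. r - b) ` I)"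
  unfolding int_curve_def
proof (intro conjI ballI)
  show "open ((\<lambda>r. r - b) ` I)" using assms open_translation_subtract by (auto simp: int_curve_def)
  show "connected ((\<lambda>r. r - b) ` I)"
    using assms unfolding int_curve_def by (intro connected_continuous_image continuous_intros) auto
  fix r assume "r \<in> (\<lambda>r. r - b) ` I"
  then have "has_velocity A \<gamma> (Y s (\<gamma> (r + b))) (1 * r + b)" using assms by (auto simp: int_curve_def)
  from has_velocity_affine[OF this] show "has_velocity A (\<lambda>r. \<gamma> (r + b)) (Y s (\<gamma> (r + b))) r" by simp
qed

text \<open>In a chart around the common point the field is Lipschitz, and on an interval of
  half-length at most \<open>1 / (2 * L)\<close> the Gronwall bound with zero initial difference
  forces equality.\<close>

lemma local_uniqueness:
  assumes s: "s \<in> J" and \<gamma>: "int_curve A (Y s) \<gamma> I" "int_curve A (Y s) \<gamma>' I" and t0: "t0 \<in> I" "\<gamma> t0 = \<gamma>' t0"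
  shows "\<forall>\<^sub>F t in nhds t0. \<gamma> t = \<gamma>' t"
proof -
  obtain c where c: "c \<in> charts_at A (\<gamma> t0)" using ex_chart by blast
  note m = charts_atD[OF c]
  define f where "f s x = Y s (chart_inv c x) c" for s x
  define x0 where "x0 = snd c (\<gamma> t0)"
  obtain f' where f': "continuous_on (J \<times> chart_image c) (\<lambda>z. f (fst z) (snd z))"
    "continuous_on (J \<times> chart_image c) f'" "\<And>z. z \<in> J \<times> chart_image c \<Longrightarrow> (f (fst z) has_derivative blinfun_apply (f' z)) (at (snd z))"
    using field_C1[OF m(1)] unfolding f_def by blast
  have x0: "x0 \<in> chart_image c" using m by (simp add: x0_def)
  have "isCont (\<lambda>z. f (fst z) (snd z)) (s, x0)"
    using f'(1) J chart_open(2)[OF m(1)] s x0 by (simp add: continuous_on_eq_continuous_at open_Times)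
  then have "isCont (\<lambda>s. f s x0) s" using isCont_o2[of s "\<lambda>s. (s, x0)" "\<lambda>z. f (fst z) (snd z)"] by simp
  then have pd: "param_diff f s x0 (f' (s, x0))"
    using param_diff_C1[of "J \<times> chart_image c" s x0 f' f] f' J chart_open(2)[OF m(1)] s x0
    by (auto intro: open_Times)
  obtain e where e: "e > 0" "\<And>s' x y. \<lbrakk>dist s' s < e; dist x x0 < e; dist y x0 < e\<rbrakk> \<Longrightarrow>
     norm (f s' x - f s' y - f' (s, x0) (x - y)) \<le> 1 * norm (x - y)" using param_diffD[OF pd, of 1] by auto
  define L where "L = norm (f' (s, x0)) + 1"
  have lip: "norm (f s x - f s y) \<le> L * norm (x - y)" if "dist x x0 < e" "dist y x0 < e" for x y
  proof -
    have "norm (f s x - f s y) \<le> norm (f s x - f s y - f' (s, x0) (x - y)) + norm (f' (s, x0) (x - y))"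
      using norm_triangle_sub[of "f s x - f s y" "f' (s, x0) (x - y)"] by (simp add: add.commute)
    also have "\<dots> \<le> 1 * norm (x - y) + norm (f' (s, x0)) * norm (x - y)"
      using e that norm_blinfun by (intro add_mono) auto
    finally show ?thesis by (simp add: L_def algebra_simps)
  qed
  have "\<forall>\<^sub>F t in nhds t0. g t \<in> fst c \<and> dist (snd c (g t)) x0 < e \<and> t \<in> I"
    if g: "int_curve A (Y s) g I" "g t0 = \<gamma> t0" for g
  proof -
    have ic: "isCont g t0" using g t0 by (auto simp: int_curve_def dest: has_velocityD(2))
    have "\<forall>\<^sub>F t in nhds t0. g t \<in> fst c" using ic chart_open m g by (intro isCont_eventually_in_open) auto
    moreover have "isCont (\<lambda>t. snd c (g t)) t0" by (rule isCont_o2[OF ic]) (use isCont_chart m g in simp)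
    then have "\<forall>\<^sub>F t in nhds t0. snd c (g t) \<in> ball x0 e" using e g by (intro isCont_eventually_in_open) (auto simp: x0_def)
    moreover have "\<forall>\<^sub>F t in nhds t0. t \<in> I" using g t0 by (intro eventually_nhds_in_open) (auto simp: int_curve_def)
    ultimately show ?thesis by eventually_elim (auto simp: dist_commute)
  qed
  from eventually_conj[OF this[OF \<gamma>(1) refl] this[OF \<gamma>(2) t0(2)[symmetric]]]
  obtain d where d: "d > 0" "\<And>t. dist t t0 < d \<Longrightarrow> (\<gamma> t \<in> fst c \<and> dist (snd c (\<gamma> t)) x0 < e \<and> t \<in> I) \<and>
     (\<gamma>' t \<in> fst c \<and> dist (snd c (\<gamma>' t)) x0 < e \<and> t \<in> I)" unfolding eventually_nhds_metric by blast
  have L: "L > 0" by (simp add: L_def add_nonneg_pos)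
  define \<delta> where "\<delta> = min (d / 2) (1 / (2 * L))"
  have \<delta>: "\<delta> > 0" "\<delta> < d" using d(1) L by (auto simp: \<delta>_def)
  have "L * \<delta> \<le> L * (1 / (2 * L))" using L by (intro mult_left_mono) (auto simp: \<delta>_def)
  then have L\<delta>: "L * \<delta> \<le> 1 / 2" using L by simp
  have dv: "((\<lambda>t. snd c (g (t + t0))) has_vector_derivative f s (snd c (g (t + t0)))) (at t)"
    if g: "int_curve A (Y s) g I" "\<And>t. dist t t0 < d \<Longrightarrow> g t \<in> fst c \<and> t \<in> I" and t: "t \<in> {-\<delta>..\<delta>}" for g t
  proof -
    have "dist (t + t0) t0 < d" using t \<delta> by (auto simp: dist_real_def)
    then have gt: "g (t + t0) \<in> fst c" "t + t0 \<in> I" using g(2) by auto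
    then have "has_velocity A g (Y s (g (t + t0))) (1 * t + t0)" using g(1) by (auto simp: int_curve_def)
    from has_velocityD(3)[OF has_velocity_affine[OF this], of c] show ?thesis using gt m by (simp add: f_def chart_atI)
  qed
  have "snd c (\<gamma> (t + t0)) - snd c (\<gamma>' (t + t0)) = 0" if t: "t \<in> {-\<delta>..\<delta>}" for t
  proof -
    have "norm (snd c (\<gamma> (t + t0)) - snd c (\<gamma>' (t + t0))) \<le> 2 * (norm (snd c (\<gamma> (0 + t0)) - snd c (\<gamma>' (0 + t0))) + 0 * \<delta>)"
    proof (rule small_interval_gronwall[where L = L])
      fix t assume t: "t \<in> {-\<delta>..\<delta>}"
      have td: "dist (t + t0) t0 < d" using t \<delta> by (auto simp: dist_real_def)
      show "((\<lambda>t. snd c (\<gamma> (t + t0)) - snd c (\<gamma>' (t + t0))) has_vector_derivative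
          f s (snd c (\<gamma> (t + t0))) - f s (snd c (\<gamma>' (t + t0)))) (at t within {-\<delta>..\<delta>})"
        by (rule has_vector_derivative_at_within[OF has_vector_derivative_diff[OF dv[OF \<gamma>(1) _ t] dv[OF \<gamma>(2) _ t]]])
          (use d(2) in blast)+
      show "norm (f s (snd c (\<gamma> (t + t0))) - f s (snd c (\<gamma>' (t + t0)))) \<le> L * norm (snd c (\<gamma> (t + t0)) - snd c (\<gamma>' (t + t0))) + 0"
        using lip d(2)[OF td] by auto
    qed (use L L\<delta> t in auto)
    then show ?thesis using t0 by simp
  qed
  note zero = this
  have eq: "snd c (\<gamma> t) = snd c (\<gamma>' t)" if "dist t t0 < \<delta>" for t
  proof -
    have "t - t0 \<in> {-\<delta>..\<delta>}" using that by (auto simp: dist_real_def)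
    from zero[OF this] show ?thesis by simp
  qed
  have "\<gamma> t = \<gamma>' t" if "dist t t0 < \<delta>" for t
  proof -
    have "dist t t0 < d" using that \<delta> by simp
    from d(2)[OF this] eq[OF that] show ?thesis using inv_chart[OF m(1)] by metis
  qed
  then show ?thesis using \<delta> unfolding eventually_nhds_metric by blast
qed

text \<open>Agreement spreads to nearby times by local uniqueness, disagreement because the manifold
  is Hausdorff. On a connected interval only one of the two can occur.\<close>

lemma int_curve_unique:
  assumes s: "s \<in> J" and \<gamma>: "int_curve A (Y s) \<gamma> I" "int_curve A (Y s) \<gamma>' I" and t: "t0 \<in> I" "\<gamma> t0 = \<gamma>' t0" "t \<in> I"
  shows "\<gamma> t = \<gamma>' t"
proof (rule connected_induction_simple[where S = I and P = "\<lambda>t. \<gamma> t = \<gamma>' t" and a = t0])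
  show "connected I" using \<gamma> by (simp add: int_curve_def)
  have oI: "open I" using \<gamma> by (simp add: int_curve_def)
  fix a assume a: "a \<in> I"
  show "\<exists>T. openin (top_of_set I) T \<and> a \<in> T \<and> (\<forall>x\<in>T. \<forall>y\<in>T. \<gamma> x = \<gamma>' x \<longrightarrow> \<gamma> y = \<gamma>' y)"
  proof (cases "\<gamma> a = \<gamma>' a")
    case True
    from local_uniqueness[OF s \<gamma> a True]
    obtain S where "open S" "a \<in> S" "\<forall>t\<in>S. \<gamma> t = \<gamma>' t" unfolding eventually_nhds by blast
    then show ?thesis using a by (intro exI[of _ "I \<inter> S"]) (auto simp: openin_open)
  next
    case False
    obtain U V where UV: "open U" "open V" "\<gamma> a \<in> U" "\<gamma>' a \<in> V" "U \<inter> V = {}" using hausdorff[OF False] by blast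
    have ic: "isCont \<gamma> a" "isCont \<gamma>' a" using \<gamma> a by (auto simp: int_curve_def dest: has_velocityD(2))
    have "\<forall>\<^sub>F t in nhds a. \<gamma> t \<in> U" "\<forall>\<^sub>F t in nhds a. \<gamma>' t \<in> V"
      using ic UV by (auto intro: isCont_eventually_in_open)
    then have "\<forall>\<^sub>F t in nhds a. \<gamma> t \<noteq> \<gamma>' t" by eventually_elim (use UV(5) in auto)
    then obtain S where "open S" "a \<in> S" "\<forall>t\<in>S. \<gamma> t \<noteq> \<gamma>' t" unfolding eventually_nhds by blast
    then show ?thesis using a by (intro exI[of _ "I \<inter> S"]) (auto simp: openin_open)
  qed
qed (use t in auto)

lemma int_curve_union:
  assumes s: "s \<in> J" and \<gamma>: "int_curve A (Y s) \<gamma> I" "int_curve A (Y s) \<gamma>' I'" and t0: "t0 \<in> I" "t0 \<in> I'" "\<gamma> t0 = \<gamma>' t0"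
  obtains g where "int_curve A (Y s) g (I \<union> I')" "\<And>t. t \<in> I \<Longrightarrow> g t = \<gamma> t" "\<And>t. t \<in> I' \<Longrightarrow> g t = \<gamma>' t"
proof -
  have o: "open I" "open I'" "connected I" "connected I'" using \<gamma> by (auto simp: int_curve_def)
  have oc: "open (I \<inter> I')" "connected (I \<inter> I')"
    using o by (auto simp: is_interval_connected_1[symmetric] intro: is_interval_Int)
  have agree: "\<gamma> t = \<gamma>' t" if "t \<in> I" "t \<in> I'" for t
    using int_curve_unique[OF s int_curve_subset[OF \<gamma>(1) oc] int_curve_subset[OF \<gamma>(2) oc], of t0 t] t0 that by auto
  define g where "g t = (if t \<in> I then \<gamma> t else \<gamma>' t)" for t
  have g: "t \<in> I \<Longrightarrow> g t = \<gamma> t" "t \<in> I' \<Longrightarrow> g t = \<gamma>' t" for t using agree by (auto simp: g_def)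
  have "has_velocity A g (Y s (g t)) t" if "t \<in> I \<union> I'" for t
    using that
  proof
    assume t: "t \<in> I"
    have "\<forall>\<^sub>F r in nhds t. \<gamma> r = g r" using eventually_nhds_in_open[OF o(1) t] by eventually_elim (simp add: g)
    then show ?thesis using has_velocity_cong[of \<gamma> "Y s (\<gamma> t)" t g] \<gamma>(1) t g by (simp add: int_curve_def)
  next
    assume t: "t \<in> I'"
    have "\<forall>\<^sub>F r in nhds t. \<gamma>' r = g r" using eventually_nhds_in_open[OF o(2) t] by eventually_elim (simp add: g)
    then show ?thesis using has_velocity_cong[of \<gamma>' "Y s (\<gamma>' t)" t g] \<gamma>(2) t g by (simp add: int_curve_def)
  qed
  moreover have "connected (I \<union> I')" using o t0 by (intro connected_Un) auto
  ultimately have "int_curve A (Y s) g (I \<union> I')" using o by (simp add: int_curve_def open_Un)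
  then show thesis using that g by blast
qed

text \<open>Two integral curves with the same starting point may have different domains, but they
  glue along 0 and so have the same endpoint; thus the definite description in \<open>flow\<close>
  is justified.\<close>

lemma flow_eq:
  assumes s: "s \<in> J" and \<gamma>: "int_curve A (Y s) \<gamma> I" and I: "0 \<in> I" "t \<in> I"
  shows "flow A (Y s) t (\<gamma> 0) = \<gamma> t"
  unfolding flow_def
proof (rule the_equality)
  show "\<exists>g I. open I \<and> connected I \<and> 0 \<in> I \<and> t \<in> I \<and> (\<forall>r\<in>I. has_velocity A g (Y s (g r)) r) \<and> g 0 = \<gamma> 0 \<and> g t = \<gamma> t"
    using assms unfolding int_curve_def by blast
  fix q assume "\<exists>g I. open I \<and> connected I \<and> 0 \<in> I \<and> t \<in> I \<and> (\<forall>r\<in>I. has_velocity A g (Y s (g r)) r) \<and> g 0 = \<gamma> 0 \<and> g t = q"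
  then obtain g I' where g: "int_curve A (Y s) g I'" "0 \<in> I'" "t \<in> I'" "g 0 = \<gamma> 0" "g t = q" unfolding int_curve_def by blast
  obtain h where "\<And>t. t \<in> I \<Longrightarrow> h t = \<gamma> t" "\<And>t. t \<in> I' \<Longrightarrow> h t = g t"
    by (rule int_curve_union[OF s \<gamma> g(1) I(1) g(2)]) (use g in auto)
  then show "q = \<gamma> t" using I(2) g(3,5) by metis
qed

section \<open>Regularity of the flow up to a given time\<close>

text \<open>The Euclidean flow carried over by one chart. The time \<open>\<delta>\<close> is common
  to all points of \<open>N\<close>, which is what continuation along a longer curve relies
  on.\<close>

lemma local_flow:
  assumes s0: "s0 \<in> J"
  obtains \<delta> N \<Phi> where "\<delta> > 0" "open N" "(s0, q0) \<in> N"
    "\<And>s q. (s, q) \<in> N \<Longrightarrow> s \<in> J \<and> int_curve A (Y s) (\<Phi> s q) {-\<delta><..<\<delta>} \<and> \<Phi> s q 0 = q"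
    "\<And>s q t. (s, q) \<in> N \<Longrightarrow> \<bar>t\<bar> < \<delta> \<Longrightarrow> \<exists>c d D. chart_param_diff A c d (\<lambda>s q. \<Phi> s q t) s q D"
proof -
  obtain c where c: "c \<in> charts_at A q0" using ex_chart by blast
  note m = charts_atD[OF c]
  define f where "f s x = Y s (chart_inv c x) c" for s x
  define x0 where "x0 = snd c q0"
  define W where "W = J \<times> chart_image c"
  obtain f' where f': "continuous_on W (\<lambda>z. f (fst z) (snd z))"
    "continuous_on W f'" "\<And>z. z \<in> W \<Longrightarrow> (f (fst z) has_derivative blinfun_apply (f' z)) (at (snd z))"
    using field_C1[OF m(1)] unfolding f_def W_def by blast
  have W: "open W" "(s0, x0) \<in> W" using J chart_open(2)[OF m(1)] s0 m by (auto simp: W_def x0_def open_Times)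
  obtain \<delta> r \<phi> where \<phi>: "\<delta> > 0" "r > 0"
    "\<And>s x. \<lbrakk>dist s s0 < r; dist x x0 < r\<rbrakk> \<Longrightarrow> \<phi> s x 0 = x"
    "\<And>s x t. \<lbrakk>dist s s0 < r; dist x x0 < r; \<bar>t\<bar> < \<delta>\<rbrakk> \<Longrightarrow>
       (s, \<phi> s x t) \<in> W \<and> (\<phi> s x has_vector_derivative f s (\<phi> s x t)) (at t)"
    "\<And>s x t. \<lbrakk>dist s s0 < r; dist x x0 < r; \<bar>t\<bar> < \<delta>\<rbrakk> \<Longrightarrow> \<exists>D. param_diff (\<lambda>s x. \<phi> s x t) s x D"
    apply (rule local_flow_euclid[OF W f'(1,2)])
     apply (erule f'(3))
    apply (rule that; assumption)
    done
  define N where "N = ball s0 r \<times> {q \<in> fst c. snd c q \<in> ball x0 r}"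
  define \<Phi> where "\<Phi> s q t = chart_inv c (\<phi> s (snd c q) t)" for s q t
  have "continuous_on (fst c) (snd c)" using chart_homeo[OF m(1)] by (simp add: homeomorphism_def)
  then have "open (fst c \<inter> snd c -` ball x0 r)" by (rule continuous_open_preimage) (use chart_open m in auto)
  moreover have "{q \<in> fst c. snd c q \<in> ball x0 r} = fst c \<inter> snd c -` ball x0 r" by auto
  ultimately have oN: "open N" unfolding N_def by (intro open_Times) auto
  show thesis
  proof (rule that[OF \<phi>(1) oN])
    show "(s0, q0) \<in> N" using m \<phi>(2) by (simp add: N_def x0_def)
    fix s q assume sq: "(s, q) \<in> N"
    have s: "dist s s0 < r" and q: "q \<in> fst c" and x: "dist (snd c q) x0 < r" using sq by (auto simp: N_def dist_commute)
    have "s \<in> J" using \<phi>(4)[OF s x, of 0] \<phi>(1) by (auto simp: W_def)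
    have img: "\<phi> s (snd c q) t \<in> chart_image c" if "\<bar>t\<bar> < \<delta>" for t using \<phi>(4)[OF s x that] by (auto simp: W_def)
    have "has_velocity A (\<Phi> s q) (Y s (\<Phi> s q t)) t" if t: "\<bar>t\<bar> < \<delta>" for t
    proof (rule has_velocityI[where c = c])
      have dv: "(\<phi> s (snd c q) has_vector_derivative f s (\<phi> s (snd c q) t)) (at t)" using \<phi>(4)[OF s x t] by simp
      show "Y s (\<Phi> s q t) \<in> tangent_space A (\<Phi> s q t)" by (rule tangent) fact
      show "isCont (\<Phi> s q) t" unfolding \<Phi>_def
        by (rule isCont_o2[OF has_vector_derivative_continuous[OF dv] isCont_chart_inv[OF m(1) img[OF t]]])
      show "c \<in> charts_at A (\<Phi> s q t)" using img[OF t] m by (simp add: \<Phi>_def chart_atI)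
      have "\<forall>\<^sub>F t in nhds t. t \<in> {-\<delta><..<\<delta>}" using t by (intro eventually_nhds_in_open) auto
      then have "\<forall>\<^sub>F t in nhds t. \<phi> s (snd c q) t = snd c (\<Phi> s q t)"
      proof eventually_elim
        case (elim t)
        then have "\<bar>t\<bar> < \<delta>" by auto
        from img[OF this] show ?case using m by (simp add: \<Phi>_def)
      qed
      from has_vector_derivative_cong_nhds[OF dv this]
      show "((\<lambda>t. snd c (\<Phi> s q t)) has_vector_derivative Y s (\<Phi> s q t) c) (at t)" by (simp add: f_def \<Phi>_def)
    qed
    then show "s \<in> J \<and> int_curve A (Y s) (\<Phi> s q) {-\<delta><..<\<delta>} \<and> \<Phi> s q 0 = q"
      using \<open>s \<in> J\<close> \<phi>(3)[OF s x] m q by (auto simp: int_curve_def \<Phi>_def)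
    fix t assume t: "\<bar>t\<bar> < \<delta>"
    obtain D where D: "param_diff (\<lambda>s x. \<phi> s x t) s (snd c q) D" using \<phi>(5)[OF s x t] by blast
    have cq: "c \<in> charts_at A q" using m q by (simp add: chart_atI)
    have "\<forall>\<^sub>F z in nhds (s, q). z \<in> N" using oN sq by (rule eventually_nhds_in_open)
    then obtain e where e: "e > 0" "\<And>s' x. \<lbrakk>dist s' s < e; dist x (snd c q) < e\<rbrakk> \<Longrightarrow> x \<in> chart_image c \<and> (s', chart_inv c x) \<in> N"
      using eventually_chart_inv_param[OF cq] by metis
    have "chart_param_diff A c c (\<lambda>s q. \<Phi> s q t) s q D"
      unfolding chart_param_diff_def
    proof (intro conjI cq)
      show "c \<in> charts_at A (\<Phi> s q t)" using img[OF t] m by (simp add: \<Phi>_def chart_atI)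
      show "param_diff (\<lambda>s x. snd c (\<Phi> s (chart_inv c x) t)) s (snd c q) D"
      proof (rule param_diff_cong[OF D e(1)])
        fix s' x assume "dist s' s < e" "dist x (snd c q) < e"
        from e(2)[OF this] have "dist s' s0 < r" "dist x x0 < r" "x \<in> chart_image c" using m by (auto simp: N_def dist_commute)
        then show "\<phi> s' x t = snd c (\<Phi> s' (chart_inv c x) t)"
          using \<phi>(4)[of s' x t] t m by (auto simp: \<Phi>_def W_def)
      qed
      have "isCont (\<lambda>z. (fst z, snd c (snd z))) (s, q)"
        using isCont_o2[of "(s, q)" snd "snd c"] isCont_chart m q by (auto intro!: continuous_intros)
      then have "isCont (\<lambda>z. \<phi> (fst z) (snd c (snd z)) t) (s, q)"
        using isCont_o2[of "(s, q)" "\<lambda>z. (fst z, snd c (snd z))" "\<lambda>z. \<phi> (fst z) (snd z) t"] param_diff_isCont[OF D] by simp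
      then show "isCont (\<lambda>z. \<Phi> (fst z) (snd z) t) (s, q)"
        unfolding \<Phi>_def by (rule isCont_o2) (use isCont_chart_inv[OF m(1) img[OF t]] in simp)
    qed
    then show "\<exists>c d D. chart_param_diff A c d (\<lambda>s q. \<Phi> s q t) s q D" by blast
  qed
qed

text \<open>As a definite description, \<open>flow\<close> has some value even where no integral
  curve reaches time \<open>T\<close>; existence of the curves nearby is therefore recorded along
  with differentiability.\<close>

definition flow_regular where
  "flow_regular s0 p0 T \<longleftrightarrow>
     (\<forall>\<^sub>F z in nhds (s0, p0). fst z \<in> J \<and> (\<exists>\<gamma> I. int_curve A (Y (fst z)) \<gamma> I \<and> \<gamma> 0 = snd z \<and> 0 \<in> I \<and> T \<in> I)) \<and>
     (\<exists>c d D. chart_param_diff A c d (\<lambda>s. flow A (Y s) T) s0 p0 D)"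

lemma flow_regular_0:
  assumes "s0 \<in> J"
  shows "flow_regular s0 p0 0"
proof -
  obtain \<delta> N \<Phi> where \<Phi>: "\<delta> > 0" "open N" "(s0, p0) \<in> N"
    "\<And>s q. (s, q) \<in> N \<Longrightarrow> s \<in> J \<and> int_curve A (Y s) (\<Phi> s q) {-\<delta><..<\<delta>} \<and> \<Phi> s q 0 = q"
    by (rule local_flow[OF assms, of p0]) blast
  have ev: "\<forall>\<^sub>F z in nhds (s0, p0). z \<in> N" using \<Phi> by (simp add: eventually_nhds_in_open)
  have "flow A (Y s) 0 q = q" if "(s, q) \<in> N" for s q
    using flow_eq[of s "\<Phi> s q" "{-\<delta><..<\<delta>}" 0] \<Phi>(4)[OF that] \<Phi>(1) by simp
  then have "\<forall>\<^sub>F z in nhds (s0, p0). snd z = flow A (Y (fst z)) 0 (snd z)"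
    using ev by (auto elim: eventually_mono)
  moreover obtain c where "c \<in> charts_at A p0" using ex_chart by blast
  ultimately have "chart_param_diff A c c (\<lambda>s. flow A (Y s) 0) s0 p0 (transition c c p0)"
    by (intro chart_param_diff_cong[OF chart_deriv_id(2)]) auto
  moreover have "\<forall>\<^sub>F z in nhds (s0, p0). fst z \<in> J \<and> (\<exists>\<gamma> I. int_curve A (Y (fst z)) \<gamma> I \<and> \<gamma> 0 = snd z \<and> 0 \<in> I \<and> 0 \<in> I)"
    using ev
  proof eventually_elim
    case (elim z)
    then show ?case using \<Phi>(4)[of "fst z" "snd z"] \<Phi>(1)
      by (intro conjI exI[of _ "\<Phi> (fst z) (snd z)"] exI[of _ "{-\<delta><..<\<delta>}"]) auto
  qed
  ultimately show ?thesis unfolding flow_regular_def by blast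
qed

text \<open>The times at which the flow is regular contain 0 and form an open and closed subset of
  \<open>I0\<close>; thus no step size common to the whole orbit has to be found.\<close>

lemma flow_regular:
  assumes s0: "s0 \<in> J" and \<gamma>0: "int_curve A (Y s0) \<gamma>0 I0" and T: "0 \<in> I0" "T \<in> I0"
  shows "flow_regular s0 (\<gamma>0 0) T"
proof (rule connected_induction_simple[where S = I0 and P = "flow_regular s0 (\<gamma>0 0)" and a = 0])
  show "connected I0" using \<gamma>0 by (simp add: int_curve_def)
  have oI: "open I0" using \<gamma>0 by (simp add: int_curve_def)
  show "flow_regular s0 (\<gamma>0 0) 0" by (rule flow_regular_0[OF s0])
  \<comment> \<open>Regularity spreads between times near \<open>a\<close>, in both directions, by composition with the local flow at \<open>\<gamma>0 a\<close>.\<close>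
  fix a assume a: "a \<in> I0"
  obtain \<delta> N \<Phi> where \<Phi>: "\<delta> > 0" "open N" "(s0, \<gamma>0 a) \<in> N"
    "\<And>s q. (s, q) \<in> N \<Longrightarrow> s \<in> J \<and> int_curve A (Y s) (\<Phi> s q) {-\<delta><..<\<delta>} \<and> \<Phi> s q 0 = q"
    "\<And>s q t. (s, q) \<in> N \<Longrightarrow> \<bar>t\<bar> < \<delta> \<Longrightarrow> \<exists>c d D. chart_param_diff A c d (\<lambda>s q. \<Phi> s q t) s q D"
    by (rule local_flow[OF s0, of "\<gamma>0 a"]) blast
  have ica: "isCont \<gamma>0 a" using \<gamma>0 a by (auto simp: int_curve_def dest: has_velocityD(2))
  then have "isCont (\<lambda>t. (s0, \<gamma>0 t)) a" by (auto intro!: continuous_intros)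
  then have "\<forall>\<^sub>F t in nhds a. (s0, \<gamma>0 t) \<in> N" by (rule isCont_eventually_in_open) (use \<Phi> in auto)
  moreover have "\<forall>\<^sub>F t in nhds a. dist t a < \<delta> / 2" using \<Phi>(1) eventually_nhds_metric half_gt_zero by blast
  moreover have "\<forall>\<^sub>F t in nhds a. t \<in> I0" using oI a by (rule eventually_nhds_in_open)
  ultimately have "\<forall>\<^sub>F t in nhds a. (s0, \<gamma>0 t) \<in> N \<and> dist t a < \<delta> / 2 \<and> t \<in> I0" by eventually_elim auto
  then obtain S where S: "open S" "a \<in> S" "\<And>t. t \<in> S \<Longrightarrow> (s0, \<gamma>0 t) \<in> N \<and> dist t a < \<delta> / 2 \<and> t \<in> I0"
    unfolding eventually_nhds by blast
  have step: "flow_regular s0 (\<gamma>0 0) y" if x: "x \<in> S" and y: "y \<in> S" and rx: "flow_regular s0 (\<gamma>0 0) x" for x y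
  proof -
    have xy: "\<bar>y - x\<bar> < \<delta>" using S(3)[OF x] S(3)[OF y] dist_triangle_half_l[of x a \<delta> y] by (simp add: dist_real_def dist_commute abs_minus_commute)
    have fx: "flow A (Y s0) x (\<gamma>0 0) = \<gamma>0 x" using flow_eq[OF s0 \<gamma>0] T S(3)[OF x] by blast
    obtain c d D where D: "chart_param_diff A c d (\<lambda>s. flow A (Y s) x) s0 (\<gamma>0 0) D" using rx unfolding flow_regular_def by blast
    have d: "d \<in> charts_at A (\<gamma>0 x)" using D fx by (simp add: chart_param_diff_def)
    obtain c' d' D0 where D0: "chart_param_diff A c' d' (\<lambda>s q. \<Phi> s q (y - x)) s0 (\<gamma>0 x) D0"
      using \<Phi>(5)[of s0 "\<gamma>0 x" "y - x"] S(3)[OF x] xy by blast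
    then have "d' \<in> charts_at A (\<Phi> s0 (\<gamma>0 x) (y - x))" by (simp add: chart_param_diff_def)
    then obtain D' where D': "chart_param_diff A d d' (\<lambda>s q. \<Phi> s q (y - x)) s0 (\<gamma>0 x) D'"
      using chart_param_diff_change[OF D0 d] by blast
    have comp: "chart_param_diff A c d' (\<lambda>s q. \<Phi> s (flow A (Y s) x q) (y - x)) s0 (\<gamma>0 0) (\<lambda>u. D' (D u))"
      using chart_param_diff_compose[OF D, of d' "\<lambda>s q. \<Phi> s q (y - x)"] D' fx by simp
    have "isCont (\<lambda>z. flow A (Y (fst z)) x (snd z)) (s0, \<gamma>0 0)" using D by (simp add: chart_param_diff_def)
    then have "isCont (\<lambda>z. (fst z, flow A (Y (fst z)) x (snd z))) (s0, \<gamma>0 0)" by (auto intro!: continuous_intros)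
    then have evN: "\<forall>\<^sub>F z in nhds (s0, \<gamma>0 0). (fst z, flow A (Y (fst z)) x (snd z)) \<in> N"
      by (rule isCont_eventually_in_open) (use \<Phi>(2) S(3)[OF x] fx in auto)
    have evx: "\<forall>\<^sub>F z in nhds (s0, \<gamma>0 0). fst z \<in> J \<and> (\<exists>\<gamma> I. int_curve A (Y (fst z)) \<gamma> I \<and> \<gamma> 0 = snd z \<and> 0 \<in> I \<and> x \<in> I)"
      using rx unfolding flow_regular_def by blast
    have ev: "\<forall>\<^sub>F z in nhds (s0, \<gamma>0 0). (fst z \<in> J \<and> (\<exists>\<gamma> I. int_curve A (Y (fst z)) \<gamma> I \<and> \<gamma> 0 = snd z \<and> 0 \<in> I \<and> y \<in> I)) \<and>
        \<Phi> (fst z) (flow A (Y (fst z)) x (snd z)) (y - x) = flow A (Y (fst z)) y (snd z)"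
      using evN evx
    proof eventually_elim
      case (elim z)
      obtain s q where z: "z = (s, q)" by (cases z)
      obtain \<gamma> I where \<gamma>: "int_curve A (Y s) \<gamma> I" "\<gamma> 0 = q" "0 \<in> I" "x \<in> I" and sJ: "s \<in> J" using elim(2) z by auto
      have q': "flow A (Y s) x q = \<gamma> x" using flow_eq[OF sJ \<gamma>(1,3,4)] \<gamma>(2) by simp
      have N: "(s, \<gamma> x) \<in> N" using elim(1) z q' by simp
      \<comment> \<open>The local solution through \<open>\<gamma> x\<close>, moved so that it
        starts at time \<open>x\<close>, glues with \<open>\<gamma>\<close> there and reaches time
        \<open>y\<close>. Hence the flow over \<open>y\<close> is the flow over \<open>x\<close>
        followed by the local flow over \<open>y - x\<close>.\<close>
      define I' where "I' = (\<lambda>r. r - - x) ` {-\<delta><..<\<delta>}"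
      have ic: "int_curve A (Y s) (\<lambda>r. \<Phi> s (\<gamma> x) (r + - x)) I'"
        unfolding I'_def using \<Phi>(4)[OF N] by (intro int_curve_shift) auto
      have "y - x \<in> {-\<delta><..<\<delta>}" using xy by auto
      then have "y \<in> (\<lambda>r. r - - x) ` {-\<delta><..<\<delta>}" by (intro image_eqI[of _ _ "y - x"]) auto
      moreover have "x \<in> (\<lambda>r. r - - x) ` {-\<delta><..<\<delta>}" using \<Phi>(1) by (intro image_eqI[of _ _ 0]) auto
      ultimately have I': "x \<in> I'" "y \<in> I'" by (auto simp: I'_def)
      obtain g where g: "int_curve A (Y s) g (I \<union> I')" "\<And>t. t \<in> I \<Longrightarrow> g t = \<gamma> t" "\<And>t. t \<in> I' \<Longrightarrow> g t = \<Phi> s (\<gamma> x) (t + - x)"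
        by (rule int_curve_union[OF sJ \<gamma>(1) ic \<gamma>(4) I'(1)]) (use \<Phi>(4)[OF N] in auto)
      have g0: "g 0 = q" "g y = \<Phi> s (\<gamma> x) (y - x)" using g(2)[OF \<gamma>(3)] g(3)[OF I'(2)] \<gamma>(2) by auto
      have "flow A (Y s) y q = g y" using flow_eq[OF sJ g(1), of y] g0 \<gamma> I' by auto
      then show ?case using z sJ g(1) g0 \<gamma>(3) I'(2) q' by auto
    qed
    have "chart_param_diff A c d' (\<lambda>s. flow A (Y s) y) s0 (\<gamma>0 0) (\<lambda>u. D' (D u))"
      by (rule chart_param_diff_cong[OF comp]) (use ev in \<open>auto elim: eventually_mono\<close>)
    moreover have "\<forall>\<^sub>F z in nhds (s0, \<gamma>0 0). fst z \<in> J \<and> (\<exists>\<gamma> I. int_curve A (Y (fst z)) \<gamma> I \<and> \<gamma> 0 = snd z \<and> 0 \<in> I \<and> y \<in> I)"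
      using ev by (rule eventually_mono) blast
    ultimately show ?thesis unfolding flow_regular_def by blast
  qed
  show "\<exists>T. openin (top_of_set I0) T \<and> a \<in> T \<and> (\<forall>x\<in>T. \<forall>y\<in>T. flow_regular s0 (\<gamma>0 0) x \<longrightarrow> flow_regular s0 (\<gamma>0 0) y)"
  proof (intro exI[of _ "I0 \<inter> S"] conjI ballI impI)
    show "openin (top_of_set I0) (I0 \<inter> S)" by (rule openin_open_Int[OF S(1)])
    show "a \<in> I0 \<inter> S" using a S(2) by simp
  qed (use step in blast)
qed (use T in auto)

end

section \<open>Hamiltonian vector fields\<close>

text \<open>Derivatives are bounded linear maps, so their continuity is in the operator norm. The
  closure properties that follow are those required by Cramer's rule.\<close>

definition C1_on :: "'a::real_normed_vector set \<Rightarrow> ('a \<Rightarrow> 'b::real_normed_vector) \<Rightarrow> bool" where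
  "C1_on S g \<longleftrightarrow> (\<exists>g'. continuous_on S g' \<and> (\<forall>z\<in>S. (g has_derivative blinfun_apply (g' z)) (at z)))"

lemma C1_onI:
  assumes "continuous_on S g'" "\<And>z. z \<in> S \<Longrightarrow> (g has_derivative blinfun_apply (g' z)) (at z)"
  shows "C1_on S g"
  using assms unfolding C1_on_def by blast

lemma C1_on_cont: "C1_on S g \<Longrightarrow> continuous_on S g"
  unfolding C1_on_def by (meson continuous_at_imp_continuous_on has_derivative_continuous)

lemma smooth_on_imp_C1_on:
  fixes f :: "'a::euclidean_space \<Rightarrow> 'b::real_normed_vector"
  shows "smooth_on S f \<Longrightarrow> C1_on S f"
  using smooth_on_C1[of S f] unfolding C1_on_def by metis

lemma smooth_on_directional: "smooth_on S f \<Longrightarrow> smooth_on S (\<lambda>x. frechet_derivative f (at x) w)"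
  unfolding smooth_on_def by (metis Ck_on.simps(2))

lemma C1_on_const: "C1_on S (\<lambda>z. k)"
  by (rule C1_onI[of S "\<lambda>_. 0"]) (auto simp: zero_blinfun.rep_eq)

lemma C1_on_add:
  assumes "C1_on S g" "C1_on S h"
  shows "C1_on S (\<lambda>z. g z + h z)"
proof -
  obtain g' h' where *: "continuous_on S g'" "\<And>z. z \<in> S \<Longrightarrow> (g has_derivative blinfun_apply (g' z)) (at z)"
    "continuous_on S h'" "\<And>z. z \<in> S \<Longrightarrow> (h has_derivative blinfun_apply (h' z)) (at z)"
    using assms unfolding C1_on_def by blast
  show ?thesis
  proof (rule C1_onI[of S "\<lambda>z. g' z + h' z"])
    show "((\<lambda>z. g z + h z) has_derivative blinfun_apply (g' z + h' z)) (at z)" if "z \<in> S" for z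
      using has_derivative_add[OF *(2)[OF that] *(4)[OF that]] by (simp add: plus_blinfun.rep_eq)
  qed (intro continuous_intros *)
qed

lemma C1_on_mult:
  fixes g h :: "'a::real_normed_vector \<Rightarrow> real"
  assumes "C1_on S g" "C1_on S h"
  shows "C1_on S (\<lambda>z. g z * h z)"
proof -
  obtain g' h' where *: "continuous_on S g'" "\<And>z. z \<in> S \<Longrightarrow> (g has_derivative blinfun_apply (g' z)) (at z)"
    "continuous_on S h'" "\<And>z. z \<in> S \<Longrightarrow> (h has_derivative blinfun_apply (h' z)) (at z)"
    using assms unfolding C1_on_def by blast
  show ?thesis
  proof (rule C1_onI[of S "\<lambda>z. g z *\<^sub>R h' z + h z *\<^sub>R g' z"])
    show "((\<lambda>z. g z * h z) has_derivative blinfun_apply (g z *\<^sub>R h' z + h z *\<^sub>R g' z)) (at z)" if "z \<in> S" for z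
      using has_derivative_mult[OF *(2)[OF that] *(4)[OF that]]
      by (simp add: plus_blinfun.rep_eq scaleR_blinfun.rep_eq mult.commute)
  qed (intro continuous_intros * C1_on_cont assms)
qed

lemma C1_on_inverse:
  fixes g :: "'a::real_normed_vector \<Rightarrow> real"
  assumes "C1_on S g" "\<And>z. z \<in> S \<Longrightarrow> g z \<noteq> 0"
  shows "C1_on S (\<lambda>z. inverse (g z))"
proof -
  obtain g' where *: "continuous_on S g'" "\<And>z. z \<in> S \<Longrightarrow> (g has_derivative blinfun_apply (g' z)) (at z)"
    using assms unfolding C1_on_def by blast
  show ?thesis
  proof (rule C1_onI[of S "\<lambda>z. (- (inverse (g z) * inverse (g z))) *\<^sub>R g' z"])
    show "((\<lambda>z. inverse (g z)) has_derivative blinfun_apply ((- (inverse (g z) * inverse (g z))) *\<^sub>R g' z)) (at z)" if "z \<in> S" for z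
      using Deriv.has_derivative_inverse[OF assms(2)[OF that] *(2)[OF that]]
      by (simp add: scaleR_blinfun.rep_eq uminus_blinfun.rep_eq mult_ac)
    show "continuous_on S (\<lambda>z. (- (inverse (g z) * inverse (g z))) *\<^sub>R g' z)"
      using C1_on_cont[OF assms(1)] assms(2) *(1) by (intro continuous_intros) auto
  qed
qed

lemma C1_on_scaleR_const:
  fixes g :: "'a::real_normed_vector \<Rightarrow> real"
  assumes "C1_on S g"
  shows "C1_on S (\<lambda>z. g z *\<^sub>R v)"
proof -
  obtain g' where *: "continuous_on S g'" "\<And>z. z \<in> S \<Longrightarrow> (g has_derivative blinfun_apply (g' z)) (at z)"
    using assms unfolding C1_on_def by blast
  show ?thesis
  proof (rule C1_onI[of S "\<lambda>z. blinfun_scaleR_left v o\<^sub>L g' z"])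
    show "continuous_on S (\<lambda>z. blinfun_scaleR_left v o\<^sub>L g' z)"
      by (intro bounded_bilinear.continuous_on[OF bounded_bilinear_blinfun_compose] continuous_intros *)
    show "((\<lambda>z. g z *\<^sub>R v) has_derivative blinfun_apply (blinfun_scaleR_left v o\<^sub>L g' z)) (at z)" if "z \<in> S" for z
      using has_derivative_scaleR_left[OF *(2)[OF that], of v] by (simp add: o_def blinfun_compose.rep_eq blinfun_scaleR_left.rep_eq)
  qed
qed

lemma C1_on_sum: "(\<And>i. i \<in> I \<Longrightarrow> C1_on S (g i)) \<Longrightarrow> C1_on S (\<lambda>z. \<Sum>i\<in>I. g i z)"
  by (induction I rule: infinite_finite_induct) (auto intro: C1_on_const C1_on_add)

lemma C1_on_prod:
  fixes g :: "'i \<Rightarrow> 'a::real_normed_vector \<Rightarrow> real"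
  shows "(\<And>i. i \<in> I \<Longrightarrow> C1_on S (g i)) \<Longrightarrow> C1_on S (\<lambda>z. \<Prod>i\<in>I. g i z)"
  by (induction I rule: infinite_finite_induct) (auto intro: C1_on_const C1_on_mult)

lemma C1_on_compose_linear:
  assumes "C1_on S g" "bounded_linear L" "\<And>z. z \<in> S' \<Longrightarrow> L z \<in> S"
  shows "C1_on S' (\<lambda>z. g (L z))"
proof -
  obtain g' where *: "continuous_on S g'" "\<And>z. z \<in> S \<Longrightarrow> (g has_derivative blinfun_apply (g' z)) (at z)"
    using assms unfolding C1_on_def by blast
  have L: "(L has_derivative L) (at z)" for z using assms(2) by (rule bounded_linear_imp_has_derivative)
  have bL: "blinfun_apply (Blinfun L) = L" using assms(2) by (rule bounded_linear_Blinfun_apply)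
  show ?thesis
  proof (rule C1_onI[of S' "\<lambda>z. g' (L z) o\<^sub>L Blinfun L"])
    have "continuous_on S' L" using assms(2) by (rule linear_continuous_on)
    then have "continuous_on S' (\<lambda>z. g' (L z))"
      by (rule continuous_on_compose2[OF *(1)]) (use assms(3) in auto)
    then show "continuous_on S' (\<lambda>z. g' (L z) o\<^sub>L Blinfun L)"
      by (intro bounded_bilinear.continuous_on[OF bounded_bilinear_blinfun_compose] continuous_intros)
    show "((\<lambda>z. g (L z)) has_derivative blinfun_apply (g' (L z) o\<^sub>L Blinfun L)) (at z)" if "z \<in> S'" for z
      using diff_chain_at[OF L *(2)[OF assms(3)[OF that]]] by (simp add: o_def bL blinfun_compose.rep_eq)
  qed
qed

text \<open>Composition of the full derivative with the inclusion of the space directions, in the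
  form demanded of a family of vector fields.\<close>

lemma C1_on_partial:
  fixes g :: "real \<times> 'a::real_normed_vector \<Rightarrow> 'b::real_normed_vector"
  assumes "C1_on S g"
  obtains g' where "continuous_on S g'"
    "\<And>z. z \<in> S \<Longrightarrow> ((\<lambda>x. g (fst z, x)) has_derivative blinfun_apply (g' z)) (at (snd z))"
proof -
  obtain h where h: "continuous_on S h" "\<And>z. z \<in> S \<Longrightarrow> (g has_derivative blinfun_apply (h z)) (at z)"
    using assms unfolding C1_on_def by blast
  define i where "i = Blinfun (\<lambda>u::'a. (0::real, u))"
  have bl: "bounded_linear (\<lambda>u::'a. (0::real, u))"
    by (intro bounded_linear_Pair bounded_linear_zero bounded_linear_ident)
  have i: "blinfun_apply i u = (0, u)" for u unfolding i_def by (simp add: bounded_linear_Blinfun_apply[OF bl])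
  show thesis
  proof (rule that[of "\<lambda>z. h z o\<^sub>L i"])
    show "continuous_on S (\<lambda>z. h z o\<^sub>L i)"
      by (intro bounded_bilinear.continuous_on[OF bounded_bilinear_blinfun_compose] continuous_intros h)
    fix z assume z: "z \<in> S"
    have "((\<lambda>x. (fst z, x)) has_derivative (\<lambda>u. (0, u))) (at (snd z))" by (auto intro!: derivative_eq_intros)
    from diff_chain_at[OF this, of g "blinfun_apply (h z)"] h(2)[OF z]
    show "((\<lambda>x. g (fst z, x)) has_derivative blinfun_apply (h z o\<^sub>L i)) (at (snd z))"
      by (simp add: o_def blinfun_compose.rep_eq i)
  qed
qed

lemma C1_on_det:
  fixes M :: "'a::real_normed_vector \<Rightarrow> real^'n^'n"
  assumes "\<And>i j. C1_on S (\<lambda>z. M z $ i $ j)"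
  shows "C1_on S (\<lambda>z. det (M z))"
  unfolding det_def by (intro C1_on_sum C1_on_mult C1_on_const C1_on_prod assms)

section \<open>The Hamiltonian vector field in coordinates\<close>

locale hamiltonian_family = smooth_manifold A
  for A :: "('a::{t2_space, second_countable_topology}, real^4) chart set" +
  fixes \<omega> :: "'a \<Rightarrow> ('a, real^4) tvec \<Rightarrow> ('a, real^4) tvec \<Rightarrow> real"
    and J :: "real set" and H :: "real \<Rightarrow> 'a \<Rightarrow> real"
  assumes symplectic: "symplectic_manifold A \<omega>" and J_open: "open J"
    and H_smooth: "smooth_function_family A J H"
begin

definition H_in_chart where "H_in_chart c z = H (fst z) (chart_inv c (snd z))"

lemma H_in_chart_smooth: "c \<in> A \<Longrightarrow> smooth_on (J \<times> chart_image c) (H_in_chart c)"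
  using H_smooth unfolding smooth_function_family_def H_in_chart_def by (simp add: case_prod_beta')

lemma H_chart_derivative:
  assumes "c \<in> A" "s \<in> J" "x \<in> chart_image c"
  shows "((\<lambda>x. H s (chart_inv c x)) has_derivative (\<lambda>u. frechet_derivative (H_in_chart c) (at (s, x)) (0, u))) (at x)"
proof -
  have "H_in_chart c differentiable (at (s, x))"
    using H_in_chart_smooth[OF assms(1)] assms unfolding smooth_on_def
    by (metis Ck_on.simps(2) mem_Sigma_iff)
  then have "(H_in_chart c has_derivative frechet_derivative (H_in_chart c) (at (s, x))) (at (s, x))"
    by (simp add: frechet_derivative_works)
  moreover have "((\<lambda>x. (s, x)) has_derivative (\<lambda>u. (0, u))) (at x)"
    by (auto intro!: derivative_eq_intros)
  ultimately show ?thesis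
    using diff_chain_at[of "\<lambda>x. (s, x)" "\<lambda>u. (0, u)" x "H_in_chart c"] by (simp add: o_def H_in_chart_def)
qed

text \<open>The gradient in the space variables for the Euclidean inner product of the chart; it
  represents dH in that chart and depends on the chart.\<close>

definition grad where
  "grad c z = (\<chi> i. frechet_derivative (H_in_chart c) (at z) (0, axis i 1))"

lemma H_chart_grad:
  assumes "c \<in> A" "s \<in> J" "x \<in> chart_image c"
  shows "((\<lambda>x. H s (chart_inv c x)) has_derivative (\<lambda>u. u \<bullet> grad c (s, x))) (at x)"
proof -
  note d = H_chart_derivative[OF assms]
  have "frechet_derivative (H_in_chart c) (at (s, x)) (0, u) = u \<bullet> grad c (s, x)" for u
  proof -
    have "u = (\<Sum>i\<in>UNIV. u $ i *\<^sub>R axis i 1)" using basis_expansion[of u] by (simp add: scalar_mult_eq_scaleR)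
    then have "frechet_derivative (H_in_chart c) (at (s, x)) (0, u) =
      frechet_derivative (H_in_chart c) (at (s, x)) (0, \<Sum>i\<in>UNIV. u $ i *\<^sub>R axis i 1)" by simp
    also have "\<dots> = (\<Sum>i\<in>UNIV. u $ i *\<^sub>R frechet_derivative (H_in_chart c) (at (s, x)) (0, axis i 1))"
      by (simp add: linear_sum[OF has_derivative_linear[OF d]] linear_scale[OF has_derivative_linear[OF d], simplified])
    also have "\<dots> = u \<bullet> grad c (s, x)" by (simp add: inner_vec_def grad_def)
    finally show ?thesis .
  qed
  then show ?thesis using d by simp
qed

lemma dfun_chart:
  assumes s: "s \<in> J" and c: "c \<in> charts_at A p" and \<xi>: "\<xi> \<in> tangent_space A p"
  shows "dfun A (H s) p \<xi> = \<xi> c \<bullet> grad c (s, snd c p)"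
proof -
  define c0 where "c0 = chart_at A p"
  have c0: "c0 \<in> charts_at A p" by (simp add: c0_def chart_at)
  note m = charts_atD[OF c] charts_atD[OF c0]
  have t: "((\<lambda>x. snd c (chart_inv c0 x)) has_derivative transition c0 c p) (at (snd c0 p))"
    using chart_deriv_id(1)[OF c0 c] by (simp add: chart_deriv_def)
  have "((\<lambda>x. H s (chart_inv c x)) has_derivative (\<lambda>u. u \<bullet> grad c (s, snd c p))) (at (snd c p))"
    using H_chart_grad[OF m(1) s] m by simp
  then have "((\<lambda>x. H s (chart_inv c (snd c (chart_inv c0 x)))) has_derivative (\<lambda>u. transition c0 c p u \<bullet> grad c (s, snd c p))) (at (snd c0 p))"
    using diff_chain_at[OF t, of "\<lambda>x. H s (chart_inv c x)"] m by (simp add: o_def)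
  moreover have "\<forall>\<^sub>F q in nhds p. q \<in> fst c" using m chart_open by (intro eventually_nhds_in_open) auto
  then have "\<forall>\<^sub>F x in nhds (snd c0 p). chart_inv c0 x \<in> fst c" by (rule eventually_chart_inv[OF c0])
  then have "\<forall>\<^sub>F x in nhds (snd c0 p). H s (chart_inv c (snd c (chart_inv c0 x))) = H s (chart_inv c0 x)"
    by eventually_elim (use m in simp)
  ultimately have "((\<lambda>x. H s (chart_inv c0 x)) has_derivative (\<lambda>u. transition c0 c p u \<bullet> grad c (s, snd c p))) (at (snd c0 p))"
    by (rule has_derivative_cong_nhds)
  then have "frechet_derivative (H s \<circ> chart_inv c0) (at (snd c0 p)) = (\<lambda>u. transition c0 c p u \<bullet> grad c (s, snd c p))"
    by (simp add: o_def frechet_derivative_at[symmetric])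
  then show ?thesis using tangent_transition[OF \<xi> c0 c] by (simp add: dfun_def Let_def c0_def)
qed

lemma two_form: "two_form A \<omega>" and nondegenerate: "nondegenerate_form A \<omega>"
  using symplectic by (auto simp: symplectic_manifold_def)

lemma form_linear_left:
  "\<lbrakk>\<xi> \<in> tangent_space A p; \<eta> \<in> tangent_space A p; \<zeta> \<in> tangent_space A p\<rbrakk> \<Longrightarrow>
     \<omega> p (r *\<^sub>R \<xi> + \<eta>) \<zeta> = r * \<omega> p \<xi> \<zeta> + \<omega> p \<eta> \<zeta>"
  using two_form unfolding two_form_def by blast

lemma form_skew: "\<lbrakk>\<xi> \<in> tangent_space A p; \<eta> \<in> tangent_space A p\<rbrakk> \<Longrightarrow> \<omega> p \<xi> \<eta> = - \<omega> p \<eta> \<xi>"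
  using two_form unfolding two_form_def by blast

lemma form_self: "\<xi> \<in> tangent_space A p \<Longrightarrow> \<omega> p \<xi> \<xi> = 0"
  using form_skew[of \<xi> p \<xi>] by simp

lemma coord_vec_linear:
  assumes "c \<in> charts_at A p"
  shows "coord_vec A c p (r *\<^sub>R u + v) = r *\<^sub>R coord_vec A c p u + coord_vec A c p v"
proof (rule tangent_eqI[OF coord_vec_tangent(1)[OF assms] _ assms])
  show "r *\<^sub>R coord_vec A c p u + coord_vec A c p v \<in> tangent_space A p"
    using subspace_tangent_space coord_vec_tangent(1)[OF assms] by (intro subspace_add subspace_scale) auto
qed (use coord_vec_tangent[OF assms] in \<open>simp_all add: scaleR_fun_def\<close>)

definition form_matrix where
  "form_matrix c x = (\<chi> i j. form_in_chart A \<omega> c x (axis i 1) (axis j 1) :: real^4^4)"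

lemma form_chart:
  assumes c: "c \<in> charts_at A p" and \<xi>: "\<xi> \<in> tangent_space A p" and \<eta>: "\<eta> \<in> tangent_space A p"
  shows "\<omega> p \<xi> \<eta> = \<xi> c \<bullet> (form_matrix c (snd c p) *v \<eta> c)"
proof -
  note m = charts_atD[OF c]
  define B where "B u w = \<omega> p (coord_vec A c p u) (coord_vec A c p w)" for u w
  note t = coord_vec_tangent(1)[OF c]
  have Bl: "B (r *\<^sub>R u + v) w = r * B u w + B v w" for r u v w
    using form_linear_left[OF t t t] by (simp add: B_def coord_vec_linear[OF c])
  have Bs: "B u w = - B w u" for u w unfolding B_def by (rule form_skew[OF t t])
  have z: "B 0 w = 0" for w using Bl[of 1 0 0 w] by simp
  have l1: "linear (\<lambda>u. B u w)" for w
    by (rule linearI) (use Bl[of 1 _ _ w] Bl[of _ _ 0 w] z in auto)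
  \<comment> \<open>Skew symmetry transfers linearity to the second argument, since
    \<open>two_form\<close> states it for the first.\<close>
  have l2: "linear (\<lambda>w. B u w)" for u
  proof (rule linearI)
    show "B u (v + w) = B u v + B u w" for v w using linear_add[OF l1[of u], of v w] Bs by (metis minus_add_distrib)
    show "B u (r *\<^sub>R w) = r *\<^sub>R B u w" for r w using linear_scale[OF l1[of u], of r w] Bs by (metis scaleR_minus_right)
  qed
  have e: "u = (\<Sum>i\<in>UNIV. u $ i *\<^sub>R axis i 1)" for u :: "real^4" using basis_expansion[of u] by (simp add: scalar_mult_eq_scaleR)
  have W: "form_matrix c (snd c p) $ i $ j = B (axis i 1) (axis j 1)" for i j
    using m by (simp add: form_matrix_def form_in_chart_def B_def)
  have "B u w = u \<bullet> (form_matrix c (snd c p) *v w)" for u w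
  proof -
    have "B u w = B (\<Sum>i\<in>UNIV. u $ i *\<^sub>R axis i 1) w" by (simp add: e[symmetric])
    also have "\<dots> = (\<Sum>i\<in>UNIV. u $ i * B (axis i 1) w)"
      by (simp add: linear_sum[OF l1[of w]] linear_scale[OF l1[of w], simplified])
    also have "\<dots> = (\<Sum>i\<in>UNIV. u $ i * B (axis i 1) (\<Sum>j\<in>UNIV. w $ j *\<^sub>R axis j 1))" by (simp add: e[symmetric])
    also have "\<dots> = (\<Sum>i\<in>UNIV. u $ i * (\<Sum>j\<in>UNIV. w $ j * B (axis i 1) (axis j 1)))"
      by (simp add: linear_sum[OF l2] linear_scale[OF l2, simplified])
    finally show ?thesis by (simp add: inner_vec_def matrix_vector_mult_def W mult.commute)
  qed
  then show ?thesis using coord_vec_coord[OF \<xi> c] coord_vec_coord[OF \<eta> c] by (metis B_def)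
qed

text \<open>A vector in the kernel of the matrix is the coordinate vector of a tangent vector on
  which the form degenerates.\<close>

lemma form_matrix_det:
  assumes "c \<in> A" "x \<in> chart_image c"
  shows "det (form_matrix c x) \<noteq> 0"
proof -
  define p where "p = chart_inv c x"
  have c: "c \<in> charts_at A p" and x: "snd c p = x" using assms by (auto simp: p_def chart_atI)
  have "y = 0" if y: "form_matrix c x *v y = 0" for y
  proof -
    have "coord_vec A c p y = 0"
    proof (rule nondegenerate[unfolded nondegenerate_form_def, rule_format])
      fix \<eta> assume \<eta>: "\<eta> \<in> tangent_space A p"
      have "\<omega> p \<eta> (coord_vec A c p y) = 0"
        using form_chart[OF c \<eta> coord_vec_tangent(1)[OF c]] y by (simp add: x coord_vec_tangent(2)[OF c])
      then show "\<omega> p (coord_vec A c p y) \<eta> = 0" using form_skew[OF \<eta> coord_vec_tangent(1)[OF c]] by simp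
    qed (rule coord_vec_tangent(1)[OF c])
    then show ?thesis using coord_vec_tangent(2)[OF c, of y] by simp
  qed
  then have "invertible (form_matrix c x)" by (metis invertible_left_inverse matrix_left_invertible_ker)
  then show ?thesis by (simp add: invertible_det_nz)
qed

text \<open>Cramer's rule for the linear system \<open>form_matrix *v w = grad\<close>, written out
  with determinants so that regularity in parameter and point can be read off.\<close>

definition ham_coord where
  "ham_coord c z = (\<Sum>k\<in>UNIV. (det (\<chi> i j. if j = k then grad c z $ i else form_matrix c (snd z) $ i $ j)
      * inverse (det (form_matrix c (snd z)))) *\<^sub>R axis k (1::real))"

lemma ham_coord:
  assumes "c \<in> A" "x \<in> chart_image c"
  shows "form_matrix c x *v w = grad c (s, x) \<longleftrightarrow> w = ham_coord c (s, x)"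
proof -
  have "(\<chi> k. det (\<chi> i j. if j = k then grad c (s, x) $ i else form_matrix c x $ i $ j) / det (form_matrix c x)) = ham_coord c (s, x)"
    unfolding ham_coord_def snd_conv by (subst basis_expansion[symmetric]) (simp add: scalar_mult_eq_scaleR divide_inverse)
  then show ?thesis using cramer[OF form_matrix_det[OF assms], of w "grad c (s, x)"] by simp
qed

text \<open>Tested on all \<open>\<xi>\<close>, the defining equation becomes a linear system with
  invertible matrix. Its unique solvability justifies the definite description
  \<open>ham_vf\<close>.\<close>

lemma ham_vf_characterization:
  assumes s: "s \<in> J" and c: "c \<in> charts_at A p"
  shows "X \<in> tangent_space A p \<and> (\<forall>\<xi>\<in>tangent_space A p. dfun A (H s) p \<xi> = \<omega> p \<xi> X) \<longleftrightarrow>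
    X = coord_vec A c p (ham_coord c (s, snd c p))"
proof -
  note m = charts_atD[OF c]
  have iff: "(\<forall>\<xi>\<in>tangent_space A p. dfun A (H s) p \<xi> = \<omega> p \<xi> X) \<longleftrightarrow> X c = ham_coord c (s, snd c p)"
    if X: "X \<in> tangent_space A p" for X
  proof -
    have "(\<forall>\<xi>\<in>tangent_space A p. dfun A (H s) p \<xi> = \<omega> p \<xi> X) \<longleftrightarrow>
      (\<forall>\<xi>\<in>tangent_space A p. \<xi> c \<bullet> grad c (s, snd c p) = \<xi> c \<bullet> (form_matrix c (snd c p) *v X c))"
      using dfun_chart[OF s c] form_chart[OF c _ X] by simp
    also have "\<dots> \<longleftrightarrow> (\<forall>u. u \<bullet> grad c (s, snd c p) = u \<bullet> (form_matrix c (snd c p) *v X c))"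
      using coord_vec_tangent[OF c] by metis
    also have "\<dots> \<longleftrightarrow> form_matrix c (snd c p) *v X c = grad c (s, snd c p)"
      by (metis vector_eq_rdot inner_commute)
    finally show ?thesis using ham_coord[OF m(1)] m by simp
  qed
  show ?thesis
    using iff coord_vec_tangent[OF c] coord_vec_coord[OF _ c] by metis
qed

lemma ham_vf_coord_vec:
  assumes s: "s \<in> J" and c: "c \<in> charts_at A p"
  shows "ham_vf A \<omega> (H s) p = coord_vec A c p (ham_coord c (s, snd c p))"
  unfolding ham_vf_def using ham_vf_characterization[OF assms] by simp

lemma ham_vf_coord: "s \<in> J \<Longrightarrow> c \<in> charts_at A p \<Longrightarrow> ham_vf A \<omega> (H s) p c = ham_coord c (s, snd c p)"
  by (simp add: ham_vf_coord_vec coord_vec_tangent)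

lemma ham_vf_tangent: "s \<in> J \<Longrightarrow> ham_vf A \<omega> (H s) p \<in> tangent_space A p"
  using ex_chart[of p] ham_vf_coord_vec coord_vec_tangent by metis

lemma ham_vf_dfun: "s \<in> J \<Longrightarrow> \<xi> \<in> tangent_space A p \<Longrightarrow> dfun A (H s) p \<xi> = \<omega> p \<xi> (ham_vf A \<omega> (H s) p)"
  using ex_chart[of p] ham_vf_coord_vec ham_vf_characterization by metis

lemma ham_vf_eqI:
  "\<lbrakk>s \<in> J; X \<in> tangent_space A p; \<And>\<xi>. \<xi> \<in> tangent_space A p \<Longrightarrow> dfun A (H s) p \<xi> = \<omega> p \<xi> X\<rbrakk> \<Longrightarrow> ham_vf A \<omega> (H s) p = X"
  using ex_chart[of p] ham_vf_coord_vec ham_vf_characterization by metis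

text \<open>The coordinates are polynomials in the entries of the gradient and the form matrix,
  divided by a determinant without zeros. The gradient already contains one derivative of the
  energy, hence the appeal to smoothness of directional derivatives.\<close>

lemma ham_coord_C1: "c \<in> A \<Longrightarrow> C1_on (J \<times> chart_image c) (ham_coord c)"
proof -
  assume c: "c \<in> A"
  have g: "C1_on (J \<times> chart_image c) (\<lambda>z. grad c z $ i)" for i
    unfolding grad_def using smooth_on_imp_C1_on[OF smooth_on_directional[OF H_in_chart_smooth[OF c]]] by simp
  have "C1_on (chart_image c) (\<lambda>x. form_matrix c x $ i $ j)" for i j
    using two_form c unfolding two_form_def form_matrix_def by (auto intro: smooth_on_imp_C1_on)
  then have f: "C1_on (J \<times> chart_image c) (\<lambda>z. form_matrix c (snd z) $ i $ j)" for i j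
    by (rule C1_on_compose_linear[OF _ bounded_linear_snd]) auto
  have "C1_on (J \<times> chart_image c) (\<lambda>z. (\<chi> i j. if j = k then grad c z $ i else form_matrix c (snd z) $ i $ j) $ i $ j)" for i j k
    using g f by (cases "j = k") auto
  then show ?thesis unfolding ham_coord_def
    by (intro C1_on_sum C1_on_scaleR_const C1_on_mult C1_on_inverse C1_on_det f) (use form_matrix_det[OF c] in auto)
qed

end

section \<open>The reduced monodromy\<close>

text \<open>The line \<open>x0 + t u\<close> is corrected by a multiple \<open>r t\<close> of
  \<open>w\<close>, found by the intermediate value theorem. The curve need not be continuous away
  from 0: a velocity at time 0 is all that \<open>tangent_space_of\<close> asks for.\<close>

lemma level_set_curve:
  fixes h :: "'e::euclidean_space \<Rightarrow> real"
  assumes d: "(h has_derivative (\<lambda>u. u \<bullet> g)) (at x0)" and g: "g \<noteq> 0" and S: "open S" "x0 \<in> S" "continuous_on S h"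
    and u: "u \<bullet> g = 0"
  obtains y where "y 0 = x0" "\<And>t. y t \<in> S" "\<And>t. h (y t) = h x0" "(y has_vector_derivative u) (at 0)"
proof -
  define w where "w = g /\<^sub>R (g \<bullet> g)"
  have w: "w \<bullet> g = 1" using g by (simp add: w_def)
  define C where "C = norm u + norm w + 1"
  have C: "C > 0" by (simp add: C_def add_nonneg_pos)
  have dist_y: "norm (t *\<^sub>R u + r *\<^sub>R w) \<le> \<bar>t\<bar> * C" if "\<bar>r\<bar> \<le> \<bar>t\<bar>" for t r
  proof -
    have "norm (t *\<^sub>R u + r *\<^sub>R w) \<le> \<bar>t\<bar> * norm u + \<bar>r\<bar> * norm w" using norm_triangle_ineq[of "t *\<^sub>R u" "r *\<^sub>R w"] by simp
    also have "\<dots> \<le> \<bar>t\<bar> * norm u + \<bar>t\<bar> * norm w" using that by (intro add_left_mono mult_right_mono) auto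
    also have "\<dots> \<le> \<bar>t\<bar> * C" by (simp add: C_def algebra_simps)
    finally show ?thesis .
  qed
  \<comment> \<open>To first order a move by \<open>t *\<^sub>R u\<close> leaves \<open>h\<close>
    unchanged and a move by \<open>r *\<^sub>R w\<close> changes it by \<open>r\<close>; the
    remainder is small compared with t, uniformly over corrections no larger than t.\<close>
  have est: "\<exists>\<eta>>0. \<forall>t r. \<bar>t\<bar> < \<eta> \<longrightarrow> \<bar>r\<bar> \<le> \<bar>t\<bar> \<longrightarrow> \<bar>h (x0 + (t *\<^sub>R u + r *\<^sub>R w)) - h x0 - r\<bar> \<le> e * \<bar>t\<bar>" if e: "e > 0" for e
  proof -
    have "e / C > 0" using e C by simp
    then obtain \<eta> where \<eta>: "\<eta> > 0" "\<And>y. norm (y - x0) < \<eta> \<Longrightarrow> norm (h y - h x0 - (y - x0) \<bullet> g) \<le> e / C * norm (y - x0)"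
      using d unfolding has_derivative_at_alt by meson
    show ?thesis
    proof (intro exI[of _ "\<eta> / C"] conjI allI impI)
      show "0 < \<eta> / C" using \<eta> C by simp
      fix t r :: real assume t: "\<bar>t\<bar> < \<eta> / C" and r: "\<bar>r\<bar> \<le> \<bar>t\<bar>"
      define z where "z = t *\<^sub>R u + r *\<^sub>R w"
      have z: "norm z \<le> \<bar>t\<bar> * C" using dist_y[OF r] by (simp add: z_def)
      have "\<bar>t\<bar> * C < \<eta>" using t C by (simp add: pos_less_divide_eq)
      then have "norm (h (x0 + z) - h x0 - z \<bullet> g) \<le> e / C * norm z" using \<eta>(2)[of "x0 + z"] z by simp
      also have "\<dots> \<le> e / C * (\<bar>t\<bar> * C)" using z e C by (intro mult_left_mono) auto
      also have "\<dots> = e * \<bar>t\<bar>" using C by simp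
      finally show "\<bar>h (x0 + (t *\<^sub>R u + r *\<^sub>R w)) - h x0 - r\<bar> \<le> e * \<bar>t\<bar>"
        by (simp add: z_def inner_add_left u w)
    qed
  qed
  \<comment> \<open>With relative error 1/2 the values of \<open>h\<close> at the two extreme
    corrections lie on different sides of \<open>h x0\<close>.\<close>
  obtain \<eta>1 where \<eta>1: "\<eta>1 > 0" "\<And>t r. \<lbrakk>\<bar>t\<bar> < \<eta>1; \<bar>r\<bar> \<le> \<bar>t\<bar>\<rbrakk> \<Longrightarrow> \<bar>h (x0 + (t *\<^sub>R u + r *\<^sub>R w)) - h x0 - r\<bar> \<le> 1/2 * \<bar>t\<bar>"
    using est[of "1/2"] by auto
  obtain \<eta>2 where \<eta>2: "\<eta>2 > 0" "ball x0 \<eta>2 \<subseteq> S" using S openE by blast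
  define \<eta> where "\<eta> = min \<eta>1 (\<eta>2 / C)"
  have \<eta>: "\<eta> > 0" using \<eta>1 \<eta>2 C by (simp add: \<eta>_def)
  have inS: "x0 + (t *\<^sub>R u + r *\<^sub>R w) \<in> S" if "\<bar>t\<bar> < \<eta>" "\<bar>r\<bar> \<le> \<bar>t\<bar>" for t r
  proof -
    have "\<bar>t\<bar> < \<eta>2 / C" using that(1) by (simp add: \<eta>_def)
    then have "\<bar>t\<bar> * C < \<eta>2" using C by (simp add: pos_less_divide_eq)
    then have "norm (t *\<^sub>R u + r *\<^sub>R w) < \<eta>2" using dist_y[OF that(2)] by simp
    then have "x0 + (t *\<^sub>R u + r *\<^sub>R w) \<in> ball x0 \<eta>2"
    proof -
      have "dist x0 (x0 + z) = norm z" for z by (simp add: dist_norm)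
      then show ?thesis using \<open>norm (t *\<^sub>R u + r *\<^sub>R w) < \<eta>2\<close> by (simp only: mem_ball)
    qed
    then show ?thesis using \<eta>2 by blast
  qed
  have "\<exists>r. \<bar>r\<bar> \<le> \<bar>t\<bar> \<and> h (x0 + (t *\<^sub>R u + r *\<^sub>R w)) = h x0" if t: "\<bar>t\<bar> < \<eta>" for t
  proof -
    have t1: "\<bar>t\<bar> < \<eta>1" using t by (simp add: \<eta>_def)
    have c: "continuous_on {-\<bar>t\<bar>..\<bar>t\<bar>} (\<lambda>r. h (x0 + (t *\<^sub>R u + r *\<^sub>R w)))"
      by (rule continuous_on_compose2[OF S(3)]) (use inS[OF t] in \<open>auto intro!: continuous_intros\<close>)
    define a where "a = \<bar>t\<bar>"
    have a: "a \<ge> 0" by (simp add: a_def)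
    have e1: "\<bar>h (x0 + (t *\<^sub>R u + (-a) *\<^sub>R w)) - h x0 - - a\<bar> \<le> 1/2 * a"
      using \<eta>1(2)[OF t1, of "-a"] by (simp add: a_def)
    have e2: "\<bar>h (x0 + (t *\<^sub>R u + a *\<^sub>R w)) - h x0 - a\<bar> \<le> 1/2 * a"
      using \<eta>1(2)[OF t1, of a] by (simp add: a_def)
    have "h (x0 + (t *\<^sub>R u + (-\<bar>t\<bar>) *\<^sub>R w)) \<le> h x0"
      using abs_le_D1[OF e1] a unfolding a_def[symmetric] by linarith
    moreover have "h x0 \<le> h (x0 + (t *\<^sub>R u + \<bar>t\<bar> *\<^sub>R w))"
      using abs_le_D2[OF e2] a unfolding a_def[symmetric] by linarith
    ultimately obtain r where "-\<bar>t\<bar> \<le> r" "r \<le> \<bar>t\<bar>" "h (x0 + (t *\<^sub>R u + r *\<^sub>R w)) = h x0"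
      using IVT'[of "\<lambda>r. h (x0 + (t *\<^sub>R u + r *\<^sub>R w))" "-\<bar>t\<bar>" "h x0" "\<bar>t\<bar>", OF _ _ _ c] by auto
    then show ?thesis by (intro exI[of _ r]) auto
  qed
  then obtain r where r: "\<And>t. \<bar>t\<bar> < \<eta> \<Longrightarrow> \<bar>r t\<bar> \<le> \<bar>t\<bar> \<and> h (x0 + (t *\<^sub>R u + r t *\<^sub>R w)) = h x0" by metis
  \<comment> \<open>For larger times the curve rests at \<open>x0\<close>, so it lies in the level
    set at all times.\<close>
  define y where "y t = (if \<bar>t\<bar> < \<eta> then x0 + (t *\<^sub>R u + r t *\<^sub>R w) else x0)" for t
  show thesis
  proof (rule that[of y])
    have "r 0 = 0" using r[of 0] \<eta> by simp
    then show y0: "y 0 = x0" using \<eta> by (simp add: y_def)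
    show "y t \<in> S" for t using inS r S by (auto simp: y_def)
    show "h (y t) = h x0" for t using r by (simp add: y_def)
    show "(y has_vector_derivative u) (at 0)"
      unfolding has_vector_derivative_def has_derivative_at_alt
    proof (intro conjI allI impI bounded_linear_scaleR_left)
      fix e :: real assume e: "e > 0"
      define e' where "e' = e / (norm w + 1)"
      have e': "e' > 0" using e by (simp add: e'_def add_nonneg_pos)
      have "norm w + 1 > 0" by (simp add: add_nonneg_pos)
      then have "e' * norm w = e * (norm w / (norm w + 1))" "norm w / (norm w + 1) \<le> 1" by (auto simp: e'_def)
      then have ew: "e' * norm w \<le> e" using mult_left_mono[of "norm w / (norm w + 1)" 1 e] e by simp
      obtain \<eta>' where \<eta>': "\<eta>' > 0" "\<And>t r. \<lbrakk>\<bar>t\<bar> < \<eta>'; \<bar>r\<bar> \<le> \<bar>t\<bar>\<rbrakk> \<Longrightarrow> \<bar>h (x0 + (t *\<^sub>R u + r *\<^sub>R w)) - h x0 - r\<bar> \<le> e' * \<bar>t\<bar>"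
        using est[OF e'] by blast
      show "\<exists>d>0. \<forall>t. norm (t - 0) < d \<longrightarrow> norm (y t - y 0 - (t - 0) *\<^sub>R u) \<le> e * norm (t - 0)"
      proof (intro exI[of _ "min \<eta> \<eta>'"] conjI allI impI)
        show "0 < min \<eta> \<eta>'" using \<eta> \<eta>' by simp
        fix t :: real assume t: "norm (t - 0) < min \<eta> \<eta>'"
        then have "\<bar>t\<bar> < \<eta>" "\<bar>t\<bar> < \<eta>'" by auto
        \<comment> \<open>As \<open>h\<close> takes its old value on the curve, \<open>r t\<close>
          equals the remainder up to sign and is of order o(t).\<close>
        then have "\<bar>r t\<bar> \<le> e' * \<bar>t\<bar>" using \<eta>'(2)[of t "r t"] r[of t] by simp
        then have "\<bar>r t\<bar> * norm w \<le> e' * \<bar>t\<bar> * norm w" by (intro mult_right_mono) auto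
        also have "\<dots> = e' * norm w * \<bar>t\<bar>" by simp
        also have "\<dots> \<le> e * \<bar>t\<bar>" using ew by (intro mult_right_mono) auto
        finally show "norm (y t - y 0 - (t - 0) *\<^sub>R u) \<le> e * norm (t - 0)"
          using \<open>\<bar>t\<bar> < \<eta>\<close> y0 by (simp add: y_def)
      qed
    qed
  qed
qed

lemma coset_eq_iff:
  assumes "subspace L"
  shows "coset L a = coset L b \<longleftrightarrow> a - b \<in> L"
proof
  assume "coset L a = coset L b"
  moreover have "a \<in> coset L a" using subspace_0[OF assms] by (auto simp: coset_def intro!: exI[of _ 0])
  ultimately obtain y where "a = b + y" "y \<in> L" by (auto simp: coset_def)
  then show "a - b \<in> L" by simp
next
  assume ab: "a - b \<in> L"
  have "a + y \<in> coset L b" if "y \<in> L" for y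
    using subspace_add[OF assms ab that] by (auto simp: coset_def intro!: exI[of _ "a - b + y"])
  moreover have "b + y \<in> coset L a" if "y \<in> L" for y
    using subspace_diff[OF assms that ab] by (auto simp: coset_def intro!: exI[of _ "y - (a - b)"])
  ultimately show "coset L a = coset L b" by (auto simp: coset_def)
qed

context hamiltonian_family
begin

text \<open>With vanishing gradient the zero vector would solve the defining equation of the
  Hamiltonian vector field.\<close>

lemma grad_nonzero:
  assumes s: "s \<in> J" and c: "c \<in> charts_at A p" and X: "ham_vf A \<omega> (H s) p \<noteq> 0"
  shows "grad c (s, snd c p) \<noteq> 0"
proof
  assume "grad c (s, snd c p) = 0"
  then have "dfun A (H s) p \<xi> = 0" if "\<xi> \<in> tangent_space A p" for \<xi>
    using dfun_chart[OF s c that] by simp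
  moreover have "\<omega> p \<xi> 0 = 0" if "\<xi> \<in> tangent_space A p" for \<xi>
    using form_chart[OF c that subspace_0[OF subspace_tangent_space]] by simp
  ultimately have "ham_vf A \<omega> (H s) p = 0"
    using s subspace_0[OF subspace_tangent_space] by (intro ham_vf_eqI) auto
  then show False using X by simp
qed

lemma H_along_curve:
  assumes s: "s \<in> J" and v: "has_velocity A \<gamma> \<xi> t"
  shows "((\<lambda>t. H s (\<gamma> t)) has_vector_derivative dfun A (H s) (\<gamma> t) \<xi>) (at t)"
proof -
  obtain c where c: "c \<in> charts_at A (\<gamma> t)" using ex_chart by blast
  note m = charts_atD[OF c] and v = has_velocityD[OF v]
  have "((\<lambda>t. snd c (\<gamma> t)) has_derivative (\<lambda>h. h *\<^sub>R \<xi> c)) (at t)"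
    using v(3)[OF c] by (simp add: has_vector_derivative_def)
  from diff_chain_at[OF this H_chart_grad[OF m(1) s chart_in[OF m(2)]]]
  have "((\<lambda>t. H s (chart_inv c (snd c (\<gamma> t)))) has_derivative (\<lambda>h. (h *\<^sub>R \<xi> c) \<bullet> grad c (s, snd c (\<gamma> t)))) (at t)"
    by (simp add: o_def)
  then have "((\<lambda>t. H s (chart_inv c (snd c (\<gamma> t)))) has_vector_derivative dfun A (H s) (\<gamma> t) \<xi>) (at t)"
    using dfun_chart[OF s c v(1)] by (simp add: has_vector_derivative_def)
  moreover have "\<forall>\<^sub>F t in nhds t. \<gamma> t \<in> fst c" using v(2) chart_open m by (intro isCont_eventually_in_open) auto
  then have "\<forall>\<^sub>F t in nhds t. H s (chart_inv c (snd c (\<gamma> t))) = H s (\<gamma> t)"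
    by eventually_elim (use m in simp)
  ultimately show ?thesis by (rule has_vector_derivative_cong_nhds)
qed

text \<open>The energy is constant along a curve in the level set, which gives one inclusion; the
  other is \<open>level_set_curve\<close>, applicable because the gradient does not vanish.\<close>

lemma tangent_space_of_level:
  assumes s: "s \<in> J" and X: "ham_vf A \<omega> (H s) p \<noteq> 0" and c: "c \<in> charts_at A p"
  shows "tangent_space_of A (H s -` {H s p}) p = {\<xi> \<in> tangent_space A p. \<xi> c \<bullet> grad c (s, snd c p) = 0}"
proof (intro set_eqI iffI)
  fix \<xi> assume "\<xi> \<in> tangent_space_of A (H s -` {H s p}) p"
  then obtain \<gamma> where \<gamma>: "\<gamma> 0 = p" "\<And>t. H s (\<gamma> t) = H s p" "has_velocity A \<gamma> \<xi> 0"
    unfolding tangent_space_of_def by auto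
  have t: "\<xi> \<in> tangent_space A p" using has_velocityD(1)[OF \<gamma>(3)] \<gamma>(1) by simp
  have "((\<lambda>t. H s p) has_vector_derivative dfun A (H s) p \<xi>) (at 0)"
    using H_along_curve[OF s \<gamma>(3)] \<gamma> by simp
  then have "dfun A (H s) p \<xi> = 0" using has_vector_derivative_const vector_derivative_unique_at by blast
  then show "\<xi> \<in> {\<xi> \<in> tangent_space A p. \<xi> c \<bullet> grad c (s, snd c p) = 0}" using dfun_chart[OF s c t] t by simp
next
  fix \<xi> assume "\<xi> \<in> {\<xi> \<in> tangent_space A p. \<xi> c \<bullet> grad c (s, snd c p) = 0}"
  then have \<xi>: "\<xi> \<in> tangent_space A p" "\<xi> c \<bullet> grad c (s, snd c p) = 0" by auto
  note m = charts_atD[OF c]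
  have "continuous_on (chart_image c) (\<lambda>x. H s (chart_inv c x))"
    using H_chart_grad[OF m(1) s] by (meson continuous_at_imp_continuous_on has_derivative_continuous)
  then obtain y where y: "y 0 = snd c p" "\<And>t. y t \<in> chart_image c" "\<And>t. H s (chart_inv c (y t)) = H s (chart_inv c (snd c p))"
    "(y has_vector_derivative \<xi> c) (at 0)"
    using level_set_curve[OF H_chart_grad[OF m(1) s chart_in[OF m(2)]] grad_nonzero[OF s c X] chart_open(2)[OF m(1)] chart_in[OF m(2)] _ \<xi>(2)]
    by metis
  have "has_velocity A (\<lambda>t. chart_inv c (y t)) \<xi> 0"
  proof (rule has_velocityI[where c = c])
    show "isCont (\<lambda>t. chart_inv c (y t)) 0"
      by (rule isCont_o2[OF has_vector_derivative_continuous[OF y(4)]]) (rule isCont_chart_inv[OF m(1) y(2)])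
    show "((\<lambda>t. snd c (chart_inv c (y t))) has_vector_derivative \<xi> c) (at 0)" using y m by simp
  qed (use y m \<xi> c in auto)
  then show "\<xi> \<in> tangent_space_of A (H s -` {H s p}) p"
    unfolding tangent_space_of_def using y m by (intro CollectI exI[of _ "\<lambda>t. chart_inv c (y t)"]) auto
qed

lemma dmap_scaleR:
  assumes g: "chart_deriv A c d g p D" and \<xi>: "\<xi> \<in> tangent_space A p"
  shows "dmap A g p (k *\<^sub>R \<xi>) = k *\<^sub>R dmap A g p \<xi>"
proof -
  have k: "k *\<^sub>R \<xi> \<in> tangent_space A p" using subspace_scale[OF subspace_tangent_space \<xi>] .
  show ?thesis
  proof (rule tangent_eqI[OF dmap_tangent(1)[OF g k] subspace_scale[OF subspace_tangent_space dmap_tangent(1)[OF g \<xi>]]])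
    show "d \<in> charts_at A (g p)" using g by (simp add: chart_deriv_def)
    show "dmap A g p (k *\<^sub>R \<xi>) d = (k *\<^sub>R dmap A g p \<xi>) d"
      using dmap_tangent(2)[OF g k] dmap_tangent(2)[OF g \<xi>] linear_scale[OF chart_deriv_linear[OF g]] by (simp add: scaleR_fun_def)
  qed
qed

text \<open>Every basis of the quotient, read in the chart, gives the same trace by
  \<open>quotient_matrix_trace\<close>; together with one explicit basis this determines the
  definite description \<open>quotient_trace\<close>.\<close>

lemma monodromy_trace_eq:
  assumes s: "s \<in> J" and X: "ham_vf A \<omega> (H s) (v 0) \<noteq> 0" and c: "c \<in> charts_at A (v 0)"
    and F: "flow A (ham_vf A \<omega> (H s)) \<tau> (v 0) = v 0"
    and D: "chart_deriv A c c (flow A (ham_vf A \<omega> (H s)) \<tau>) (v 0) D"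
    and DX: "D (ham_vf A \<omega> (H s) (v 0) c) = ham_vf A \<omega> (H s) (v 0) c"
    and Dg: "\<And>u. D u \<bullet> grad c (s, snd c (v 0)) = u \<bullet> grad c (s, snd c (v 0))"
  shows "monodromy_trace A \<omega> (H s) v \<tau> = trace (matrix D) - 2"
proof -
  define p where "p = v 0"
  define Xp where "Xp = ham_vf A \<omega> (H s) p"
  define g where "g = grad c (s, snd c p)"
  define \<alpha> where "\<alpha> u = u \<bullet> g" for u
  define L where "L = span {Xp}"
  define f where "f = dmap A (flow A (ham_vf A \<omega> (H s)) \<tau>) p"
  define V where "V = tangent_space_of A (energy_surface (H s) v) p"
  have cp: "c \<in> charts_at A p" using c by (simp add: p_def)
  have V: "V = {\<xi> \<in> tangent_space A p. \<alpha> (\<xi> c) = 0}"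
    using tangent_space_of_level[OF s X c] by (simp add: V_def energy_surface_def p_def \<alpha>_def g_def)
  have lin\<alpha>: "linear \<alpha>" unfolding \<alpha>_def by (rule bounded_linear.linear[OF bounded_linear_inner_left])
  have XT: "Xp \<in> tangent_space A p" unfolding Xp_def by (rule ham_vf_tangent[OF s])
  have x0: "Xp c \<noteq> 0" using tangent_eqI[OF XT subspace_0[OF subspace_tangent_space] cp] X by (auto simp: Xp_def p_def)
  have "dfun A (H s) p Xp = 0" using ham_vf_dfun[OF s XT] form_self[OF XT] by (simp add: Xp_def)
  then have \<alpha>X: "\<alpha> (Xp c) = 0" using dfun_chart[OF s cp XT] by (simp add: \<alpha>_def g_def)
  have g0: "\<alpha> g \<noteq> 0" using grad_nonzero[OF s c X] by (simp add: \<alpha>_def g_def p_def)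
  have linD: "linear D" by (rule chart_deriv_linear[OF D])
  have mD: "matrix D *v u = D u" for u using matrix_works[OF linD[unfolded linear_matrix_vector_mul_eq[symmetric]]] linD by (simp add: matrix_works)
  have fT: "f \<xi> \<in> tangent_space A p" "f \<xi> c = D (\<xi> c)" if "\<xi> \<in> tangent_space A p" for \<xi>
    using dmap_tangent[OF D, folded p_def, OF that] F by (auto simp: f_def p_def)
  have sL: "subspace L" by (simp add: L_def)
  have Lk: "\<xi> \<in> L \<longleftrightarrow> (\<exists>k. \<xi> = k *\<^sub>R Xp)" for \<xi> by (auto simp: L_def span_singleton)
  have LT: "L \<subseteq> tangent_space A p" using XT subspace_scale[OF subspace_tangent_space] by (auto simp: Lk)
  have Lc: "\<xi> \<in> L \<longleftrightarrow> (\<exists>k. \<xi> c = k *\<^sub>R Xp c)" if "\<xi> \<in> tangent_space A p" for \<xi>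
  proof -
    have "\<xi> = k *\<^sub>R Xp \<longleftrightarrow> \<xi> c = k *\<^sub>R Xp c" for k
      using tangent_eqI[OF that subspace_scale[OF subspace_tangent_space XT] cp, of k] by (auto simp: scaleR_fun_def)
    then show ?thesis by (simp add: Lk)
  qed
  have lincomb: "a *\<^sub>R \<xi> + b *\<^sub>R \<eta> \<in> tangent_space A p" if "\<xi> \<in> tangent_space A p" "\<eta> \<in> tangent_space A p" for a b \<xi> \<eta>
    using that by (intro subspace_add subspace_scale subspace_tangent_space)
  \<comment> \<open>Well defined on cosets because \<open>D\<close> fixes the coordinate vector of
    \<open>X\<close>.\<close>
  have ind: "induced_map L f (coset L \<xi>) = coset L (f \<xi>)" if \<xi>: "\<xi> \<in> tangent_space A p" for \<xi>
  proof -
    have "coset L (f (\<xi> + y)) = coset L (f \<xi>)" if y: "y \<in> L" for y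
    proof -
      obtain k where k: "y = k *\<^sub>R Xp" using y Lk by blast
      have t: "\<xi> + y \<in> tangent_space A p" using \<xi> y LT subspace_add[OF subspace_tangent_space] by blast
      have "f (\<xi> + y) c - f \<xi> c = k *\<^sub>R Xp c"
        using fT(2)[OF t] fT(2)[OF \<xi>] DX linD by (simp add: k scaleR_fun_def linear_add linear_scale Xp_def p_def)
      then have "f (\<xi> + y) - f \<xi> \<in> L"
        using Lc[OF subspace_diff[OF subspace_tangent_space fT(1)[OF t] fT(1)[OF \<xi>]]] by auto
      then show ?thesis by (simp add: coset_eq_iff[OF sL])
    qed
    moreover have "\<xi> \<in> coset L \<xi>" using subspace_0[OF sL] by (auto simp: coset_def intro!: exI[of _ 0])
    ultimately show ?thesis unfolding induced_map_def by (auto simp: coset_def[of L \<xi>])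
  qed
  have key: "trace B = trace (matrix D) - 2"
    if e: "quotient_basis V L e" and B: "\<And>j. induced_map L f (coset L (e j)) = coset L (\<Sum>i\<in>UNIV. B $ i $ j *\<^sub>R e i)" for e :: "2 \<Rightarrow> _" and B :: "real^2^2"
  proof (rule quotient_matrix_trace[where e = "\<lambda>i. e i c" and X = "Xp c", OF lin\<alpha> x0 \<alpha>X g0])
    have eV: "e i \<in> tangent_space A p" "\<alpha> (e i c) = 0" for i using e V by (auto simp: quotient_basis_def)
    show "matrix D *v Xp c = Xp c" using DX mD by (simp add: Xp_def p_def)
    show "\<alpha> (matrix D *v u) = \<alpha> u" for u using Dg mD by (simp add: \<alpha>_def g_def p_def)
    show "\<alpha> (e i c) = 0" for i by (rule eV(2))
    show "\<forall>k l m. k *\<^sub>R Xp c + l *\<^sub>R e 1 c + m *\<^sub>R e 2 c = 0 \<longrightarrow> l = 0 \<and> m = 0"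
    proof (intro allI impI)
      fix k l m :: real assume z: "k *\<^sub>R Xp c + l *\<^sub>R e 1 c + m *\<^sub>R e 2 c = 0"
      define a :: "real^2" where "a = vector [l, m]"
      have "(l *\<^sub>R e 1 + m *\<^sub>R e 2) c = (- k) *\<^sub>R Xp c" using z by (simp add: scaleR_fun_def eq_neg_iff_add_eq_0 add_ac)
      then have "l *\<^sub>R e 1 + m *\<^sub>R e 2 \<in> L" using Lc[OF lincomb[OF eV(1) eV(1)]] by blast
      \<comment> \<open>A nontrivial relation would give the zero class two coordinate vectors,
        \<open>a\<close> and 0.\<close>
      from subspace_neg[OF sL this] have "coset L 0 = coset L (\<Sum>i\<in>UNIV. a $ i *\<^sub>R e i)"
        by (simp add: coset_eq_iff[OF sL] sum_2 a_def)
      moreover have "coset L 0 = coset L (\<Sum>i\<in>UNIV. (0::real^2) $ i *\<^sub>R e i)" by simp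
      moreover have "coset L 0 \<in> quotient_space V L"
        using subspace_0[OF subspace_tangent_space] by (auto simp: quotient_space_def V linear_0[OF lin\<alpha>])
      moreover have "\<forall>C\<in>quotient_space V L. \<exists>!a::real^2. C = coset L (\<Sum>i\<in>UNIV. a $ i *\<^sub>R e i)"
        using e unfolding quotient_basis_def by (rule conjunct2)
      ultimately have "a = 0" by blast
      then have "a $ 1 = 0" "a $ 2 = 0" by auto
      then show "l = 0 \<and> m = 0" by (simp add: a_def)
    qed
    fix j
    have "f (e j) - (\<Sum>i\<in>UNIV. B $ i $ j *\<^sub>R e i) \<in> L" using B[of j] ind[OF eV(1)] by (simp add: coset_eq_iff[OF sL])
    then have *: "f (e j) - (B $ 1 $ j *\<^sub>R e 1 + B $ 2 $ j *\<^sub>R e 2) \<in> L" by (simp add: sum_2)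
    then obtain k where "(f (e j) - (B $ 1 $ j *\<^sub>R e 1 + B $ 2 $ j *\<^sub>R e 2)) c = k *\<^sub>R Xp c" using Lc LT by blast
    then have "D (e j c) = k *\<^sub>R Xp c + B$1$j *\<^sub>R e 1 c + B$2$j *\<^sub>R e 2 c" using fT(2)[OF eV(1)] by (simp add: scaleR_fun_def algebra_simps)
    then show "\<exists>k. matrix D *v e j c = k *\<^sub>R Xp c + B$1$j *\<^sub>R e 1 c + B$2$j *\<^sub>R e 2 c" using mD by auto
  qed
  obtain P :: "real^4^4" where P: "invertible P" "P *v axis 1 1 = Xp c" "\<And>x. \<alpha> (P *v x) = x $ 4"
    using adapted_frame[OF lin\<alpha> x0 \<alpha>X g0] by metis
  \<comment> \<open>The two middle columns of the adapted frame, lifted to tangent vectors,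
    represent a basis of the quotient.\<close>
  define b where "b i = P *v axis (if i = (1::2) then 2 else 3) 1" for i
  define e where "e i = coord_vec A c p (b i)" for i
  have eT: "e i \<in> tangent_space A p" "e i c = b i" for i using coord_vec_tangent[OF cp] by (auto simp: e_def)
  have b\<alpha>: "\<alpha> (b i) = 0" for i by (simp add: b_def P(3) axis_def)
  have exp: "P *v x = x$1 *\<^sub>R Xp c + x$2 *\<^sub>R b 1 + x$3 *\<^sub>R b 2 + x$4 *\<^sub>R (P *v axis 4 1)" for x
  proof -
    have "x = x$1 *\<^sub>R axis 1 1 + x$2 *\<^sub>R axis 2 1 + x$3 *\<^sub>R axis 3 1 + x$4 *\<^sub>R axis 4 1"
      by (simp add: vec_eq_iff forall_4 axis_def)
    then have "P *v x = P *v (x$1 *\<^sub>R axis 1 1 + x$2 *\<^sub>R axis 2 1 + x$3 *\<^sub>R axis 3 1 + x$4 *\<^sub>R axis 4 1)" by simp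
    then show ?thesis by (simp add: matrix_vector_right_distrib matrix_vector_mult_scaleR P(2) b_def)
  qed
  have rep: "\<exists>x::real^4. u = x$1 *\<^sub>R Xp c + x$2 *\<^sub>R b 1 + x$3 *\<^sub>R b 2" if "\<alpha> u = 0" for u
  proof -
    have "u = P *v (matrix_inv P *v u)" by (simp add: matrix_vector_mul_assoc matrix_inv_right[OF P(1)])
    then show ?thesis using exp[of "matrix_inv P *v u"] P(3)[of "matrix_inv P *v u"] that
      by (intro exI[of _ "matrix_inv P *v u"]) simp
  qed
  have ind0: "l = 0 \<and> m = 0" if z: "k *\<^sub>R Xp c + l *\<^sub>R b 1 + m *\<^sub>R b 2 = 0" for k l m
  proof -
    define x :: "real^4" where "x = (\<chi> i. if i = 1 then k else if i = 2 then l else if i = 3 then m else 0)"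
    have "P *v x = 0" using exp[of x] z by (simp add: x_def)
    then have "x = 0" using inj_matrix_vector_mult[OF P(1)] by (metis injD matrix_vector_mult_0_right)
    then have "x $ 2 = 0" "x $ 3 = 0" by auto
    then show ?thesis by (simp add: x_def)
  qed
  have cosetI: "coset L \<xi> = coset L (\<Sum>i\<in>UNIV. a $ i *\<^sub>R e i) \<longleftrightarrow> (\<exists>k. \<xi> c = k *\<^sub>R Xp c + a$1 *\<^sub>R b 1 + a$2 *\<^sub>R b 2)"
    if \<xi>: "\<xi> \<in> tangent_space A p" for \<xi> and a :: "real^2"
  proof -
    have "coset L \<xi> = coset L (\<Sum>i\<in>UNIV. a $ i *\<^sub>R e i) \<longleftrightarrow> \<xi> - (a$1 *\<^sub>R e 1 + a$2 *\<^sub>R e 2) \<in> L"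
      by (simp add: coset_eq_iff[OF sL] sum_2)
    also have "\<dots> \<longleftrightarrow> (\<exists>k. (\<xi> - (a$1 *\<^sub>R e 1 + a$2 *\<^sub>R e 2)) c = k *\<^sub>R Xp c)"
      by (rule Lc[OF subspace_diff[OF subspace_tangent_space \<xi> lincomb[OF eT(1) eT(1)]]])
    also have "\<dots> \<longleftrightarrow> (\<exists>k. \<xi> c = k *\<^sub>R Xp c + a$1 *\<^sub>R b 1 + a$2 *\<^sub>R b 2)"
      by (simp add: scaleR_fun_def eT(2) diff_eq_eq add.assoc)
    finally show ?thesis .
  qed
  have qb: "quotient_basis V L e"
    unfolding quotient_basis_def
  proof (intro conjI allI ballI)
    show "e i \<in> V" for i using eT b\<alpha> by (simp add: V)
    fix C assume "C \<in> quotient_space V L"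
    then obtain \<xi> where \<xi>: "\<xi> \<in> tangent_space A p" "\<alpha> (\<xi> c) = 0" "C = coset L \<xi>" by (auto simp: quotient_space_def V)
    obtain x :: "real^4" where x: "\<xi> c = x$1 *\<^sub>R Xp c + x$2 *\<^sub>R b 1 + x$3 *\<^sub>R b 2" using rep[OF \<xi>(2)] by blast
    show "\<exists>!a::real^2. C = coset L (\<Sum>i\<in>UNIV. a $ i *\<^sub>R e i)"
    proof (rule ex1I[of _ "vector [x$2, x$3]"])
      show "C = coset L (\<Sum>i\<in>UNIV. (vector [x$2, x$3] :: real^2) $ i *\<^sub>R e i)"
        using cosetI[OF \<xi>(1), of "vector [x$2, x$3]"] x by (auto simp: \<xi>(3))
      fix a :: "real^2" assume "C = coset L (\<Sum>i\<in>UNIV. a $ i *\<^sub>R e i)"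
      then obtain k where "\<xi> c = k *\<^sub>R Xp c + a$1 *\<^sub>R b 1 + a$2 *\<^sub>R b 2" using cosetI[OF \<xi>(1), of a] \<xi>(3) by blast
      then have "(k - x$1) *\<^sub>R Xp c + (a$1 - x$2) *\<^sub>R b 1 + (a$2 - x$3) *\<^sub>R b 2 = 0" using x by (simp add: algebra_simps)
      from ind0[OF this] show "a = vector [x$2, x$3]" by (simp add: vec_eq_iff forall_2)
    qed
  qed
  have "\<exists>x::real^4. D (b j) = x$1 *\<^sub>R Xp c + x$2 *\<^sub>R b 1 + x$3 *\<^sub>R b 2" for j
    using rep[of "D (b j)"] Dg[of "b j"] b\<alpha>[of j] by (simp add: \<alpha>_def g_def p_def)
  then obtain x :: "2 \<Rightarrow> real^4" where x: "\<And>j. D (b j) = x j$1 *\<^sub>R Xp c + x j$2 *\<^sub>R b 1 + x j$3 *\<^sub>R b 2" by metis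
  define B :: "real^2^2" where "B = (\<chi> i j. if i = 1 then x j $ 2 else x j $ 3)"
  have Bj: "induced_map L f (coset L (e j)) = coset L (\<Sum>i\<in>UNIV. B $ i $ j *\<^sub>R e i)" for j
  proof -
    have "coset L (f (e j)) = coset L (\<Sum>i\<in>UNIV. (\<chi> i. B $ i $ j) $ i *\<^sub>R e i)"
      unfolding cosetI[OF fT(1)[OF eT(1)]] using x[of j] by (auto simp: fT(2)[OF eT(1)] eT(2) B_def)
    then show ?thesis using ind[OF eT(1)] by simp
  qed
  have "quotient_trace V L (induced_map L f) = trace (matrix D) - 2"
    unfolding quotient_trace_def
  proof (rule the_equality)
    show "\<exists>e B. quotient_basis V L e \<and> (\<forall>j. induced_map L f (coset L (e j)) = coset L (\<Sum>i\<in>UNIV. B $ i $ j *\<^sub>R e i)) \<and> trace (matrix D) - 2 = trace (B::real^2^2)"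
      by (intro exI[of _ e] exI[of _ B] conjI allI qb Bj) (rule key[OF qb Bj, symmetric])
    fix x assume "\<exists>e B. quotient_basis V L e \<and> (\<forall>j. induced_map L f (coset L (e j)) = coset L (\<Sum>i\<in>UNIV. B $ i $ j *\<^sub>R e i)) \<and> x = trace (B::real^2^2)"
    then show "x = trace (matrix D) - 2" using key by (elim exE conjE) simp
  qed
  then show ?thesis
    by (simp add: monodromy_trace_def reduced_monodromy_def V_def L_def f_def Xp_def p_def)
qed

section \<open>Symmetries and conservation of energy\<close>

text \<open>Differentiation of \<open>H s (g q) = H s q\<close>. Hence the functional that cuts out
  the tangent space of the energy level is preserved by \<open>D\<close>.\<close>

lemma germ_preserves_grad:
  assumes s: "s \<in> J" and g: "chart_deriv A c d g p D" and inv: "\<forall>\<^sub>F q in nhds p. H s (g q) = H s q"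
  shows "D u \<bullet> grad d (s, snd d (g p)) = u \<bullet> grad c (s, snd c p)"
proof -
  have c: "c \<in> charts_at A p" and d: "d \<in> charts_at A (g p)" and ic: "isCont g p" using g by (auto simp: chart_deriv_def)
  note m = charts_atD[OF c] charts_atD[OF d]
  have "((\<lambda>x. snd d (g (chart_inv c x))) has_derivative D) (at (snd c p))" using g by (simp add: chart_deriv_def)
  from diff_chain_at[OF this, of "\<lambda>x. H s (chart_inv d x)"] H_chart_grad[OF m(3) s chart_in[OF m(4)]] m
  have "((\<lambda>x. H s (chart_inv d (snd d (g (chart_inv c x))))) has_derivative (\<lambda>u. D u \<bullet> grad d (s, snd d (g p)))) (at (snd c p))"
    by (simp add: o_def)
  moreover have "\<forall>\<^sub>F q in nhds p. g q \<in> fst d" using ic chart_open m by (intro isCont_eventually_in_open) auto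
  then have "\<forall>\<^sub>F q in nhds p. H s (chart_inv d (snd d (g q))) = H s q"
    using inv by eventually_elim (use m in simp)
  then have "\<forall>\<^sub>F x in nhds (snd c p). H s (chart_inv d (snd d (g (chart_inv c x)))) = H s (chart_inv c x)"
    by (rule eventually_chart_inv[OF c])
  ultimately have "((\<lambda>x. H s (chart_inv c x)) has_derivative (\<lambda>u. D u \<bullet> grad d (s, snd d (g p)))) (at (snd c p))"
    by (rule has_derivative_cong_nhds)
  moreover have "((\<lambda>x. H s (chart_inv c x)) has_derivative (\<lambda>u. u \<bullet> grad c (s, snd c p))) (at (snd c p))"
    by (rule H_chart_grad[OF m(1) s chart_in[OF m(2)]])
  ultimately show ?thesis using has_derivative_unique by (metis (no_types, lifting))
qed

lemma involution_chart_deriv: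
  assumes "antisymplectic_involution A \<omega> \<rho>" "c \<in> charts_at A p" "d \<in> charts_at A (\<rho> p)"
  shows "\<exists>D. chart_deriv A c d \<rho> p D"
  using assms smooth_map_chart_deriv unfolding antisymplectic_involution_def by blast

text \<open>The involution preserves dH and reverses the form, so it reverses the solution of the
  defining equation. Every vector at \<open>\<rho> p\<close> can be used as a test vector because
  the derivative at \<open>\<rho> p\<close> is a right inverse of the one at
  \<open>p\<close>.\<close>

lemma involution_ham_vf:
  assumes s: "s \<in> J" and \<rho>: "antisymplectic_involution A \<omega> \<rho>" and H\<rho>: "H s \<circ> \<rho> = H s"
  shows "dmap A \<rho> p (ham_vf A \<omega> (H s) p) = - ham_vf A \<omega> (H s) (\<rho> p)"
proof -
  have \<rho>\<rho>: "\<rho> (\<rho> q) = q" for q using \<rho> unfolding antisymplectic_involution_def by (metis comp_apply id_apply)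
  have Hq: "H s (\<rho> q) = H s q" for q using H\<rho> by (metis comp_apply)
  obtain c d where c: "c \<in> charts_at A p" and d: "d \<in> charts_at A (\<rho> p)" using ex_chart by metis
  obtain D where D: "chart_deriv A c d \<rho> p D" using involution_chart_deriv[OF \<rho> c d] by blast
  have c': "c \<in> charts_at A (\<rho> (\<rho> p))" using c \<rho>\<rho> by simp
  obtain D' where D': "chart_deriv A d c \<rho> (\<rho> p) D'" using involution_chart_deriv[OF \<rho> d c'] by blast
  have "chart_deriv A d d (\<lambda>q. \<rho> (\<rho> q)) (\<rho> p) (\<lambda>u. D (D' u))"
    using chart_deriv_compose[OF D', of d \<rho> D] D \<rho>\<rho> by simp
  moreover have "chart_deriv A d d (\<lambda>q. \<rho> (\<rho> q)) (\<rho> p) (transition d d (\<rho> p))" using chart_deriv_id(1)[OF d d] \<rho>\<rho> by simp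
  ultimately have "(\<lambda>u. D (D' u)) = transition d d (\<rho> p)" by (rule chart_deriv_unique)
  then have DD': "D (D' u) = u" for u using transition_same[OF d] by metis
  define X where "X = ham_vf A \<omega> (H s) p"
  have XT: "X \<in> tangent_space A p" using ham_vf_tangent[OF s] by (simp add: X_def)
  note dX = dmap_tangent(1)[OF D XT]
  have "ham_vf A \<omega> (H s) (\<rho> p) = - dmap A \<rho> p X"
  proof (rule ham_vf_eqI[OF s])
    show nX: "- dmap A \<rho> p X \<in> tangent_space A (\<rho> p)" using subspace_neg[OF subspace_tangent_space dX] .
    fix \<eta> assume \<eta>: "\<eta> \<in> tangent_space A (\<rho> p)"
    define \<xi> where "\<xi> = coord_vec A c p (D' (\<eta> d))"
    have \<xi>: "\<xi> \<in> tangent_space A p" "\<xi> c = D' (\<eta> d)" using coord_vec_tangent[OF c] by (auto simp: \<xi>_def)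
    have \<eta>\<xi>: "\<eta> = dmap A \<rho> p \<xi>"
      by (rule tangent_eqI[OF \<eta> dmap_tangent(1)[OF D \<xi>(1)] d]) (simp add: dmap_tangent(2)[OF D \<xi>(1)] \<xi>(2) DD')
    have "dfun A (H s) (\<rho> p) \<eta> = D (\<xi> c) \<bullet> grad d (s, snd d (\<rho> p))"
      using dfun_chart[OF s d \<eta>] dmap_tangent(2)[OF D \<xi>(1)] \<eta>\<xi> by simp
    also have "\<dots> = dfun A (H s) p \<xi>"
      using germ_preserves_grad[OF s D] Hq dfun_chart[OF s c \<xi>(1)] by simp
    also have "\<dots> = \<omega> p \<xi> X" using ham_vf_dfun[OF s \<xi>(1)] by (simp add: X_def)
    also have "\<dots> = - \<omega> (\<rho> p) \<eta> (dmap A \<rho> p X)"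
      using \<rho> \<xi>(1) XT unfolding antisymplectic_involution_def \<eta>\<xi> by simp
    also have "\<dots> = \<omega> (\<rho> p) \<eta> (- dmap A \<rho> p X)"
      using form_chart[OF d \<eta> dX] form_chart[OF d \<eta> nX] by (simp add: linear_neg[OF matrix_vector_mul_linear])
    finally show "dfun A (H s) (\<rho> p) \<eta> = \<omega> (\<rho> p) \<eta> (- dmap A \<rho> p X)" .
  qed
  then show ?thesis by (simp add: X_def)
qed

text \<open>The involution negates the field and reversal of time negates it again. The factor
  \<open>k\<close> provides for the rescaling by the period.\<close>

lemma int_curve_involution:
  assumes s: "s \<in> J" and \<rho>: "antisymplectic_involution A \<omega> \<rho>" and H\<rho>: "H s \<circ> \<rho> = H s"
    and \<gamma>: "int_curve A (\<lambda>p. k *\<^sub>R ham_vf A \<omega> (H s) p) \<gamma> I"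
  shows "int_curve A (\<lambda>p. k *\<^sub>R ham_vf A \<omega> (H s) p) (\<lambda>r. \<rho> (\<gamma> (b - r))) ((\<lambda>r. b - r) ` I)"
  unfolding int_curve_def
proof (intro conjI ballI)
  have "(\<lambda>r. b - r) ` I = (\<lambda>r. b - r) -` I" by (auto simp: image_iff intro!: bexI[of _ "b - _"])
  moreover have "open ((\<lambda>r. b - r) -` I)" using \<gamma> by (intro open_vimage continuous_intros) (simp add: int_curve_def)
  ultimately show "open ((\<lambda>r. b - r) ` I)" by simp
  show "connected ((\<lambda>r. b - r) ` I)" using \<gamma> by (intro connected_continuous_image continuous_intros) (simp add: int_curve_def)
  fix r assume "r \<in> (\<lambda>r. b - r) ` I"
  then have "b - r \<in> I" by auto
  then have "has_velocity A \<gamma> (k *\<^sub>R ham_vf A \<omega> (H s) (\<gamma> (b - r))) ((-1) * r + b)" using \<gamma> by (auto simp: int_curve_def)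
  note v = has_velocity_affine[OF this]
  let ?p = "\<gamma> ((-1) * r + b)"
  obtain c d where cd: "c \<in> charts_at A ?p" "d \<in> charts_at A (\<rho> ?p)" using ex_chart by metis
  obtain D where D: "chart_deriv A c d \<rho> ?p D" using involution_chart_deriv[OF \<rho> cd] by blast
  have X: "ham_vf A \<omega> (H s) ?p \<in> tangent_space A ?p" by (rule ham_vf_tangent[OF s])
  have "dmap A \<rho> ?p ((-1) *\<^sub>R k *\<^sub>R ham_vf A \<omega> (H s) ?p) = k *\<^sub>R ham_vf A \<omega> (H s) (\<rho> ?p)"
    using dmap_scaleR[OF D X, of "- k"] involution_ham_vf[OF s \<rho> H\<rho>, of ?p] by simp
  then show "has_velocity A (\<lambda>r. \<rho> (\<gamma> (b - r))) (k *\<^sub>R ham_vf A \<omega> (H s) (\<rho> (\<gamma> (b - r)))) r"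
    using has_velocity_image[OF v, of c d \<rho> D] D by simp
qed

lemma int_curve_energy:
  assumes s: "s \<in> J" and \<gamma>: "int_curve A (\<lambda>p. k *\<^sub>R ham_vf A \<omega> (H s) p) \<gamma> I" and t: "t \<in> I" "t' \<in> I"
  shows "H s (\<gamma> t) = H s (\<gamma> t')"
proof -
  have "convex I" using \<gamma> by (simp add: int_curve_def convex_connected is_interval_connected_1 is_interval_convex_1[symmetric])
  moreover have "((\<lambda>t. H s (\<gamma> t)) has_derivative (\<lambda>h. 0)) (at t within I)" if "t \<in> I" for t
  proof -
    have v: "has_velocity A \<gamma> (k *\<^sub>R ham_vf A \<omega> (H s) (\<gamma> t)) t" using \<gamma> that by (simp add: int_curve_def)
    define X where "X = ham_vf A \<omega> (H s) (\<gamma> t)"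
    have X: "X \<in> tangent_space A (\<gamma> t)" by (simp add: X_def ham_vf_tangent[OF s])
    obtain c where c: "c \<in> charts_at A (\<gamma> t)" using ex_chart by blast
    have "dfun A (H s) (\<gamma> t) X = 0" using ham_vf_dfun[OF s X] form_self[OF X] by (simp add: X_def)
    then have "dfun A (H s) (\<gamma> t) (k *\<^sub>R X) = 0"
      using dfun_chart[OF s c X] dfun_chart[OF s c subspace_scale[OF subspace_tangent_space X]] by (simp add: scaleR_fun_def)
    then have "((\<lambda>t. H s (\<gamma> t)) has_vector_derivative 0) (at t)" using H_along_curve[OF s v] by (simp add: X_def)
    then show ?thesis by (simp add: has_vector_derivative_def has_derivative_at_withinI)
  qed
  ultimately show ?thesis using has_derivative_zero_constant[of I "\<lambda>t. H s (\<gamma> t)"] t by auto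
qed

end

section \<open>Rescaling to period one\<close>

lemma (in smooth_manifold) int_curve_rescale:
  assumes "k \<noteq> 0" "int_curve A X \<gamma> I"
  shows "int_curve A (\<lambda>p. k *\<^sub>R X p) (\<lambda>r. \<gamma> (k * r)) ((\<lambda>r. r / k) ` I)"
  unfolding int_curve_def
proof (intro conjI ballI)
  have "(\<lambda>r. r / k) ` I = (\<lambda>r. k * r) -` I" using assms(1) by (auto simp: image_iff intro!: bexI[of _ "k * _"])
  moreover have "open ((\<lambda>r. k * r) -` I)" using assms by (intro open_vimage continuous_intros) (simp add: int_curve_def)
  ultimately show "open ((\<lambda>r. r / k) ` I)" by simp
  show "connected ((\<lambda>r. r / k) ` I)" using assms by (intro connected_continuous_image continuous_intros) (simp_all add: int_curve_def)
  fix r assume "r \<in> (\<lambda>r. r / k) ` I"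
  then have "has_velocity A \<gamma> (X (\<gamma> (k * r))) (k * r + 0)" using assms by (auto simp: int_curve_def)
  from has_velocity_affine[OF this] show "has_velocity A (\<lambda>r. \<gamma> (k * r)) (k *\<^sub>R X (\<gamma> (k * r))) r" by simp
qed

text \<open>Both definite descriptions are satisfied by the same points, so the equation holds even
  where no integral curve exists, and the two maps agree as functions.\<close>

lemma (in smooth_manifold) flow_rescale:
  assumes k: "k \<noteq> 0"
  shows "flow A X k p = flow A (\<lambda>p. k *\<^sub>R X p) 1 p"
proof -
  have "(\<exists>\<gamma> I. int_curve A X \<gamma> I \<and> 0 \<in> I \<and> k \<in> I \<and> \<gamma> 0 = p \<and> \<gamma> k = q) \<longleftrightarrow>
    (\<exists>\<gamma> I. int_curve A (\<lambda>p. k *\<^sub>R X p) \<gamma> I \<and> 0 \<in> I \<and> 1 \<in> I \<and> \<gamma> 0 = p \<and> \<gamma> 1 = q)" (is "?l \<longleftrightarrow> ?r") for q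
  proof
    assume ?l
    then obtain \<gamma> I where \<gamma>: "int_curve A X \<gamma> I" "0 \<in> I" "k \<in> I" "\<gamma> 0 = p" "\<gamma> k = q" by blast
    have "0 \<in> (\<lambda>r. r / k) ` I" "1 \<in> (\<lambda>r. r / k) ` I" using \<gamma> k by (auto intro: image_eqI[of _ _ 0] image_eqI[of _ _ k])
    then show ?r using int_curve_rescale[OF k \<gamma>(1)] \<gamma>(4,5)
      by (intro exI[of _ "\<lambda>r. \<gamma> (k * r)"] exI[of _ "(\<lambda>r. r / k) ` I"]) auto
  next
    assume ?r
    then obtain \<gamma> I where \<gamma>: "int_curve A (\<lambda>p. k *\<^sub>R X p) \<gamma> I" "0 \<in> I" "1 \<in> I" "\<gamma> 0 = p" "\<gamma> 1 = q" by blast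
    have "0 \<in> (\<lambda>r. r / inverse k) ` I" "k \<in> (\<lambda>r. r / inverse k) ` I"
      using \<gamma> image_eqI[of k "\<lambda>r. r / inverse k" 1 I] image_eqI[of 0 "\<lambda>r. r / inverse k" 0 I]
      by (simp_all add: divide_inverse)
    then show ?l using int_curve_rescale[OF _ \<gamma>(1), of "inverse k"] \<gamma>(4,5) k
      by (intro exI[of _ "\<lambda>r. \<gamma> (inverse k * r)"] exI[of _ "(\<lambda>r. r / inverse k) ` I"]) auto
  qed
  then show ?thesis unfolding flow_def int_curve_def by (simp add: conj_ac)
qed

text \<open>The period multiplies the field, so the period map is the time-1 map for every
  parameter.\<close>

locale rescaled_hamiltonian_family = hamiltonian_family +
  fixes \<tau> :: "real \<Rightarrow> real"
  assumes \<tau>: "smooth_on J \<tau>"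
begin

definition Y where "Y s p = \<tau> s *\<^sub>R ham_vf A \<omega> (H s) p"

sublocale field: smooth_field_family A J Y
proof
  show "open J" by (rule J_open)
  show "Y s p \<in> tangent_space A p" if "s \<in> J" for s p
    unfolding Y_def by (rule subspace_scale[OF subspace_tangent_space ham_vf_tangent[OF that]])
  fix c assume c: "c \<in> A"
  define S where "S = J \<times> chart_image c"
  obtain h' where h': "continuous_on S h'"
    "\<And>z. z \<in> S \<Longrightarrow> ((\<lambda>x. ham_coord c (fst z, x)) has_derivative blinfun_apply (h' z)) (at (snd z))"
    using C1_on_partial[OF ham_coord_C1[OF c]] unfolding S_def by blast
  have C1\<tau>: "C1_on S (\<lambda>z. \<tau> (fst z))"
    using smooth_on_imp_C1_on[OF \<tau>] by (rule C1_on_compose_linear[OF _ bounded_linear_fst]) (auto simp: S_def)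
  have Yc: "Y s (chart_inv c x) c = \<tau> s *\<^sub>R ham_coord c (s, x)" if "s \<in> J" "x \<in> chart_image c" for s x
    using that c ham_vf_coord[OF that(1), of c "chart_inv c x"] by (simp add: Y_def scaleR_fun_def chart_atI)
  have ct: "continuous_on S (\<lambda>z. \<tau> (fst z))" using C1\<tau> by (rule C1_on_cont)
  have ch: "continuous_on S (ham_coord c)" using C1_on_cont[OF ham_coord_C1[OF c]] by (simp add: S_def)
  show "\<exists>f'. continuous_on (J \<times> chart_image c) (\<lambda>z. Y (fst z) (chart_inv c (snd z)) c) \<and>
        continuous_on (J \<times> chart_image c) f' \<and>
        (\<forall>z\<in>J \<times> chart_image c. ((\<lambda>x. Y (fst z) (chart_inv c x) c) has_derivative blinfun_apply (f' z)) (at (snd z)))"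
  proof (intro exI[of _ "\<lambda>z. \<tau> (fst z) *\<^sub>R h' z"] conjI ballI)
    have "continuous_on S (\<lambda>z. \<tau> (fst z) *\<^sub>R ham_coord c z)" by (intro continuous_intros ct ch)
    then show "continuous_on (J \<times> chart_image c) (\<lambda>z. Y (fst z) (chart_inv c (snd z)) c)"
      unfolding S_def by (rule continuous_on_eq) (auto simp: Yc)
    show "continuous_on (J \<times> chart_image c) (\<lambda>z. \<tau> (fst z) *\<^sub>R h' z)"
      unfolding S_def[symmetric] by (intro continuous_intros ct h')
    fix z assume z: "z \<in> J \<times> chart_image c"
    then obtain s x where sx: "z = (s, x)" "s \<in> J" "x \<in> chart_image c" by auto
    have "((\<lambda>x. \<tau> s *\<^sub>R ham_coord c (s, x)) has_derivative blinfun_apply (\<tau> s *\<^sub>R h' z)) (at x)"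
      using has_derivative_scaleR_right[OF h'(2)[of z], of "\<tau> s"] sx by (simp add: S_def scaleR_blinfun.rep_eq)
    moreover have "\<forall>\<^sub>F x in nhds x. x \<in> chart_image c" using sx c chart_open by (intro eventually_nhds_in_open) auto
    then have "\<forall>\<^sub>F x in nhds x. \<tau> s *\<^sub>R ham_coord c (s, x) = Y s (chart_inv c x) c" by eventually_elim (simp add: Yc sx)
    ultimately show "((\<lambda>x. Y (fst z) (chart_inv c x) c) has_derivative blinfun_apply (\<tau> (fst z) *\<^sub>R h' z)) (at (snd z))"
      unfolding sx(1) fst_conv snd_conv by (rule has_derivative_cong_nhds)
  qed
qed

end

section \<open>Symmetric orbits\<close>

lemma range_diff_real: "range (\<lambda>r::real. b - r) = UNIV" "range (\<lambda>r::real. r - b) = UNIV"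
proof -
  show "range (\<lambda>r::real. b - r) = UNIV" by (rule surjI[where f = "\<lambda>x. b - x"]) simp
  show "range (\<lambda>r::real. r - b) = UNIV" by (rule surjI[where f = "\<lambda>x. x + b"]) simp
qed

locale symmetric_orbit_family = rescaled_hamiltonian_family +
  fixes \<rho>\<^sub>1 \<rho>\<^sub>2 :: "'a \<Rightarrow> 'a" and v :: "real \<Rightarrow> real \<Rightarrow> 'a"
  assumes \<rho>1: "antisymplectic_involution A \<omega> \<rho>\<^sub>1" and \<rho>2: "antisymplectic_involution A \<omega> \<rho>\<^sub>2"
    and commute: "\<rho>\<^sub>1 \<circ> \<rho>\<^sub>2 = \<rho>\<^sub>2 \<circ> \<rho>\<^sub>1"
    and H\<rho>1: "\<And>s. s \<in> J \<Longrightarrow> H s \<circ> \<rho>\<^sub>1 = H s" and H\<rho>2: "\<And>s. s \<in> J \<Longrightarrow> H s \<circ> \<rho>\<^sub>2 = H s"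
    and v_smooth: "smooth_curve_family A J v"
    and orbit: "\<And>s. s \<in> J \<Longrightarrow> simple_periodic_orbit A (ham_vf A \<omega> (H s)) (v s) (\<tau> s)"
begin

text \<open>A composition of two antisymplectic maps that preserve the energy: it maps integral
  curves to integral curves without reversing time.\<close>

definition \<sigma> where "\<sigma> q = \<rho>\<^sub>1 (\<rho>\<^sub>2 q)"

lemma rho_rho [simp]: "\<rho>\<^sub>1 (\<rho>\<^sub>1 q) = q" "\<rho>\<^sub>2 (\<rho>\<^sub>2 q) = q"
  using \<rho>1 \<rho>2 unfolding antisymplectic_involution_def by (metis comp_apply id_apply)+

lemma rho_commute: "\<rho>\<^sub>2 (\<rho>\<^sub>1 q) = \<rho>\<^sub>1 (\<rho>\<^sub>2 q)"
  using commute by (metis comp_apply)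

lemma sigma_simps [simp]: "\<sigma> (\<sigma> q) = q" "\<rho>\<^sub>1 (\<sigma> q) = \<rho>\<^sub>2 q" "\<sigma> (\<rho>\<^sub>2 q) = \<rho>\<^sub>1 q"
  by (simp_all add: \<sigma>_def rho_commute)

lemma H_rho: "s \<in> J \<Longrightarrow> H s (\<rho>\<^sub>1 q) = H s q" "s \<in> J \<Longrightarrow> H s (\<rho>\<^sub>2 q) = H s q"
  using H\<rho>1 H\<rho>2 by (metis comp_apply)+

lemma H_sigma: "s \<in> J \<Longrightarrow> H s (\<sigma> q) = H s q"
  by (simp add: \<sigma>_def H_rho)

lemma tau_pos: "s \<in> J \<Longrightarrow> \<tau> s > 0"
  using orbit unfolding simple_periodic_orbit_def by blast

lemma v_periodic: "s \<in> J \<Longrightarrow> v s (t + 1) = v s t"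
  using orbit unfolding simple_periodic_orbit_def by blast

lemma v_simple: "s \<in> J \<Longrightarrow> v s t = v s t' \<Longrightarrow> t - t' \<in> \<int>"
  using orbit unfolding simple_periodic_orbit_def by blast

lemma v_int_curve: "s \<in> J \<Longrightarrow> int_curve A (Y s) (v s) UNIV"
  using orbit unfolding simple_periodic_orbit_def int_curve_def Y_def by simp

lemma int_curve_rho:
  assumes "s \<in> J" "int_curve A (Y s) \<gamma> I"
  shows "int_curve A (Y s) (\<lambda>r. \<rho>\<^sub>1 (\<gamma> (b - r))) ((\<lambda>r. b - r) ` I)"
    "int_curve A (Y s) (\<lambda>r. \<rho>\<^sub>2 (\<gamma> (b - r))) ((\<lambda>r. b - r) ` I)"
  using int_curve_involution[OF assms(1) \<rho>1 H\<rho>1[OF assms(1)], of "\<tau> s" \<gamma> I b]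
    int_curve_involution[OF assms(1) \<rho>2 H\<rho>2[OF assms(1)], of "\<tau> s" \<gamma> I b] assms(2)
  unfolding Y_def[abs_def] by auto

lemma int_curve_sigma:
  assumes "s \<in> J" "int_curve A (Y s) \<gamma> I"
  shows "int_curve A (Y s) (\<lambda>r. \<sigma> (\<gamma> (r + b))) ((\<lambda>r. r - b) ` I)"
proof -
  have "(\<lambda>r. 0 - r) ` (\<lambda>r. b - r) ` I = (\<lambda>r. r - b) ` I" by (simp add: image_image)
  then show ?thesis
    using int_curve_rho(1)[OF assms(1) int_curve_rho(2)[OF assms, of b], of 0] by (simp add: \<sigma>_def add.commute)
qed

text \<open>The image of an integral curve under each symmetry is again one, and the sign of
  \<open>T\<close> records whether time is reversed. The germ identities between flow and symmetries
  reduce to these four formulas.\<close>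

lemma flow_along:
  assumes "s \<in> J" "int_curve A (Y s) \<gamma> I"
  shows "\<lbrakk>a \<in> I; a + T \<in> I\<rbrakk> \<Longrightarrow> flow A (Y s) T (\<gamma> a) = \<gamma> (a + T)"
    "\<lbrakk>a \<in> I; a - T \<in> I\<rbrakk> \<Longrightarrow> flow A (Y s) T (\<rho>\<^sub>1 (\<gamma> a)) = \<rho>\<^sub>1 (\<gamma> (a - T))"
    "\<lbrakk>a \<in> I; a - T \<in> I\<rbrakk> \<Longrightarrow> flow A (Y s) T (\<rho>\<^sub>2 (\<gamma> a)) = \<rho>\<^sub>2 (\<gamma> (a - T))"
    "\<lbrakk>a \<in> I; a + T \<in> I\<rbrakk> \<Longrightarrow> flow A (Y s) T (\<sigma> (\<gamma> a)) = \<sigma> (\<gamma> (a + T))"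
proof -
  have p: "0 \<in> (\<lambda>r. r - a) ` I \<and> T \<in> (\<lambda>r. r - a) ` I" if "a \<in> I" "a + T \<in> I"
    using image_eqI[of 0 "\<lambda>r. r - a" a I] image_eqI[of T "\<lambda>r. r - a" "a + T" I] that by auto
  have m: "0 \<in> (\<lambda>r. a - r) ` I \<and> T \<in> (\<lambda>r. a - r) ` I" if "a \<in> I" "a - T \<in> I"
    using image_eqI[of 0 "\<lambda>r. a - r" a I] image_eqI[of T "\<lambda>r. a - r" "a - T" I] that by auto
  show "flow A (Y s) T (\<gamma> a) = \<gamma> (a + T)" if "a \<in> I" "a + T \<in> I"
    using field.flow_eq[OF assms(1) field.int_curve_shift[OF assms(2), of a], of T] p[OF that] by (simp add: add.commute)
  show "flow A (Y s) T (\<rho>\<^sub>1 (\<gamma> a)) = \<rho>\<^sub>1 (\<gamma> (a - T))" if "a \<in> I" "a - T \<in> I"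
    using field.flow_eq[OF assms(1) int_curve_rho(1)[OF assms, of a], of T] m[OF that] by simp
  show "flow A (Y s) T (\<rho>\<^sub>2 (\<gamma> a)) = \<rho>\<^sub>2 (\<gamma> (a - T))" if "a \<in> I" "a - T \<in> I"
    using field.flow_eq[OF assms(1) int_curve_rho(2)[OF assms, of a], of T] m[OF that] by simp
  show "flow A (Y s) T (\<sigma> (\<gamma> a)) = \<sigma> (\<gamma> (a + T))" if "a \<in> I" "a + T \<in> I"
    using field.flow_eq[OF assms(1) int_curve_sigma[OF assms, of a], of T] p[OF that] by (simp add: add.commute)
qed

lemma flow_v: "s \<in> J \<Longrightarrow> flow A (Y s) T (v s t) = v s (t + T)"
  using flow_along(1)[OF _ v_int_curve] by simp

text \<open>Otherwise the constant curve would be an integral curve and the orbit would coincide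
  with it, although its points at times 0 and 1/2 differ.\<close>

lemma ham_vf_nonzero:
  assumes s: "s \<in> J"
  shows "ham_vf A \<omega> (H s) (v s 0) \<noteq> 0"
proof
  assume z: "ham_vf A \<omega> (H s) (v s 0) = 0"
  obtain c where c: "c \<in> charts_at A (v s 0)" using ex_chart by blast
  have "has_velocity A (\<lambda>r. v s 0) (Y s (v s 0)) t" for t
    by (rule has_velocityI[where c = c]) (use z c subspace_0[OF subspace_tangent_space] in \<open>auto simp: Y_def\<close>)
  then have "int_curve A (Y s) (\<lambda>r. v s 0) UNIV" by (simp add: int_curve_def)
  from field.int_curve_unique[OF s this v_int_curve[OF s], of 0 "1/2"] have "v s 0 = v s (1/2)" by simp
  from v_simple[OF s this] have "(1/2 :: real) \<in> \<int>" by simp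
  then obtain n :: int where "1/2 = (of_int n :: real)" by (auto elim: Ints_cases)
  then have "of_int (2 * n) = (of_int 1 :: real)" by simp
  then have "2 * n = 1" by (simp only: of_int_eq_iff)
  then show False by presburger
qed

text \<open>Identities between germs at \<open>v s 0\<close> can be checked along a single integral
  curve through a nearby point, provided it is defined for all times involved.\<close>

lemma long_curves:
  assumes s: "s \<in> J"
  shows "\<forall>\<^sub>F q in nhds (v s 0). \<exists>\<gamma> I. int_curve A (Y s) \<gamma> I \<and> \<gamma> 0 = q \<and> {-m..m} \<subseteq> I"
proof -
  have ev: "\<forall>\<^sub>F q in nhds (v s 0). \<exists>\<gamma> I. int_curve A (Y s) \<gamma> I \<and> \<gamma> 0 = q \<and> 0 \<in> I \<and> T \<in> I" for T
  proof -
    have "\<forall>\<^sub>F z in nhds (s, v s 0). \<exists>\<gamma> I. int_curve A (Y (fst z)) \<gamma> I \<and> \<gamma> 0 = snd z \<and> 0 \<in> I \<and> T \<in> I"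
      using field.flow_regular[OF s v_int_curve[OF s] UNIV_I UNIV_I, of T] unfolding field.flow_regular_def
      by (elim conjE) (erule eventually_mono, blast)
    moreover have "filterlim (\<lambda>q. (s, q)) (nhds (s, v s 0)) (nhds (v s 0))"
      by (intro tendsto_Pair tendsto_const filterlim_ident)
    ultimately have "\<forall>\<^sub>F q in nhds (v s 0). \<exists>\<gamma> I. int_curve A (Y (fst (s, q))) \<gamma> I \<and> \<gamma> 0 = snd (s, q) \<and> 0 \<in> I \<and> T \<in> I"
      by (rule eventually_compose_filterlim)
    then show ?thesis unfolding fst_conv snd_conv .
  qed
  show ?thesis
    using ev[of m] ev[of "-m"]
  proof eventually_elim
    case (elim q)
    obtain \<gamma> I where \<gamma>: "int_curve A (Y s) \<gamma> I" "\<gamma> 0 = q" "0 \<in> I" "m \<in> I" using elim(1) by blast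
    obtain \<gamma>' I' where \<gamma>': "int_curve A (Y s) \<gamma>' I'" "\<gamma>' 0 = q" "0 \<in> I'" "-m \<in> I'" using elim(2) by blast
    obtain g where g: "int_curve A (Y s) g (I \<union> I')" "\<And>t. t \<in> I \<Longrightarrow> g t = \<gamma> t"
      by (rule field.int_curve_union[OF s \<gamma>(1) \<gamma>'(1) \<gamma>(3) \<gamma>'(3)]) (use \<gamma> \<gamma>' in auto)
    have "is_interval (I \<union> I')" using g(1) by (simp add: int_curve_def is_interval_connected_1)
    then have "{-m..m} \<subseteq> I \<union> I'" using \<gamma>(4) \<gamma>'(4) unfolding is_interval_1 by fastforce
    then show ?case using g \<gamma> by blast
  qed
qed

lemma flow_chart_deriv:
  assumes s: "s \<in> J" and c: "c \<in> charts_at A (v s t)" "d \<in> charts_at A (v s (t + T))"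
  shows "\<exists>D. chart_param_diff A c d (\<lambda>s. flow A (Y s) T) s (v s t) D" "\<exists>D. chart_deriv A c d (flow A (Y s) T) (v s t) D"
proof -
  have "field.flow_regular s (v s (0 + t)) T"
    using field.flow_regular[OF s field.int_curve_shift[OF v_int_curve[OF s], of t], of T] by simp
  then obtain c' d' D where "chart_param_diff A c' d' (\<lambda>s. flow A (Y s) T) s (v s t) D"
    unfolding field.flow_regular_def by auto
  from chart_param_diff_change[OF this c(1), of d]
  show "\<exists>D. chart_param_diff A c d (\<lambda>s. flow A (Y s) T) s (v s t) D" using c(2) flow_v[OF s] by simp
  then show "\<exists>D. chart_deriv A c d (flow A (Y s) T) (v s t) D" using chart_param_diff_chart_deriv by blast
qed

lemma energy_curve: "\<lbrakk>s \<in> J; int_curve A (Y s) \<gamma> I; t \<in> I; t' \<in> I\<rbrakk> \<Longrightarrow> H s (\<gamma> t) = H s (\<gamma> t')"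
  unfolding Y_def[abs_def] by (rule int_curve_energy)

lemma energy_v: "s \<in> J \<Longrightarrow> H s (v s t) = H s (v s t')"
  by (rule energy_curve[OF _ v_int_curve]) auto

text \<open>The curves \<open>g (v s t)\<close> and \<open>v s (k * t)\<close> have the same
  velocity at 0. The factor \<open>k\<close> is 1 for the period map and for its square root, -1 for
  the reversing map.\<close>

lemma chart_deriv_orbit:
  assumes s: "s \<in> J" and D: "chart_deriv A c c g (v s 0) D" and g: "\<And>t. g (v s t) = v s (k * t)"
  shows "D (ham_vf A \<omega> (H s) (v s 0) c) = k *\<^sub>R ham_vf A \<omega> (H s) (v s 0) c"
proof -
  define p where "p = v s 0"
  have c: "c \<in> charts_at A p" using D by (simp add: chart_deriv_def p_def)
  have vel: "has_velocity A (v s) (Y s p) 0" using v_int_curve[OF s] by (simp add: int_curve_def p_def)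
  have "has_velocity A (\<lambda>t. g (v s t)) (dmap A g p (Y s p)) 0"
    using has_velocity_image[OF vel D] by (simp add: p_def)
  then have 1: "((\<lambda>t. snd c (v s (k * t))) has_vector_derivative dmap A g p (Y s p) c) (at 0)"
    using has_velocityD(3)[of "\<lambda>t. g (v s t)" _ 0 c] c g by (simp add: p_def)
  have "has_velocity A (\<lambda>t. v s (k * t + 0)) (k *\<^sub>R Y s p) 0" by (rule has_velocity_affine) (simp add: vel)
  then have 2: "((\<lambda>t. snd c (v s (k * t))) has_vector_derivative k *\<^sub>R (Y s p c)) (at 0)"
    using has_velocityD(3)[of "\<lambda>t. v s (k * t + 0)" _ 0 c] c by (simp add: p_def scaleR_fun_def)
  have "dmap A g p (Y s p) c = k *\<^sub>R (Y s p c)" by (rule vector_derivative_unique_at[OF 1 2])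
  moreover have "dmap A g p (Y s p) c = D (Y s p c)" using dmap_tangent(2)[OF D field.tangent[OF s]] by (simp add: p_def)
  moreover have "Y s p c = \<tau> s *\<^sub>R ham_vf A \<omega> (H s) p c" by (simp add: Y_def scaleR_fun_def)
  ultimately have "\<tau> s *\<^sub>R D (ham_vf A \<omega> (H s) p c) = \<tau> s *\<^sub>R (k *\<^sub>R ham_vf A \<omega> (H s) p c)"
    using linear_scale[OF chart_deriv_linear[OF D]] by simp
  moreover have "\<tau> s \<noteq> 0" using tau_pos[OF s] by simp
  ultimately show ?thesis using scaleR_left_imp_eq unfolding p_def by blast
qed

text \<open>The conditions of the trace formula come from periodicity (fixed point), from invariance
  of the orbit (fixed vector) and from conservation of energy (fixed gradient).\<close>

lemma monodromy_trace_flow: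
  assumes s: "s \<in> J" and D: "chart_deriv A c c (flow A (Y s) 1) (v s 0) D"
  shows "monodromy_trace A \<omega> (H s) (v s) (\<tau> s) = trace (matrix D) - 2"
proof -
  have fl: "flow A (ham_vf A \<omega> (H s)) (\<tau> s) = flow A (Y s) 1"
    using flow_rescale[of "\<tau> s" "ham_vf A \<omega> (H s)"] tau_pos[OF s] by (auto simp: Y_def[abs_def])
  have c: "c \<in> charts_at A (v s 0)" using D by (simp add: chart_deriv_def)
  have fx: "flow A (Y s) 1 (v s t) = v s (1 * t)" for t using flow_v[OF s] v_periodic[OF s] by simp
  have "\<forall>\<^sub>F q in nhds (v s 0). H s (flow A (Y s) 1 q) = H s q"
    using long_curves[OF s, of 1]
  proof eventually_elim
    case (elim q)
    then obtain \<gamma> I where \<gamma>: "int_curve A (Y s) \<gamma> I" "\<gamma> 0 = q" "{-1..1} \<subseteq> I" by blast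
    then have "0 \<in> I" "1 \<in> I" by auto
    then show ?case using flow_along(1)[OF s \<gamma>(1), of 0 1] energy_curve[OF s \<gamma>(1), of 0 1] \<gamma>(2) by simp
  qed
  then have "D u \<bullet> grad c (s, snd c (v s 0)) = u \<bullet> grad c (s, snd c (v s 0))" for u
    using germ_preserves_grad[OF s D] fx[of 0] by simp
  then show ?thesis
    using monodromy_trace_eq[where v = "v s", OF s ham_vf_nonzero[OF s] c, of "\<tau> s" D] chart_deriv_orbit[OF s D fx] fx[of 0] D unfolding fl by simp
qed

text \<open>
  For \<open>s > 0\<close> the orbit \<open>v s\<close> may pass through the fixed point set of \<open>\<rho>\<^sub>1\<close> at a time other than \<open>0\<close>.
\<close>

definition doubly_symmetric_up_to_shift where
  "doubly_symmetric_up_to_shift s \<theta> \<longleftrightarrow> (\<forall>t. \<rho>\<^sub>1 (v s (- t)) = v s (t + \<theta>)) \<and> (\<forall>t. \<sigma> (v s t) = v s (t + 1/2))"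

text \<open>Both symmetries are followed or preceded by a piece of the flow so as to fix
  \<open>v s 0\<close>: half a period for \<open>\<sigma>\<close>, time \<open>- \<theta>\<close>
  for \<open>\<rho>\<^sub>1\<close>. The relations between the germs \<open>N\<close> and
  \<open>R\<close> then pass to their derivatives by the chain rule, and the matrix lemma
  applies.\<close>

lemma doubly_symmetric_trace:
  assumes s: "s \<in> J" and sym: "doubly_symmetric_up_to_shift s \<theta>" and D: "chart_deriv A c c (flow A (Y s) 1) (v s 0) D"
  shows "0 \<le> trace (matrix D)"
    "\<lbrakk>trace (matrix D) \<le> 0; u \<bullet> grad c (s, snd c (v s 0)) = 0; D u = u\<rbrakk> \<Longrightarrow> \<exists>k. u = k *\<^sub>R ham_vf A \<omega> (H s) (v s 0) c"
proof -
  define p where "p = v s 0"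
  define X where "X = ham_vf A \<omega> (H s) p"
  define g where "g = grad c (s, snd c p)"
  define N where "N q = \<sigma> (flow A (Y s) (1/2) q)" for q
  define R where "R q = flow A (Y s) (- \<theta>) (\<rho>\<^sub>1 q)" for q
  have sym1: "\<rho>\<^sub>1 (v s t) = v s (- t + \<theta>)" and sym2: "\<sigma> (v s t) = v s (t + 1/2)" for t
    using sym[unfolded doubly_symmetric_up_to_shift_def, THEN conjunct1, rule_format, of "-t"] sym unfolding doubly_symmetric_up_to_shift_def by auto
  have c: "c \<in> charts_at A p" using D by (simp add: chart_deriv_def p_def)
  have Nv: "N (v s t) = v s (1 * t)" for t using v_periodic[OF s, of t] by (simp add: N_def flow_v[OF s] sym2 add.commute)
  have Rv: "R (v s t) = v s ((-1) * t)" for t by (simp add: R_def sym1 flow_v[OF s])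
  have fl1: "flow A (Y s) 1 p = p" using flow_v[OF s, of 1 0] v_periodic[OF s, of 0] by (simp add: p_def)
  have Np: "N p = p" and Rp: "R p = p" using Nv[of 0] Rv[of 0] by (auto simp: p_def)
  obtain DN where DN: "chart_deriv A c c N p DN"
  proof -
    obtain c1 where c1: "c1 \<in> charts_at A (v s (0 + 1/2))" using ex_chart by blast
    obtain D1 where D1: "chart_deriv A c c1 (flow A (Y s) (1/2)) p D1"
      using flow_chart_deriv(2)[OF s _ c1, of c] c by (auto simp: p_def)
    obtain c2 where c2: "c2 \<in> charts_at A (\<rho>\<^sub>2 (v s (1/2)))" using ex_chart by blast
    obtain D2 where D2: "chart_deriv A c1 c2 \<rho>\<^sub>2 (v s (1/2)) D2" using involution_chart_deriv[OF \<rho>2 _ c2, of c1] c1 by auto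
    have "\<rho>\<^sub>1 (\<rho>\<^sub>2 (v s (1/2))) = p" using sym2[of "1/2"] v_periodic[OF s, of 0] by (simp add: \<sigma>_def p_def)
    then obtain D3 where D3: "chart_deriv A c2 c \<rho>\<^sub>1 (\<rho>\<^sub>2 (v s (1/2))) D3" using involution_chart_deriv[OF \<rho>1 c2, of c] c by auto
    have f: "flow A (Y s) (1/2) p = v s (1/2)" using flow_v[OF s, of "1/2" 0] by (simp add: p_def)
    show thesis
      using that chart_deriv_compose[OF D1, unfolded f, OF chart_deriv_compose[OF D2 D3]] unfolding N_def[abs_def] \<sigma>_def by blast
  qed
  obtain DR where DR: "chart_deriv A c c R p DR"
  proof -
    have r: "\<rho>\<^sub>1 p = v s \<theta>" using sym1[of 0] by (simp add: p_def)
    obtain c1 where c1: "c1 \<in> charts_at A (\<rho>\<^sub>1 p)" using ex_chart by blast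
    obtain D1 where D1: "chart_deriv A c c1 \<rho>\<^sub>1 p D1" using involution_chart_deriv[OF \<rho>1 c c1] by blast
    have "c \<in> charts_at A (v s (\<theta> + - \<theta>))" using c by (simp add: p_def)
    then obtain D2 where D2: "chart_deriv A c1 c (flow A (Y s) (- \<theta>)) (\<rho>\<^sub>1 p) D2"
      using flow_chart_deriv(2)[OF s, of c1 \<theta> c "- \<theta>"] c1 r by auto
    show thesis using that chart_deriv_compose[OF D1 D2] unfolding R_def[abs_def] by blast
  qed
  have germs: "\<forall>\<^sub>F q in nhds p. N (N q) = flow A (Y s) 1 q \<and> R (R q) = q \<and> N (R (N q)) = R q \<and> H s (N q) = H s q \<and> H s (R q) = H s q"
    \<comment> \<open>The curve is evaluated at the times 0, 1/2, 1, \<theta> and 1/2 +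
      \<theta>.\<close>
    using long_curves[OF s, of "2 + \<bar>\<theta>\<bar>"] unfolding p_def[symmetric]
  proof eventually_elim
    case (elim q)
    then obtain \<gamma> I where \<gamma>: "int_curve A (Y s) \<gamma> I" "\<gamma> 0 = q" "{-(2 + \<bar>\<theta>\<bar>)..2 + \<bar>\<theta>\<bar>} \<subseteq> I" by blast
    have I: "0 \<in> I" "1/2 \<in> I" "1 \<in> I" "\<theta> \<in> I" "1/2 + \<theta> \<in> I" 
    proof -
      have "{0, 1/2, 1, \<theta>, 1/2 + \<theta>} \<subseteq> {-(2 + \<bar>\<theta>\<bar>)..2 + \<bar>\<theta>\<bar>}" by (auto simp: abs_if)
      then show "0 \<in> I" "1/2 \<in> I" "1 \<in> I" "\<theta> \<in> I" "1/2 + \<theta> \<in> I" using \<gamma>(3) by blast+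
    qed
    note fl = flow_along[OF s \<gamma>(1)]
    have Nq: "N q = \<sigma> (\<gamma> (1/2))" using fl(1)[of 0 "1/2"] I \<gamma>(2) by (simp add: N_def)
    have Rq: "R q = \<rho>\<^sub>1 (\<gamma> \<theta>)" using fl(2)[of 0 "- \<theta>"] I \<gamma>(2) by (simp add: R_def)
    have "N (N q) = \<gamma> 1" using fl(4)[of "1/2" "1/2"] I by (simp add: Nq N_def[of "\<sigma> (\<gamma> (1/2))"])
    moreover have "flow A (Y s) 1 q = \<gamma> 1" using fl(1)[of 0 1] I \<gamma>(2) by simp
    moreover have "R (R q) = q" using fl(1)[of \<theta> "- \<theta>"] I \<gamma>(2) by (simp add: Rq R_def[of "\<rho>\<^sub>1 (\<gamma> \<theta>)"])
    moreover have "R (N q) = \<rho>\<^sub>2 (\<gamma> (1/2 + \<theta>))" using fl(3)[of "1/2" "- \<theta>"] I by (simp add: Nq R_def[of "\<sigma> (\<gamma> (1/2))"])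
    then have "N (R (N q)) = R q" using fl(3)[of "1/2 + \<theta>" "1/2"] I by (simp add: Rq N_def[of "\<rho>\<^sub>2 (\<gamma> (1/2 + \<theta>))"])
    moreover have "H s (N q) = H s q" "H s (R q) = H s q"
      using energy_curve[OF s \<gamma>(1)] I \<gamma>(2) by (auto simp: Nq Rq H_sigma[OF s] H_rho[OF s])
    ultimately show ?case by simp
  qed
  have linN: "linear DN" and linR: "linear DR" using DN DR chart_deriv_linear by blast+
  have "chart_deriv A c c (\<lambda>q. N (N q)) p (\<lambda>u. DN (DN u))" using chart_deriv_compose[OF DN, unfolded Np, OF DN] .
  moreover have "chart_deriv A c c (\<lambda>q. N (N q)) p D"
    by (rule chart_deriv_cong[OF D[folded p_def]]) (use germs in \<open>auto elim: eventually_mono\<close>)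
  ultimately have NN: "(\<lambda>u. DN (DN u)) = D" by (rule chart_deriv_unique)
  have "chart_deriv A c c (\<lambda>q. R (R q)) p (\<lambda>u. DR (DR u))" using chart_deriv_compose[OF DR, unfolded Rp, OF DR] .
  moreover have "chart_deriv A c c (\<lambda>q. R (R q)) p (transition c c p)"
    by (rule chart_deriv_cong[OF chart_deriv_id(1)[OF c c]]) (use germs in \<open>auto elim: eventually_mono\<close>)
  ultimately have "(\<lambda>u. DR (DR u)) = transition c c p" by (rule chart_deriv_unique)
  then have RR: "DR (DR u) = u" for u using transition_same[OF c] by metis
  have "chart_deriv A c c (\<lambda>q. N (R (N q))) p (\<lambda>u. DN (DR (DN u)))"
    using chart_deriv_compose[OF chart_deriv_compose[OF DN, unfolded Np, OF DR], unfolded Np Rp, OF DN] .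
  moreover have "chart_deriv A c c (\<lambda>q. N (R (N q))) p DR"
    by (rule chart_deriv_cong[OF DR]) (use germs in \<open>auto elim: eventually_mono\<close>)
  ultimately have NRN: "(\<lambda>u. DN (DR (DN u))) = DR" by (rule chart_deriv_unique)
  have gN: "DN u \<bullet> g = u \<bullet> g" for u
  proof -
    have "\<forall>\<^sub>F q in nhds p. H s (N q) = H s q" using germs by (rule eventually_mono) simp
    from germ_preserves_grad[OF s DN this] show ?thesis by (simp add: g_def Np)
  qed
  have gR: "DR u \<bullet> g = u \<bullet> g" for u
  proof -
    have "\<forall>\<^sub>F q in nhds p. H s (R q) = H s q" using germs by (rule eventually_mono) simp
    from germ_preserves_grad[OF s DR this] show ?thesis by (simp add: g_def Rp)
  qed
  have NX: "DN (X c) = X c" using chart_deriv_orbit[OF s DN[unfolded p_def] Nv] by (simp add: X_def p_def)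
  have RX: "DR (X c) = - X c" using chart_deriv_orbit[OF s DR[unfolded p_def] Rv] by (simp add: X_def p_def)
  have mN: "matrix DN *v u = DN u" and mR: "matrix DR *v u = DR u" for u
    using linN linR by (auto simp: matrix_works)
  have mm: "M = M'" if "\<And>u. M *v u = M' *v u" for M M' :: "real^4^4" using that by (simp add: matrix_eq)
  have XT: "X \<in> tangent_space A p" using ham_vf_tangent[OF s] by (simp add: X_def)
  have X0: "X c \<noteq> 0" using tangent_eqI[OF XT subspace_0[OF subspace_tangent_space] c] ham_vf_nonzero[OF s] by (auto simp: X_def p_def)
  have "dfun A (H s) p X = 0" using ham_vf_dfun[OF s XT] form_self[OF XT] by (simp add: X_def)
  then have Xg: "X c \<bullet> g = 0" using dfun_chart[OF s c XT] by (simp add: g_def)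
  have g0: "g \<bullet> g \<noteq> 0" using grad_nonzero[OF s c] ham_vf_nonzero[OF s] by (simp add: g_def p_def)
  have lin: "linear (\<lambda>u. u \<bullet> g)" by (rule bounded_linear.linear[OF bounded_linear_inner_left])
  have DD: "matrix DN ** matrix DN = matrix D"
    using matrix_compose[OF linN linN] NN by (simp add: o_def)
  note rev = reversible_square_trace[OF lin X0 Xg g0, of "matrix DN" "matrix DR"]
  have A1: "matrix DN *v X c = X c" "\<And>u. (matrix DN *v u) \<bullet> g = u \<bullet> g" "matrix DR *v X c = - X c" "\<And>u. (matrix DR *v u) \<bullet> g = u \<bullet> g"
    by (simp_all add: mN mR NX RX gN gR)
  have A2: "matrix DR ** matrix DR = mat 1" by (rule mm) (simp add: matrix_vector_mul_assoc[symmetric] mR RR)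
  have A3: "matrix DN ** matrix DR ** matrix DN = matrix DR"
    by (rule mm) (use fun_cong[OF NRN] in \<open>simp add: matrix_vector_mul_assoc[symmetric] mR mN\<close>)
  show "0 \<le> trace (matrix D)" using rev(1)[OF A1 A2 A3] DD by simp
  assume a: "trace (matrix D) \<le> 0" "u \<bullet> grad c (s, snd c (v s 0)) = 0" "D u = u"
  have "(matrix DN ** matrix DN) *v u = u"
    using fun_cong[OF NN, of u] a(3) by (simp add: matrix_vector_mul_assoc[symmetric] mN)
  with a(1,2) show "\<exists>k. u = k *\<^sub>R ham_vf A \<omega> (H s) (v s 0) c"
    using rev(2)[OF A1 A2 A3, of u] by (simp add: DD g_def p_def X_def)
qed


section \<open>Inheritance of the symmetry by the limit orbit\<close>

lemma v_isCont: "s \<in> J \<Longrightarrow> isCont (\<lambda>z. v (fst z) (snd z)) (s, t)"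
proof -
  assume s: "s \<in> J"
  have "continuous_on (J \<times> UNIV) (\<lambda>z. v (fst z) (snd z))"
    using v_smooth unfolding smooth_curve_family_def by (simp add: case_prod_beta')
  then show ?thesis using s J_open by (simp add: continuous_on_eq_continuous_at open_Times)
qed

lemma v_isCont_left: "s \<in> J \<Longrightarrow> isCont (\<lambda>s. v s t) s"
  using isCont_o2[of s "\<lambda>s. (s, t)" "\<lambda>z. v (fst z) (snd z)"] v_isCont by simp

lemma rho_isCont: "isCont \<rho>\<^sub>1 q" "isCont \<rho>\<^sub>2 q" "isCont \<sigma> q"
proof -
  show 1: "isCont \<rho>\<^sub>1 q" for q using \<rho>1 unfolding antisymplectic_involution_def smooth_map_def
    by (simp add: continuous_on_eq_continuous_at)
  show "isCont \<rho>\<^sub>2 q" using \<rho>2 unfolding antisymplectic_involution_def smooth_map_def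
    by (simp add: continuous_on_eq_continuous_at)
  from isCont_o2[OF this 1] show "isCont \<sigma> q" by (simp add: \<sigma>_def[abs_def])
qed

text \<open>Both sides are integral curves in \<open>t\<close>, since \<sigma> keeps the direction
  of time; agreement at one time is enough.\<close>

lemma sigma_orbit:
  assumes s: "s \<in> J" and 0: "\<sigma> (v s t0) = v s (t0 + b)"
  shows "\<sigma> (v s t) = v s (t + b)"
proof -
  have 1: "int_curve A (Y s) (\<lambda>r. \<sigma> (v s r)) UNIV" using int_curve_sigma[OF s v_int_curve[OF s], of 0] by simp
  have 2: "int_curve A (Y s) (\<lambda>r. v s (r + b)) UNIV" using field.int_curve_shift[OF v_int_curve[OF s], of b] by (simp add: range_diff_real)
  show ?thesis using field.int_curve_unique[OF s 1 2, of t0 t] 0 by simp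
qed

text \<open>The symmetry equations are closed conditions on the orbit, because limits are unique,
  and no shift appears in the limit.\<close>

lemma symmetric_at_limit:
  assumes s0: "s0 \<in> J" and ev: "\<forall>\<^sub>F s in at_left s0. doubly_symmetric_orbit \<rho>\<^sub>1 \<rho>\<^sub>2 (v s)"
  shows "doubly_symmetric_up_to_shift s0 0"
  unfolding doubly_symmetric_up_to_shift_def
proof (intro conjI allI)
  have lim: "((\<lambda>s. v s t) \<longlongrightarrow> v s0 t) (at_left s0)" for t
    using v_isCont_left[OF s0, of t] unfolding isCont_def by (rule filterlim_mono) (auto simp: at_le)
  have r1: "\<rho>\<^sub>1 (v s0 (- t)) = v s0 t" for t
  proof (rule tendsto_unique)
    show "((\<lambda>s. \<rho>\<^sub>1 (v s (- t))) \<longlongrightarrow> \<rho>\<^sub>1 (v s0 (- t))) (at_left s0)"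
      by (rule isCont_tendsto_compose[OF rho_isCont(1) lim])
    have "\<forall>\<^sub>F s in at_left s0. v s t = \<rho>\<^sub>1 (v s (- t))"
      using ev by eventually_elim (simp add: doubly_symmetric_orbit_def symmetric_orbit_def)
    with lim show "((\<lambda>s. \<rho>\<^sub>1 (v s (- t))) \<longlongrightarrow> v s0 t) (at_left s0)" by (rule Lim_transform_eventually)
  qed simp
  then show "\<rho>\<^sub>1 (v s0 (- t)) = v s0 (t + 0)" for t by simp
  have "\<rho>\<^sub>2 (v s0 0) = v s0 (1/2)"
  proof (rule tendsto_unique)
    show "((\<lambda>s. \<rho>\<^sub>2 (v s 0)) \<longlongrightarrow> \<rho>\<^sub>2 (v s0 0)) (at_left s0)"
      by (rule isCont_tendsto_compose[OF rho_isCont(2) lim])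
    have "\<forall>\<^sub>F s in at_left s0. v s (1/2) = \<rho>\<^sub>2 (v s 0)"
      using ev by eventually_elim (simp add: doubly_symmetric_orbit_def)
    with lim show "((\<lambda>s. \<rho>\<^sub>2 (v s 0)) \<longlongrightarrow> v s0 (1/2)) (at_left s0)" by (rule Lim_transform_eventually)
  qed simp
  \<comment> \<open>\<open>\<rho>\<^sub>1\<close> takes the point at time 1/2 to the one at time
    -1/2, which is the same point by periodicity.\<close>
  then have "\<sigma> (v s0 0) = v s0 (- (1/2))" using r1[of "- (1/2)"] by (simp add: \<sigma>_def)
  also have "\<dots> = v s0 (0 + 1/2)" using v_periodic[OF s0, of "-(1/2)"] by simp
  finally show "\<sigma> (v s0 t) = v s0 (t + 1/2)" for t by (rule sigma_orbit[OF s0])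
qed

section \<open>Isolation of the orbit on its energy level\<close>

lemma H_param_diff:
  assumes c: "c \<in> A" "s \<in> J" "x \<in> chart_image c"
  shows "param_diff (\<lambda>s x. H s (chart_inv c x)) s x (\<lambda>u. u \<bullet> grad c (s, x))"
proof -
  define S where "S = J \<times> chart_image c"
  have S: "open S" "(s, x) \<in> S" using c open_Times[OF J_open chart_open(2)[OF c(1)]] by (auto simp: S_def)
  note C1 = smooth_on_imp_C1_on[OF H_in_chart_smooth[OF c(1)], folded S_def]
  obtain h' where h0: "continuous_on S h'"
    "\<And>z. z \<in> S \<Longrightarrow> ((\<lambda>x. H_in_chart c (fst z, x)) has_derivative blinfun_apply (h' z)) (at (snd z))"
    using C1_on_partial[OF C1] by blast
  note h' = h0[unfolded H_in_chart_def fst_conv snd_conv]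
  have "isCont (H_in_chart c) (s, x)" using C1_on_cont[OF C1] S by (simp add: continuous_on_eq_continuous_at)
  then have "isCont (\<lambda>s. H s (chart_inv c x)) s"
    using isCont_o2[of s "\<lambda>s. (s, x)" "H_in_chart c"] by (simp add: H_in_chart_def)
  from param_diff_C1[OF S h'(1) this h'(2)]
  have "param_diff (\<lambda>s x. H s (chart_inv c x)) s x (blinfun_apply (h' (s, x)))" .
  moreover have "blinfun_apply (h' (s, x)) = (\<lambda>u. u \<bullet> grad c (s, x))"
    using has_derivative_unique[OF h'(2)[OF S(2)]] H_chart_grad[OF c] by simp
  ultimately show ?thesis by simp
qed

text \<open>
  The section transverse to the flow is the affine hyperplane orthogonal to the Hamiltonian vector
  field in the chart.
\<close>

lemma isolated_orbit:
  assumes s0: "s0 \<in> J" and c: "c \<in> charts_at A (v s0 0)"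
    and D: "chart_param_diff A c c (\<lambda>s. flow A (Y s) 1) s0 (v s0 0) D"
    and nondeg: "\<And>u. \<lbrakk>u \<bullet> grad c (s0, snd c (v s0 0)) = 0; D u = u\<rbrakk> \<Longrightarrow> \<exists>k. u = k *\<^sub>R ham_vf A \<omega> (H s0) (v s0 0) c"
  obtains r where "r > 0" "\<And>s p q. \<lbrakk>dist s s0 < r; p \<in> fst c; q \<in> fst c; dist (snd c p) (snd c (v s0 0)) < r;
      dist (snd c q) (snd c (v s0 0)) < r; flow A (Y s) 1 p = p; flow A (Y s) 1 q = q; H s p = H s q;
      (snd c p - snd c q) \<bullet> ham_vf A \<omega> (H s0) (v s0 0) c = 0\<rbrakk> \<Longrightarrow> p = q"
proof -
  note m = charts_atD[OF c]
  define x0 where "x0 = snd c (v s0 0)"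
  define X where "X = ham_vf A \<omega> (H s0) (v s0 0) c"
  define g where "g = grad c (s0, x0)"
  have X0: "X \<noteq> 0"
    using tangent_eqI[OF ham_vf_tangent[OF s0] subspace_0[OF subspace_tangent_space] c] ham_vf_nonzero[OF s0] by (auto simp: X_def)
  have pd: "param_diff (\<lambda>s x. snd c (flow A (Y s) 1 (chart_inv c x))) s0 x0 D"
    using D by (simp add: chart_param_diff_def x0_def)
  have ph: "param_diff (\<lambda>s x. H s (chart_inv c x)) s0 x0 (\<lambda>u. u \<bullet> g)"
    unfolding g_def by (rule H_param_diff[OF m(1) s0]) (use m in \<open>simp add: x0_def\<close>)
  have linD: "linear D" using pd by (simp add: param_diff_def bounded_linear.linear)
  \<comment> \<open>The components test whether \<open>u\<close> is fixed, tangent to the energy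
    level and tangent to the section. By \<open>nondeg\<close> the first two leave only multiples of
    \<open>X\<close>, which the third excludes.\<close>
  define T where "T u = (D u - u, u \<bullet> g, u \<bullet> X)" for u
  have linT: "linear T"
    by (rule linearI) (auto simp: T_def linear_add[OF linD] linear_scale[OF linD] inner_add_left algebra_simps)
  have "u = 0" if "T u = 0" for u
  proof -
    have u: "u \<bullet> g = 0" "D u = u" "u \<bullet> X = 0" using that by (auto simp: T_def zero_prod_def)
    then obtain k where "u = k *\<^sub>R X" using nondeg by (auto simp: g_def x0_def X_def)
    then show ?thesis using u(3) X0 by simp
  qed
  then have "inj T" using linT by (simp add: linear_injective_0)
  then obtain K where K: "K > 0" "\<And>u. K * norm u \<le> norm (T u)" using linear_inj_bounded_below_pos[OF linT] by metis
  \<comment> \<open>The errors of the period map and of the energy add up to two thirds of the lower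
    bound \<open>K\<close>, which forces the difference to vanish.\<close>
  have e: "K / 3 > 0" using K by simp
  obtain r1 where r1: "r1 > 0" "\<And>s x y. \<lbrakk>dist s s0 < r1; dist x x0 < r1; dist y x0 < r1\<rbrakk> \<Longrightarrow>
     norm (snd c (flow A (Y s) 1 (chart_inv c x)) - snd c (flow A (Y s) 1 (chart_inv c y)) - D (x - y)) \<le> K / 3 * norm (x - y)"
    using param_diffD[OF pd e] by metis
  obtain r2 where r2: "r2 > 0" "\<And>s x y. \<lbrakk>dist s s0 < r2; dist x x0 < r2; dist y x0 < r2\<rbrakk> \<Longrightarrow>
     norm (H s (chart_inv c x) - H s (chart_inv c y) - (x - y) \<bullet> g) \<le> K / 3 * norm (x - y)"
    using param_diffD[OF ph e] by metis
  show thesis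
  proof (rule that[of "min r1 r2"])
    show "min r1 r2 > 0" using r1 r2 by simp
    fix s p q
    assume s: "dist s s0 < min r1 r2" and pq: "p \<in> fst c" "q \<in> fst c" "dist (snd c p) (snd c (v s0 0)) < min r1 r2"
      "dist (snd c q) (snd c (v s0 0)) < min r1 r2" "flow A (Y s) 1 p = p" "flow A (Y s) 1 q = q" "H s p = H s q"
      "(snd c p - snd c q) \<bullet> ham_vf A \<omega> (H s0) (v s0 0) c = 0"
    define u where "u = snd c p - snd c q"
    have uX: "u \<bullet> X = 0" using pq by (simp add: u_def X_def)
    have 1: "norm (D u - u) \<le> K / 3 * norm u"
      using r1(2)[of s "snd c p" "snd c q"] s pq m by (simp add: u_def x0_def norm_minus_commute)
    have 2: "norm (u \<bullet> g) \<le> K / 3 * norm u"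
      using r2(2)[of s "snd c p" "snd c q"] s pq m by (simp add: u_def x0_def)
    have "norm (T u) \<le> norm (D u - u) + norm (u \<bullet> g, u \<bullet> X)" unfolding T_def by (rule norm_Pair_le)
    also have "norm (u \<bullet> g, u \<bullet> X) = norm (u \<bullet> g)" using uX by (simp add: norm_Pair)
    finally have "K * norm u \<le> K / 3 * norm u + K / 3 * norm u" using K(2)[of u] 1 2 by linarith
    then have "norm u = 0" using K(1) by (simp add: algebra_simps)
    then have "snd c p = snd c q" by (simp add: u_def)
    then show "p = q" using pq m inv_chart by metis
  qed
qed

text \<open>\<open>w\<close> is meant to be the image of the orbits under a symmetry. For
  \<open>s\<close> near \<open>s0\<close> it crosses the section through \<open>v s 0\<close> at
  some time close to 0; the crossing point and \<open>v s 0\<close> are fixed points of the period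
  map with equal energy, hence equal, and uniqueness identifies the curves.\<close>

lemma nearby_orbit_reparametrized:
  assumes s0: "s0 \<in> J" and c: "c \<in> charts_at A (v s0 0)"
    and D: "chart_param_diff A c c (\<lambda>s. flow A (Y s) 1) s0 (v s0 0) D"
    and nondeg: "\<And>u. \<lbrakk>u \<bullet> grad c (s0, snd c (v s0 0)) = 0; D u = u\<rbrakk> \<Longrightarrow> \<exists>k. u = k *\<^sub>R ham_vf A \<omega> (H s0) (v s0 0) c"
    and wc: "\<And>s t. s \<in> J \<Longrightarrow> isCont (\<lambda>z. w (fst z) (snd z)) (s, t)" and w0: "\<And>t. w s0 t = v s0 t"
    and w: "\<And>s. s \<in> J \<Longrightarrow> int_curve A (Y s) (w s) UNIV" "\<And>s t. s \<in> J \<Longrightarrow> w s (t + 1) = w s t"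
      "\<And>s t. s \<in> J \<Longrightarrow> H s (w s t) = H s (v s 0)"
    and \<beta>: "\<beta> > 0"
  shows "\<forall>\<^sub>F s in nhds s0. \<exists>b. \<bar>b\<bar> < \<beta> \<and> (\<forall>t. w s (t + b) = v s t)"
proof -
  note m = charts_atD[OF c]
  define x0 where "x0 = snd c (v s0 0)"
  define X where "X = ham_vf A \<omega> (H s0) (v s0 0) c"
  have X0: "X \<noteq> 0"
    using tangent_eqI[OF ham_vf_tangent[OF s0] subspace_0[OF subspace_tangent_space] c] ham_vf_nonzero[OF s0] by (auto simp: X_def)
  obtain r where r: "r > 0" "\<And>s p q. \<lbrakk>dist s s0 < r; p \<in> fst c; q \<in> fst c; dist (snd c p) x0 < r;
      dist (snd c q) x0 < r; flow A (Y s) 1 p = p; flow A (Y s) 1 q = q; H s p = H s q;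
      (snd c p - snd c q) \<bullet> X = 0\<rbrakk> \<Longrightarrow> p = q"
    apply (rule isolated_orbit[OF s0 c D, folded x0_def X_def])
     apply (rule nondeg[folded x0_def X_def]; assumption)
    apply (rule that; assumption)
    done
  have near: "\<forall>\<^sub>F z in nhds (s0, 0). u (fst z) (snd z) \<in> fst c \<and> dist (snd c (u (fst z) (snd z))) x0 < r"
    if "isCont (\<lambda>z. u (fst z) (snd z)) (s0, 0)" "u s0 0 = v s0 0" for u :: "real \<Rightarrow> real \<Rightarrow> 'a"
  proof -
    have "\<forall>\<^sub>F z in nhds (s0, 0). u (fst z) (snd z) \<in> fst c" using that chart_open m by (intro isCont_eventually_in_open) auto
    moreover have "isCont (\<lambda>z. snd c (u (fst z) (snd z))) (s0, 0)"
      by (rule isCont_o2[OF that(1)]) (use isCont_chart m that(2) in simp)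
    then have "\<forall>\<^sub>F z in nhds (s0, 0). snd c (u (fst z) (snd z)) \<in> ball x0 r"
      by (rule isCont_eventually_in_open) (use r that(2) in \<open>auto simp: x0_def\<close>)
    ultimately show ?thesis by eventually_elim (auto simp: dist_commute)
  qed
  have "\<forall>\<^sub>F z in nhds (s0, 0::real). z \<in> J \<times> UNIV"
    using open_Times[OF J_open open_UNIV] s0 by (intro eventually_nhds_in_open) auto
  then have "\<forall>\<^sub>F z in nhds (s0, 0::real). fst z \<in> J" by (rule eventually_mono) auto
  from eventually_conj[OF this eventually_conj[OF near[OF wc[OF s0] w0] near[OF v_isCont[OF s0] refl]]]
  obtain d where d: "d > 0" "\<And>s t. dist (s, t) (s0, 0) < d \<Longrightarrow> s \<in> J \<and> w s t \<in> fst c \<and> dist (snd c (w s t)) x0 < r \<and>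
      v s t \<in> fst c \<and> dist (snd c (v s t)) x0 < r"
    unfolding eventually_nhds_metric by auto
  have dst: "s \<in> J \<and> w s t \<in> fst c \<and> dist (snd c (w s t)) x0 < r \<and> v s t \<in> fst c \<and> dist (snd c (v s t)) x0 < r"
    if "dist s s0 < d / 2" "\<bar>t\<bar> < d / 2" for s t
  proof -
    have "dist (s, t) (s0, 0) \<le> dist s s0 + dist t 0" unfolding dist_Pair_Pair by (rule sqrt_sum_squares_le_sum_abs[THEN order_trans]) auto
    then show ?thesis using d(2)[of s t] that by auto
  qed
  \<comment> \<open>Signed position of \<open>w s t\<close> relative to the section through
    \<open>v s 0\<close>. At \<open>s0\<close> it increases through 0, with derivative
    \<open>\<tau> s0 * (X \<bullet> X)\<close>.\<close>
  define k where "k s t = (snd c (w s t) - snd c (v s 0)) \<bullet> X" for s t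
  have k0: "k s0 0 = 0" by (simp add: k_def w0)
  have "((\<lambda>t. snd c (w s0 t)) has_vector_derivative \<tau> s0 *\<^sub>R X) (at 0)"
    using has_velocityD(3)[of "w s0" "Y s0 (w s0 0)" 0 c] w(1)[OF s0] c
    by (simp add: int_curve_def w0 Y_def X_def scaleR_fun_def)
  from bounded_linear.has_vector_derivative[OF bounded_linear_inner_left has_vector_derivative_diff[OF this has_vector_derivative_const], of "snd c (v s0 0)" X]
  have dk: "DERIV (k s0) 0 :> \<tau> s0 * (X \<bullet> X)"
    by (simp add: k_def[abs_def] has_real_derivative_iff_has_vector_derivative)
  have pos: "\<tau> s0 * (X \<bullet> X) > 0" using tau_pos[OF s0] X0 by simp
  obtain d1 where d1: "d1 > 0" "\<And>h. 0 < h \<Longrightarrow> h < d1 \<Longrightarrow> k s0 0 < k s0 (0 + h)" using DERIV_pos_inc_right[OF dk pos] by blast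
  obtain d2 where d2: "d2 > 0" "\<And>h. 0 < h \<Longrightarrow> h < d2 \<Longrightarrow> k s0 (0 - h) < k s0 0" using DERIV_pos_inc_left[OF dk pos] by blast
  \<comment> \<open>Small enough for the signs at both ends, for staying in the chart, and for the
    bound \<open>\<beta>\<close> on the shift.\<close>
  define b where "b = Min {d1, d2, d / 2, \<beta>} / 2"
  have b: "b > 0" "b < d1" "b < d2" "b < d / 2" "b < \<beta>"
  proof -
    have "Min {d1, d2, d / 2, \<beta>} > 0" using d1 d2 d \<beta> by simp
    moreover have "Min {d1, d2, d / 2, \<beta>} \<le> x" if "x \<in> {d1, d2, d / 2, \<beta>}" for x using that by (intro Min_le) auto
    from this[of d1] this[of d2] this[of "d / 2"] this[of \<beta>]
    have "Min {d1, d2, d / 2, \<beta>} \<le> d1" "Min {d1, d2, d / 2, \<beta>} \<le> d2" "Min {d1, d2, d / 2, \<beta>} \<le> d / 2" "Min {d1, d2, d / 2, \<beta>} \<le> \<beta>" by auto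
    ultimately show "b > 0" "b < d1" "b < d2" "b < d / 2" "b < \<beta>" unfolding b_def by linarith+
  qed
  have kpm: "k s0 b > 0" "k s0 (- b) < 0" using d1(2)[of b] d2(2)[of b] b k0 by auto
  have kc: "isCont (\<lambda>s. k s t) s0" if t: "\<bar>t\<bar> < d / 2" for t
  proof -
    have "isCont (\<lambda>s. w s t) s0" using isCont_o2[of s0 "\<lambda>s. (s, t)" "\<lambda>z. w (fst z) (snd z)"] wc[OF s0] by simp
    then have "isCont (\<lambda>s. snd c (w s t)) s0" by (rule isCont_o2) (use isCont_chart m dst[of s0 t] t d in auto)
    moreover have "isCont (\<lambda>s. snd c (v s 0)) s0"
      by (rule isCont_o2[OF v_isCont_left[OF s0]]) (use isCont_chart m in auto)
    ultimately show ?thesis unfolding k_def by (intro continuous_intros)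
  qed
  \<comment> \<open>The opposite signs at \<open>b\<close> and \<open>- b\<close> persist for nearby
    parameters, so the intermediate value theorem gives a crossing.\<close>
  have "\<forall>\<^sub>F s in nhds s0. k s b \<in> {0<..}" by (rule isCont_eventually_in_open[OF kc]) (use b kpm in auto)
  moreover have "\<forall>\<^sub>F s in nhds s0. k s (- b) \<in> {..<0}" by (rule isCont_eventually_in_open[OF kc]) (use b kpm in auto)
  moreover have "\<forall>\<^sub>F s in nhds s0. dist s s0 < min r (d / 2)" unfolding eventually_nhds_metric
    using r(1) d(1) by (intro exI[of _ "min r (d / 2)"]) auto
  ultimately show ?thesis
  proof eventually_elim
    case (elim s)
    have sd: "dist s s0 < d / 2" and sr: "dist s s0 < r" using elim by auto
    have sJ: "s \<in> J" using dst[OF sd, of 0] d by simp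
    have "continuous_on {-b..b} (k s)"
    proof (intro continuous_at_imp_continuous_on ballI)
      fix t assume "t \<in> {-b..b}"
      then have t: "\<bar>t\<bar> < d / 2" using b by auto
      have "isCont (w s) t" using w(1)[OF sJ] by (auto simp: int_curve_def dest: has_velocityD(2))
      then have "isCont (\<lambda>t. snd c (w s t)) t" by (rule isCont_o2) (use isCont_chart m dst[OF sd t] in auto)
      then show "isCont (k s) t" unfolding k_def[abs_def] by (intro continuous_intros)
    qed
    then obtain t where t: "-b \<le> t" "t \<le> b" "k s t = 0" using IVT'[of "k s" "-b" 0 b] elim b by auto
    have td: "\<bar>t\<bar> < d / 2" "\<bar>t\<bar> < \<beta>" using t b by auto
    have "w s t = v s 0"
    proof (rule r(2)[OF sr])
      show "flow A (Y s) 1 (w s t) = w s t" using flow_along(1)[OF sJ w(1)[OF sJ], of t 1] w(2)[OF sJ] by simp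
      show "flow A (Y s) 1 (v s 0) = v s 0" using flow_v[OF sJ, of 1 0] v_periodic[OF sJ, of 0] by simp
      show "(snd c (w s t) - snd c (v s 0)) \<bullet> X = 0" using t(3) by (simp add: k_def)
    qed (use dst[OF sd td(1)] dst[OF sd, of 0] d w(3)[OF sJ] in auto)
    moreover have "int_curve A (Y s) (\<lambda>r. w s (r + t)) UNIV" using field.int_curve_shift[OF w(1)[OF sJ], of t] by (simp add: range_diff_real)
    ultimately have "\<forall>r. w s (r + t) = v s r" using field.int_curve_unique[OF sJ _ v_int_curve[OF sJ], of "\<lambda>r. w s (r + t)" 0] by simp
    then show ?case using td(2) by blast
  qed
qed

text \<open>The images of \<open>v s\<close> under \<open>\<rho>\<^sub>1\<close>, with time
  reversed, and under \<sigma>, moved back by half a period, are closed orbits near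
  \<open>v s\<close>, hence shifts of it. The shift for \<open>\<rho>\<^sub>1\<close> is free and
  becomes \<theta>; the one for \<sigma> has to vanish because \<sigma> is an involution.\<close>

lemma eventually_doubly_symmetric:
  assumes s0: "s0 \<in> J" and sym: "doubly_symmetric_up_to_shift s0 0" and c: "c \<in> charts_at A (v s0 0)"
    and D: "chart_param_diff A c c (\<lambda>s. flow A (Y s) 1) s0 (v s0 0) D"
    and nondeg: "\<And>u. \<lbrakk>u \<bullet> grad c (s0, snd c (v s0 0)) = 0; D u = u\<rbrakk> \<Longrightarrow> \<exists>k. u = k *\<^sub>R ham_vf A \<omega> (H s0) (v s0 0) c"
  shows "\<forall>\<^sub>F s in nhds s0. \<exists>\<theta>. doubly_symmetric_up_to_shift s \<theta>"
proof -
  have s1: "\<rho>\<^sub>1 (v s0 (- t)) = v s0 t" and s2: "\<sigma> (v s0 t) = v s0 (t + 1/2)" for t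
    using sym by (auto simp: doubly_symmetric_up_to_shift_def)
  have e1: "\<forall>\<^sub>F s in nhds s0. \<exists>b. \<bar>b\<bar> < 1/4 \<and> (\<forall>t. \<rho>\<^sub>1 (v s (0 - (t + b))) = v s t)"
  proof (rule nearby_orbit_reparametrized[OF s0 c D nondeg])
    fix s t :: real assume s: "s \<in> J"
    have "isCont (\<lambda>z. (fst z, 0 - snd z)) (s, t)"
      unfolding isCont_def by (intro tendsto_intros)
    then have "isCont (\<lambda>z. v (fst z) (0 - snd z)) (s, t)"
      using isCont_o2[of "(s, t)" "\<lambda>z. (fst z, 0 - snd z)" "\<lambda>z. v (fst z) (snd z)"] v_isCont[OF s] by simp
    then show "isCont (\<lambda>z. \<rho>\<^sub>1 (v (fst z) (0 - snd z))) (s, t)" by (rule isCont_o2) (rule rho_isCont)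
    show "int_curve A (Y s) (\<lambda>t. \<rho>\<^sub>1 (v s (0 - t))) UNIV" using int_curve_rho(1)[OF s v_int_curve[OF s], of 0] by (simp only: range_diff_real)
    show "\<rho>\<^sub>1 (v s (0 - (t + 1))) = \<rho>\<^sub>1 (v s (0 - t))" using v_periodic[OF s, of "0 - (t + 1)"] by simp
    show "H s (\<rho>\<^sub>1 (v s (0 - t))) = H s (v s 0)" unfolding H_rho[OF s] by (rule energy_v[OF s])
  qed (use s1 in auto)
  have e2: "\<forall>\<^sub>F s in nhds s0. \<exists>b. \<bar>b\<bar> < 1/4 \<and> (\<forall>t. \<sigma> (v s ((t + b) + - (1/2))) = v s t)"
  proof (rule nearby_orbit_reparametrized[OF s0 c D nondeg])
    fix s t :: real assume s: "s \<in> J"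
    have "isCont (\<lambda>z. (fst z, snd z + - (1/2))) (s, t)"
      unfolding isCont_def by (intro tendsto_intros)
    then have "isCont (\<lambda>z. v (fst z) (snd z + - (1/2))) (s, t)"
      using isCont_o2[of "(s, t)" "\<lambda>z. (fst z, snd z + - (1/2))" "\<lambda>z. v (fst z) (snd z)"] v_isCont[OF s] by simp
    then show "isCont (\<lambda>z. \<sigma> (v (fst z) (snd z + - (1/2)))) (s, t)" by (rule isCont_o2) (rule rho_isCont)
    show "int_curve A (Y s) (\<lambda>t. \<sigma> (v s (t + - (1/2)))) UNIV" using int_curve_sigma[OF s v_int_curve[OF s], of "- (1/2)"] by (simp only: range_diff_real)
    show "\<sigma> (v s (t + 1 + - (1/2))) = \<sigma> (v s (t + - (1/2)))" using v_periodic[OF s, of "t + - (1/2)"] by (simp add: algebra_simps)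
    show "H s (\<sigma> (v s (t + - (1/2)))) = H s (v s 0)" unfolding H_sigma[OF s] by (rule energy_v[OF s])
  qed (use s2 in auto)
  have "\<forall>\<^sub>F s in nhds s0. s \<in> J" using J_open s0 by (rule eventually_nhds_in_open)
  with e1 e2 show ?thesis
  proof eventually_elim
    case (elim s)
    obtain b1 where b1: "\<And>t. \<rho>\<^sub>1 (v s (0 - (t + b1))) = v s t" using elim(1) by blast
    obtain b2 where b2: "\<bar>b2\<bar> < 1/4" "\<And>t. \<sigma> (v s ((t + b2) + - (1/2))) = v s t" using elim(2) by blast
    have sg: "\<sigma> (v s t) = v s (t + 1/2 - b2)" for t using b2(2)[of "t + 1/2 - b2"] by simp
    \<comment> \<open>Applying \<sigma> twice shows that \<open>2 * b2\<close> is an integer; the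
      bound 1/4 on the shift leaves only 0.\<close>
    have "v s 0 = v s (1 - 2 * b2)" using sg[of 0] sg[of "1/2 - b2"] sigma_simps(1)[of "v s 0"] by simp
    from v_simple[OF elim(3) this] have "- 1 + 2 * b2 \<in> \<int>" by simp
    then have "1 + (- 1 + 2 * b2) \<in> \<int>" by (intro Ints_add) auto
    then obtain n where n: "2 * b2 = of_int n" by (auto elim: Ints_cases)
    have "\<bar>of_int n :: real\<bar> < 1" using b2(1) unfolding n[symmetric] by simp
    then have "n = 0" by linarith
    then have "b2 = 0" using n by simp
    moreover have "\<rho>\<^sub>1 (v s (- t)) = v s (t + - b1)" for t using b1[of "t - b1"] by simp
    ultimately have "doubly_symmetric_up_to_shift s (- b1)" using sg by (simp add: doubly_symmetric_up_to_shift_def)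
    then show ?case by blast
  qed
qed

text \<open>One chart around \<open>v s0 0\<close> serves all nearby parameters, so the derivatives
  at the moving points \<open>v s 0\<close> are comparable, and strict differentiability makes them
  converge.\<close>

lemma trace_limit:
  assumes s0: "s0 \<in> J" and c: "c \<in> charts_at A (v s0 0)"
    and D: "chart_param_diff A c c (\<lambda>s. flow A (Y s) 1) s0 (v s0 0) D"
  shows "((\<lambda>s. monodromy_trace A \<omega> (H s) (v s) (\<tau> s)) \<longlongrightarrow> trace (matrix D) - 2) (nhds s0)"
proof -
  note m = charts_atD[OF c]
  define D' where "D' s = (SOME D. chart_deriv A c c (flow A (Y s) 1) (v s 0) D)" for s
  have ct: "isCont (\<lambda>s. v s 0) s0" by (rule v_isCont_left[OF s0])
  have "\<forall>\<^sub>F s in nhds s0. v s 0 \<in> fst c" using ct chart_open m by (intro isCont_eventually_in_open) auto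
  moreover have "\<forall>\<^sub>F s in nhds s0. s \<in> J" using J_open s0 by (rule eventually_nhds_in_open)
  ultimately have ev: "\<forall>\<^sub>F s in nhds s0. s \<in> J \<and> chart_deriv A c c (flow A (Y s) 1) (v s 0) (D' s)"
  proof eventually_elim
    case (elim s)
    have "c \<in> charts_at A (v s 0)" using elim m by (simp add: chart_atI)
    moreover have "v s (0 + 1) = v s 0" by (rule v_periodic[OF elim(2)])
    ultimately have "\<exists>D. chart_deriv A c c (flow A (Y s) 1) (v s 0) D"
      using flow_chart_deriv(2)[OF elim(2), of c 0 c 1] by simp
    from someI_ex[OF this] show ?case using elim(2) by (simp add: D'_def)
  qed
  have pd: "param_diff (\<lambda>s x. snd c (flow A (Y s) 1 (chart_inv c x))) s0 (snd c (v s0 0)) D"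
    using D by (simp add: chart_param_diff_def)
  have "isCont (\<lambda>s. snd c (v s 0)) s0" by (rule isCont_o2[OF ct]) (use isCont_chart m in auto)
  then have xs: "((\<lambda>s. snd c (v s 0)) \<longlongrightarrow> snd c (v s0 0)) (nhds s0)" by (simp add: continuous_at tendsto_nhds_iff)
  have dv: "\<forall>\<^sub>F s in nhds s0. ((\<lambda>x. snd c (flow A (Y s) 1 (chart_inv c x))) has_derivative D' s) (at (snd c (v s 0)))"
    using ev by eventually_elim (simp add: chart_deriv_def)
  have lim: "((\<lambda>s. D' s u) \<longlongrightarrow> D u) (nhds s0)" for u
    by (rule param_diff_derivative_tendsto[OF pd filterlim_ident xs dv])
  have "((\<lambda>s. trace (matrix (D' s)) - 2) \<longlongrightarrow> trace (matrix D) - 2) (nhds s0)"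
    unfolding trace_def matrix_def by (simp, intro tendsto_intros lim)
  moreover have "\<forall>\<^sub>F s in nhds s0. trace (matrix (D' s)) - 2 = monodromy_trace A \<omega> (H s) (v s) (\<tau> s)"
    using ev
  proof eventually_elim
    case (elim s)
    then show ?case using monodromy_trace_flow[of s c "D' s"] by simp
  qed
  ultimately show ?thesis by (rule Lim_transform_eventually)
qed

theorem no_period_doubling:
  assumes s0: "s0 \<in> J" and sym: "\<forall>\<^sub>F s in at_left s0. doubly_symmetric_orbit \<rho>\<^sub>1 \<rho>\<^sub>2 (v s)"
    and neg: "\<forall>\<^sub>F s in at_right s0. negative_hyperbolic_orbit A \<omega> (H s) (v s) (\<tau> s)"
  shows False
proof -
  obtain c where c: "c \<in> charts_at A (v s0 0)" using ex_chart by blast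
  have "c \<in> charts_at A (v s0 (0 + 1))" using c v_periodic[OF s0, of 0] by simp
  then obtain D where D: "chart_param_diff A c c (\<lambda>s. flow A (Y s) 1) s0 (v s0 0) D"
    using flow_chart_deriv(1)[OF s0 c] by blast
  have D0: "chart_deriv A c c (flow A (Y s0) 1) (v s0 0) D" by (rule chart_param_diff_chart_deriv[OF D])
  have S0: "doubly_symmetric_up_to_shift s0 0" by (rule symmetric_at_limit[OF s0 sym])
  have lim: "((\<lambda>s. monodromy_trace A \<omega> (H s) (v s) (\<tau> s)) \<longlongrightarrow> trace (matrix D) - 2) (at_right s0)"
    using trace_limit[OF s0 c D] by (rule filterlim_mono) (auto simp: at_within_def)
  have neg': "\<forall>\<^sub>F s in at_right s0. monodromy_trace A \<omega> (H s) (v s) (\<tau> s) < - 2"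
    using neg by (simp add: negative_hyperbolic_orbit_def)
  \<comment> \<open>The strict inequality on the right survives only weakly in the limit; this weak
    form is the hypothesis under which the symmetric orbit is nondegenerate.\<close>
  have "trace (matrix D) - 2 \<le> - 2"
    by (rule tendsto_upperbound[OF lim]) (use neg' in \<open>auto elim: eventually_mono\<close>)
  then have le: "trace (matrix D) \<le> 0" by simp
  have "\<forall>\<^sub>F s in nhds s0. \<exists>\<theta>. doubly_symmetric_up_to_shift s \<theta>"
    by (rule eventually_doubly_symmetric[OF s0 S0 c D]) (rule doubly_symmetric_trace(2)[OF s0 S0 D0 le])
  moreover have "\<forall>\<^sub>F s in nhds s0. s \<in> J" using J_open s0 by (rule eventually_nhds_in_open)
  ultimately have "\<forall>\<^sub>F s in nhds s0. s \<in> J \<and> (\<exists>\<theta>. doubly_symmetric_up_to_shift s \<theta>)" by eventually_elim auto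
  then have "\<forall>\<^sub>F s in at_right s0. s \<in> J \<and> (\<exists>\<theta>. doubly_symmetric_up_to_shift s \<theta>)"
    by (rule filter_leD[rotated]) (auto simp: at_within_def)
  with neg' have "\<forall>\<^sub>F s in at_right s0. False"
  proof eventually_elim
    case (elim s)
    then obtain \<theta> where s: "s \<in> J" and \<theta>: "doubly_symmetric_up_to_shift s \<theta>" by blast
    obtain c where c: "c \<in> charts_at A (v s 0)" using ex_chart by blast
    then have "c \<in> charts_at A (v s (0 + 1))" using v_periodic[OF s, of 0] by simp
    then obtain D where D: "chart_deriv A c c (flow A (Y s) 1) (v s 0) D" using flow_chart_deriv(2)[OF s c] by blast
    \<comment> \<open>Symmetry up to a shift bounds the reduced trace from below by -2, against
      strict negative hyperbolicity.\<close>
    show False using doubly_symmetric_trace(1)[OF s \<theta> D] monodromy_trace_flow[OF s D] elim(1) by simp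
  qed
  then show False by (simp add: trivial_limit_at_right_real)
qed

end

theorem corollaryD:
  fixes A :: "('a::{t2_space, second_countable_topology}, real^4) chart set"
    and \<omega> :: "'a \<Rightarrow> ('a, real^4) tvec \<Rightarrow> ('a, real^4) tvec \<Rightarrow> real"
    and \<rho>\<^sub>1 \<rho>\<^sub>2 :: "'a \<Rightarrow> 'a"
    and \<epsilon> :: real
    and H :: "real \<Rightarrow> 'a \<Rightarrow> real"
    and v :: "real \<Rightarrow> real \<Rightarrow> 'a"
    and \<tau> :: "real \<Rightarrow> real"
  assumes "symplectic_manifold A \<omega>"
    and "antisymplectic_involution A \<omega> \<rho>\<^sub>1"
    and "antisymplectic_involution A \<omega> \<rho>\<^sub>2"
    and "\<rho>\<^sub>1 \<noteq> \<rho>\<^sub>2"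
    and "\<rho>\<^sub>1 \<circ> \<rho>\<^sub>2 = \<rho>\<^sub>2 \<circ> \<rho>\<^sub>1"
    and "\<epsilon> > 0"
    and "smooth_function_family A {-\<epsilon><..<\<epsilon>} H"
    and "\<And>s. s \<in> {-\<epsilon><..<\<epsilon>} \<Longrightarrow> H s \<circ> \<rho>\<^sub>1 = H s"
    and "\<And>s. s \<in> {-\<epsilon><..<\<epsilon>} \<Longrightarrow> H s \<circ> \<rho>\<^sub>2 = H s"
    and "smooth_curve_family A {-\<epsilon><..<\<epsilon>} v"
    and "smooth_on {-\<epsilon><..<\<epsilon>} \<tau>"
    and "\<And>s. s \<in> {-\<epsilon><..<\<epsilon>} \<Longrightarrow> simple_periodic_orbit A (ham_vf A \<omega> (H s)) (v s) (\<tau> s)"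
    and "\<And>s. s \<in> {-\<epsilon><..<0} \<Longrightarrow> doubly_symmetric_orbit \<rho>\<^sub>1 \<rho>\<^sub>2 (v s)"
  shows "\<not> ((\<forall>s\<in>{-\<epsilon><..<0}. elliptic_orbit A \<omega> (H s) (v s) (\<tau> s)) \<and>
            (\<forall>s\<in>{0<..<\<epsilon>}. negative_hyperbolic_orbit A \<omega> (H s) (v s) (\<tau> s)))"
proof
  assume bif: "(\<forall>s\<in>{-\<epsilon><..<0}. elliptic_orbit A \<omega> (H s) (v s) (\<tau> s)) \<and>
            (\<forall>s\<in>{0<..<\<epsilon>}. negative_hyperbolic_orbit A \<omega> (H s) (v s) (\<tau> s))"
  interpret symmetric_orbit_family A \<omega> "{-\<epsilon><..<\<epsilon>}" H \<tau> \<rho>\<^sub>1 \<rho>\<^sub>2 v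
    by unfold_locales (use assms in \<open>auto simp: symplectic_manifold_def\<close>)
  show False
  proof (rule no_period_doubling[of 0])
    show "0 \<in> {-\<epsilon><..<\<epsilon>}" using assms(6) by simp
    show "\<forall>\<^sub>F s in at_left 0. doubly_symmetric_orbit \<rho>\<^sub>1 \<rho>\<^sub>2 (v s)"
      unfolding eventually_at_left_field using assms(6,13) by (intro exI[of _ "-\<epsilon>"]) auto
    show "\<forall>\<^sub>F s in at_right 0. negative_hyperbolic_orbit A \<omega> (H s) (v s) (\<tau> s)"
      unfolding eventually_at_right_field using assms(6) bif by (intro exI[of _ \<epsilon>]) auto
  qed
qed

end
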